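(* Let $m$ be a positive integer, let $\vartheta\in\mathbb{C}$, and choose $\omega\in\mathbb{R}$ strictly larger than the real parts of all roots of the polynomial $\vartheta-(\mathtt{h}+1)^2\in\mathbb{C}[\mathtt{h}]$. Then the isomorphism classes of simple $\mathfrak{sl}_2$-modules on which the Casimir element $\mathtt{c}$ acts as the scalar $\vartheta$, which are torsion-free of rank $m$ over $\mathbb{C}[\mathtt{h}]$ and which admit a $\mathbf{C}_m$-grading, are in bijection with the regular orbits of $\mathbf{C}_m$ on $\Psi^{(m)}$. The bijection sends the orbit of a regular $\boldsymbol{\zeta}$ to the isomorphism class of the socle of the $R$-module $R/R(x^m-g_{\boldsymbol{\zeta}})$, regarded as an $\mathfrak{sl}_2$-module.
   Context: $\mathfrak{sl}_2$ is the complex Lie algebra with basis $\mathtt{e},\mathtt{f},\mathtt{h}$ and brackets $[\mathtt{h},\mathtt{e}]=2\mathtt{e}$, $[\mathtt{h},\mathtt{f}]=-2\mathtt{f}$, $[\mathtt{e},\mathtt{f}]=\mathtt{h}$. Its Casimir element is $\mathtt{c}=(\mathtt{h}+1)^2+4\mathtt{f}\mathtt{e}\in U(\mathfrak{sl}_2)$, and $U_\vartheta:=U(\mathfrak{sl}_2)/U(\mathfrak{sl}_2)(\mathtt{c}-\vartheta)$. The Cartan subalgebra is $\mathbb{C}\mathtt{h}$, with enveloping algebra $\mathbb{C}[\mathtt{h}]$. A torsion-free $\mathbb{C}[\mathtt{h}]$-module $V$ has rank $m$ if $\dim_{\mathbb{C}(\mathtt{h})}\mathbb{C}(\mathtt{h})\otimes_{\mathbb{C}[\mathtt{h}]}V=m$.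 $\mathbf{C}_m=\mathbb{Z}/m\mathbb{Z}$. $\mathfrak{sl}_2$ is graded by $\mathbf{C}_m$ with $\mathtt{e},\mathtt{h},\mathtt{f}$ of degrees $1,0,-1$. A module $V$ admits a $\mathbf{C}_m$-grading if there is a vector space decomposition $V=\bigoplus_{i\in\mathbf{C}_m}V_i$ with $\mathtt{e}V_i\subset V_{i+1}$, $\mathtt{h}V_i\subset V_i$, $\mathtt{f}V_i\subset V_{i-1}$. $\Omega_\omega$ is the set of complex numbers with real part in $[\omega,\omega+2)$. $\Psi^{(m)}$ is the set of tuples $\boldsymbol{\zeta}=(c,\zeta_0,\dots,\zeta_{m-1})$ with $c\in\mathbb{C}^\times$ and each $\zeta_i:\Omega_\omega\to\mathbb{Z}$ a function with finite support. $\mathbf{C}_m$ acts on $\Psi^{(m)}$ by cyclic permutation of $\zeta_0,\dots,\zeta_{m-1}$ (fixing $c$). An orbit is regular if it has $m$ elements, and $\boldsymbol{\zeta}$ is regular if its orbit is. Put $$g_{\boldsymbol{\zeta}}(\mathtt{h})=c\prod_{i=0}^{m-1}\prod_{\lambda\in\Omega_\omega}(\mathtt{h}-\lambda-2i)^{\zeta_i(\lambda)}\in\mathbb{C}(\mathtt{h}).$$ $R=\mathbb{C}(\mathtt{h})[x,x^{-1},\sigma]$ is the skew Laurent polynomial algebra: the free left $\mathbb{C}(\mathtt{h})$-module with basis $x^i$, $i\in\mathbb{Z}$, with $x^ix^j=x^{i+j}$ and $xa=\sigma(a)x$ for $a\in\mathbb{C}(\mathtt{h})$, where $\sigma$ is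 the $\mathbb{C}$-automorphism of $\mathbb{C}(\mathtt{h})$ with $\sigma(\mathtt{h})=\mathtt{h}-2$. An $R$-module is regarded as an $\mathfrak{sl}_2$-module via the injective algebra homomorphism $U_\vartheta\to R$ given by $\mathtt{e}\mapsto x$, $\mathtt{f}\mapsto\frac{\vartheta-(\mathtt{h}+1)^2}{4}x^{-1}$, $\mathtt{h}\mapsto\mathtt{h}$. *)

theory Defs
  imports
    "HOL-Algebra.Algebraic_Closure_Type"
    "HOL-Algebra.Free_Abelian_Groups"
    "HOL-Algebra.Group_Action"
    "HOL-Algebra.Elementary_Groups"
    "Jordan_Normal_Form.Missing_VectorSpace"
begin

section \<open>Modules over \<open>sl\<^sub>2\<close>\<close>

abbreviation complex_ring :: "complex ring" where
  "complex_ring \<equiv> ring_of_type_algebra"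

text \<open>
  A representation of the Lie algebra with basis \<open>e, f, h\<close> is a complex vector space with three
  linear operators satisfying the bracket relations. The fields \<open>mult\<close> and \<open>one\<close> inherited from
  the record \<open>module\<close> carry no meaning.
\<close>

record 'v sl2_struct = "(complex, 'v) module" +
  act_e :: "'v \<Rightarrow> 'v"
  act_f :: "'v \<Rightarrow> 'v"
  act_h :: "'v \<Rightarrow> 'v"

locale sl2_module = module complex_ring V for V :: "('v, 'z) sl2_struct_scheme" (structure) +
  assumes act_e_linear: "act_e V \<in> module_hom complex_ring V V"
    and act_f_linear: "act_f V \<in> module_hom complex_ring V V"
    and act_h_linear: "act_h V \<in> module_hom complex_ring V V"
    and bracket_h_e: "v \<in> carrier V \<Longrightarrow>
      act_h V (act_e V v) \<ominus> act_e V (act_h V v) = 2 \<odot>\<^bsub>V\<^esub> act_e V v"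
    and bracket_h_f: "v \<in> carrier V \<Longrightarrow>
      act_h V (act_f V v) \<ominus> act_f V (act_h V v) = (-2) \<odot>\<^bsub>V\<^esub> act_f V v"
    and bracket_e_f: "v \<in> carrier V \<Longrightarrow>
      act_e V (act_f V v) \<ominus> act_f V (act_e V v) = act_h V v"

text \<open>The action of \<open>c = (h + 1)\<^sup>2 + 4 f e\<close>.\<close>

definition casimir :: "('v, 'z) sl2_struct_scheme \<Rightarrow> 'v \<Rightarrow> 'v" where
  "casimir V v =
     (let h1 = (\<lambda>w. act_h V w \<oplus>\<^bsub>V\<^esub> w) in h1 (h1 v) \<oplus>\<^bsub>V\<^esub> 4 \<odot>\<^bsub>V\<^esub> act_f V (act_e V v))"

definition sl2_iso :: "('v, 'y) sl2_struct_scheme \<Rightarrow> ('w, 'z) sl2_struct_scheme \<Rightarrow> bool" where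
  "sl2_iso V W \<longleftrightarrow> (\<exists>\<phi> \<in> module_hom complex_ring V W. bij_betw \<phi> (carrier V) (carrier W) \<and>
     (\<forall>v \<in> carrier V. \<phi> (act_e V v) = act_e W (\<phi> v) \<and>
        \<phi> (act_f V v) = act_f W (\<phi> v) \<and> \<phi> (act_h V v) = act_h W (\<phi> v)))"

text \<open>
  The classes of the following relation are sets of structures on one carrier type. That a carrier
  type is large enough to realize every module of interest has to be stated separately.
\<close>

definition sl2_iso_rel :: "('v sl2_struct \<times> 'v sl2_struct) set" where
  "sl2_iso_rel = {(V, W). sl2_module V \<and> sl2_module W \<and> sl2_iso V W}"

definition sl2_submodule :: "'v set \<Rightarrow> ('v, 'z) sl2_struct_scheme \<Rightarrow> bool" where
  "sl2_submodule S V \<longleftrightarrow> Module.submodule S complex_ring V \<and>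
     (\<forall>v \<in> S. act_e V v \<in> S \<and> act_f V v \<in> S \<and> act_h V v \<in> S)"

definition sl2_simple :: "('v, 'z) sl2_struct_scheme \<Rightarrow> bool" where
  "sl2_simple V \<longleftrightarrow> sl2_module V \<and> carrier V \<noteq> {\<zero>\<^bsub>V\<^esub>} \<and>
     (\<forall>S. sl2_submodule S V \<longrightarrow> S = {\<zero>\<^bsub>V\<^esub>} \<or> S = carrier V)"

text \<open>The socle is the sum of all simple submodules.\<close>

definition socle :: "('v, 'z) sl2_struct_scheme \<Rightarrow> ('v, 'z) sl2_struct_scheme" where
  "socle V = V\<lparr>carrier := generate (add_monoid V)
     (\<Union>{S. sl2_submodule S V \<and> sl2_simple (V\<lparr>carrier := S\<rparr>)})\<rparr>"

text \<open>A grading by \<open>\<int>/m\<int>\<close>; the residue classes are represented by \<open>0, \<dots>, m - 1\<close>.\<close>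

definition is_cyclic_grading ::
    "nat \<Rightarrow> ('v, 'z) sl2_struct_scheme \<Rightarrow> (int \<Rightarrow> 'v set) \<Rightarrow> bool" where
  "is_cyclic_grading m V W \<longleftrightarrow>
     (\<forall>i \<in> {0..<int m}. Module.submodule (W i) complex_ring V \<and>
        act_e V ` W i \<subseteq> W ((i + 1) mod int m) \<and>
        act_h V ` W i \<subseteq> W i \<and>
        act_f V ` W i \<subseteq> W ((i - 1) mod int m)) \<and>
     (\<forall>v \<in> carrier V. \<exists>!u. u \<in> PiE {0..<int m} W \<and> v = finsum V u {0..<int m})"

definition admits_cyclic_grading :: "nat \<Rightarrow> ('v, 'z) sl2_struct_scheme \<Rightarrow> bool" where
  "admits_cyclic_grading m V \<longleftrightarrow> (\<exists>W. is_cyclic_grading m V W)"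


section \<open>Torsion-free modules and rank\<close>

text \<open>The underlying module over \<open>\<complex>[h]\<close>, where \<open>h\<close> is the polynomial variable.\<close>

definition poly_h_module :: "('v, 'z) sl2_struct_scheme \<Rightarrow> (complex poly, 'v) module" where
  "poly_h_module V = \<lparr>carrier = carrier V, monoid.mult = undefined, one = undefined,
     ring.zero = \<zero>\<^bsub>V\<^esub>, add = add V,
     module.smult = (\<lambda>p v. finsum V (\<lambda>i. poly.coeff p i \<odot>\<^bsub>V\<^esub> (act_h V ^^ i) v)
       {..Polynomial.degree p})\<rparr>"

definition torsion_free :: "('a::idom, 'v) module \<Rightarrow> bool" where
  "torsion_free M \<longleftrightarrow>
     (\<forall>a. \<forall>v \<in> carrier M. a \<noteq> 0 \<and> a \<odot>\<^bsub>M\<^esub> v = \<zero>\<^bsub>M\<^esub> \<longrightarrow> v = \<zero>\<^bsub>M\<^esub>)"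

text \<open>
  The tensor product of the field of fractions of \<open>A\<close> with an \<open>A\<close>-module \<open>M\<close> over \<open>A\<close>: the free
  abelian group on pairs (a generator \<open>(k, v)\<close> being written \<open>frag_of (k, v)\<close>) modulo the subgroup
  generated by the bilinearity and balancing relations, with scalars acting on the left factor.
\<close>

definition tensor_relations ::
    "('a::idom, 'v) module \<Rightarrow> (('a fract \<times> 'v) \<Rightarrow>\<^sub>0 int) set" where
  "tensor_relations M =
     {frag_of (k + l, v) - frag_of (k, v) - frag_of (l, v) | k l v. v \<in> carrier M} \<union>
     {frag_of (k, v \<oplus>\<^bsub>M\<^esub> w) - frag_of (k, v) - frag_of (k, w) | k v w.
        v \<in> carrier M \<and> w \<in> carrier M} \<union>
     {frag_of (k * Fract a 1, v) - frag_of (k, a \<odot>\<^bsub>M\<^esub> v) | k a v. v \<in> carrier M}"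

definition fract_tensor ::
    "('a::idom, 'v) module \<Rightarrow> ('a fract, (('a fract \<times> 'v) \<Rightarrow>\<^sub>0 int) set) module" where
  "fract_tensor M =
     (let F = free_Abelian_group (UNIV \<times> carrier M);
          N = generate F (tensor_relations M)
      in \<lparr>carrier = rcosets\<^bsub>F\<^esub> N, monoid.mult = undefined, one = undefined,
          ring.zero = N, add = set_mult F,
          module.smult =
            (\<lambda>k T. \<Union>c\<in>T. N #>\<^bsub>F\<^esub> frag_extend (\<lambda>(l, v). frag_of (k * l, v)) c)\<rparr>)"

definition has_rank :: "('a::idom, 'v) module \<Rightarrow> nat \<Rightarrow> bool" where
  "has_rank M m \<longleftrightarrow>
     vectorspace.fin_dim (ring_of_type_algebra :: 'a fract ring) (fract_tensor M) \<and>
     vectorspace.dim (ring_of_type_algebra :: 'a fract ring) (fract_tensor M) = m"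

definition graded_simple_of_rank ::
    "nat \<Rightarrow> complex \<Rightarrow> ('v, 'z) sl2_struct_scheme \<Rightarrow> bool" where
  "graded_simple_of_rank m \<theta> V \<longleftrightarrow>
     sl2_simple V \<and>
     (\<forall>v \<in> carrier V. casimir V v = \<theta> \<odot>\<^bsub>V\<^esub> v) \<and>
     torsion_free (poly_h_module V) \<and> has_rank (poly_h_module V) m \<and>
     admits_cyclic_grading m V"


section \<open>The skew Laurent polynomial algebra\<close>

type_synonym ratfun = "complex poly fract"

abbreviation ratfun_of_poly :: "complex poly \<Rightarrow> ratfun" where
  "ratfun_of_poly p \<equiv> Fract p 1"

text \<open>The substitution \<open>q(h) \<mapsto> q(h - s)\<close> on rational functions.\<close>

lemma pcompose_shift_eq_0_iff [simp]:
  fixes p :: "complex poly"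
  shows "pcompose p [:- s, 1:] = 0 \<longleftrightarrow> p = 0"
  by (rule pcompose_eq_0_iff) auto

definition ratfun_shift :: "complex \<Rightarrow> ratfun \<Rightarrow> ratfun" where
  "ratfun_shift s a =
     (case quot_of_fract a of (p, q) \<Rightarrow> Fract (pcompose p [:- s, 1:]) (pcompose q [:- s, 1:]))"

lemma ratfun_shift_Fract:
  assumes "q \<noteq> 0"
  shows "ratfun_shift s (Fract p q) = Fract (pcompose p [:- s, 1:]) (pcompose q [:- s, 1:])"
proof -
  obtain p' q' where eq: "quot_of_fract (Fract p q) = (p', q')"
    by (metis surj_pair)
  have "q' \<noteq> 0"
    using snd_quot_of_fract_nonzero [of "Fract p q"] eq by simp
  have "Fract p' q' = Fract p q"
    using quot_to_fract_quot_of_fract [of "Fract p q"] by (simp add: eq quot_to_fract_def)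
  then have "p' * q = p * q'"
    using assms \<open>q' \<noteq> 0\<close> by (simp add: eq_fract)
  then have "pcompose (p' * q) [:- s, 1:] = pcompose (p * q') [:- s, 1:]"
    by simp
  then show ?thesis
    using assms \<open>q' \<noteq> 0\<close> by (simp add: ratfun_shift_def eq eq_fract pcompose_mult)
qed

abbreviation \<sigma> :: "ratfun \<Rightarrow> ratfun" where
  "\<sigma> \<equiv> ratfun_shift 2"

lemma \<sigma>_h: "\<sigma> (ratfun_of_poly [:0, 1:]) = ratfun_of_poly [:- 2, 1:]"
  by (simp add: ratfun_shift_Fract pcompose_pCons pcompose_1)

lemma ratfun_shift_const: "ratfun_shift s (ratfun_of_poly [:c:]) = ratfun_of_poly [:c:]"
  by (simp add: ratfun_shift_Fract pcompose_1)

lemma ratfun_shift_0 [simp]: "ratfun_shift s 0 = 0"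
  by (simp add: Zero_fract_def ratfun_shift_Fract pcompose_1)

lemma ratfun_shift_1 [simp]: "ratfun_shift s 1 = 1"
  by (simp add: One_fract_def ratfun_shift_Fract pcompose_1)

lemma ratfun_shift_add: "ratfun_shift s (a + b) = ratfun_shift s a + ratfun_shift s b"
  by (cases a; cases b) (simp add: ratfun_shift_Fract pcompose_add pcompose_mult)

lemma ratfun_shift_mult: "ratfun_shift s (a * b) = ratfun_shift s a * ratfun_shift s b"
  by (cases a; cases b) (simp add: ratfun_shift_Fract pcompose_mult)

lemma ratfun_shift_shift: "ratfun_shift s (ratfun_shift t a) = ratfun_shift (s + t) a"
  by (cases a) (simp add: ratfun_shift_Fract pcompose_assoc [symmetric] pcompose_pCons add.commute)

lemma ratfun_shift_by_0 [simp]: "ratfun_shift 0 a = a"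
  by (cases a) (simp add: ratfun_shift_Fract pcompose_idR)

text \<open>
  An element \<open>\<Sum>\<^sub>i a\<^sub>i x\<^sup>i\<close> is represented by its finitely supported coefficient family. As
  \<open>x\<^sup>i b = \<sigma>\<^sup>i(b) x\<^sup>i\<close> and \<open>\<sigma>\<^sup>i(b)(h) = b(h - 2 i)\<close>, the product of \<open>a x\<^sup>i\<close> and \<open>b x\<^sup>j\<close> is
  \<open>a \<sigma>\<^sup>i(b) x\<^sup>i\<^sup>+\<^sup>j\<close>.
\<close>

definition skew_times :: "(int \<Rightarrow>\<^sub>0 ratfun) \<Rightarrow> (int \<Rightarrow>\<^sub>0 ratfun) \<Rightarrow> (int \<Rightarrow>\<^sub>0 ratfun)" where
  "skew_times p q = (\<Sum>i\<in>Poly_Mapping.keys p. \<Sum>j\<in>Poly_Mapping.keys q.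
     Poly_Mapping.single (i + j)
       (Poly_Mapping.lookup p i * ratfun_shift (2 * of_int i) (Poly_Mapping.lookup q j)))"

lemma skew_times_superset:
  assumes "finite A" "Poly_Mapping.keys p \<subseteq> A" "finite B" "Poly_Mapping.keys q \<subseteq> B"
  shows "skew_times p q = (\<Sum>i\<in>A. \<Sum>j\<in>B. Poly_Mapping.single (i + j)
    (Poly_Mapping.lookup p i * ratfun_shift (2 * of_int i) (Poly_Mapping.lookup q j)))"
proof -
  have "skew_times p q = (\<Sum>i\<in>Poly_Mapping.keys p. \<Sum>j\<in>B. Poly_Mapping.single (i + j)
    (Poly_Mapping.lookup p i * ratfun_shift (2 * of_int i) (Poly_Mapping.lookup q j)))"
    unfolding skew_times_def
    by (intro sum.cong refl sum.mono_neutral_left) (use assms in \<open>auto simp: in_keys_iff\<close>)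
  also have "\<dots> = (\<Sum>i\<in>A. \<Sum>j\<in>B. Poly_Mapping.single (i + j)
    (Poly_Mapping.lookup p i * ratfun_shift (2 * of_int i) (Poly_Mapping.lookup q j)))"
    by (intro sum.mono_neutral_left) (use assms in \<open>auto simp: in_keys_iff\<close>)
  finally show ?thesis .
qed

lemma skew_times_add_left: "skew_times (p + p') q = skew_times p q + skew_times p' q"
proof -
  let ?A = "Poly_Mapping.keys p \<union> Poly_Mapping.keys p'" and ?B = "Poly_Mapping.keys q"
  note sup = skew_times_superset [of ?A _ ?B q]
  have "Poly_Mapping.keys (p + p') \<subseteq> ?A"
    by (rule Poly_Mapping.keys_add)
  then show ?thesis
    by (simp add: sup lookup_add distrib_right single_add sum.distrib)
qed

lemma skew_times_add_right: "skew_times p (q + q') = skew_times p q + skew_times p q'"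
proof -
  let ?A = "Poly_Mapping.keys p" and ?B = "Poly_Mapping.keys q \<union> Poly_Mapping.keys q'"
  note sup = skew_times_superset [of ?A p ?B]
  have "Poly_Mapping.keys (q + q') \<subseteq> ?B"
    by (rule Poly_Mapping.keys_add)
  then show ?thesis
    by (simp add: sup lookup_add distrib_left ratfun_shift_add single_add sum.distrib)
qed

lemma skew_times_0 [simp]: "skew_times 0 q = 0" "skew_times p 0 = 0"
  by (simp_all add: skew_times_def)

lemma skew_times_single:
  "skew_times (Poly_Mapping.single i a) (Poly_Mapping.single j b) =
     Poly_Mapping.single (i + j) (a * ratfun_shift (2 * of_int i) b)"
  by (subst skew_times_superset [of "{i}" _ "{j}"]) auto

lemma skew_induct [case_names zero single add]:
  fixes p :: "int \<Rightarrow>\<^sub>0 ratfun"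
  assumes "P 0" "\<And>i a. P (Poly_Mapping.single i a)" "\<And>p q. P p \<Longrightarrow> P q \<Longrightarrow> P (p + q)"
  shows "P p"
proof (induction p rule: update_induct)
  case const
  show ?case by (rule assms)
next
  case (update f a b)
  have "Poly_Mapping.update a b f = Poly_Mapping.single a b + f"
    using update.hyps by (intro poly_mapping_eqI)
      (auto simp: lookup_update lookup_add lookup_single in_keys_iff when_def)
  then show ?case
    using assms update.IH by simp
qed

lemma skew_times_assoc: "skew_times (skew_times p q) r = skew_times p (skew_times q r)"
proof (induction p rule: skew_induct)
  case (single i a)
  show ?case
  proof (induction q rule: skew_induct)
    case (single j b)
    show ?case
    proof (induction r rule: skew_induct)
      case (single k c)
      show ?case
        by (simp add: skew_times_single ratfun_shift_mult ratfun_shift_shift algebra_simps)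
    qed (simp_all add: skew_times_add_right)
  qed (simp_all add: skew_times_add_right skew_times_add_left)
qed (simp_all add: skew_times_add_left)

lemma skew_times_one:
  "skew_times (Poly_Mapping.single 0 1) p = p" "skew_times p (Poly_Mapping.single 0 1) = p"
  by (induction p rule: skew_induct)
    (simp_all add: skew_times_single skew_times_add_left skew_times_add_right del: single_one)

typedef skew_laurent = "UNIV :: (int \<Rightarrow>\<^sub>0 ratfun) set"
  morphisms skew_coeffs Abs_skew_laurent ..

setup_lifting type_definition_skew_laurent

instantiation skew_laurent :: ring_1
begin

lift_definition zero_skew_laurent :: skew_laurent is 0 .
lift_definition one_skew_laurent :: skew_laurent is "Poly_Mapping.single 0 1" .
lift_definition plus_skew_laurent :: "skew_laurent \<Rightarrow> skew_laurent \<Rightarrow> skew_laurent" is "(+)" .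
lift_definition minus_skew_laurent :: "skew_laurent \<Rightarrow> skew_laurent \<Rightarrow> skew_laurent" is "(-)" .
lift_definition uminus_skew_laurent :: "skew_laurent \<Rightarrow> skew_laurent" is uminus .
lift_definition times_skew_laurent :: "skew_laurent \<Rightarrow> skew_laurent \<Rightarrow> skew_laurent"
  is skew_times .

instance
proof
  show "(0::skew_laurent) \<noteq> 1"
    by (simp add: skew_coeffs_inject [symmetric] zero_skew_laurent.rep_eq one_skew_laurent.rep_eq)
qed (simp_all add: skew_coeffs_inject [symmetric] zero_skew_laurent.rep_eq one_skew_laurent.rep_eq
       plus_skew_laurent.rep_eq minus_skew_laurent.rep_eq uminus_skew_laurent.rep_eq
       times_skew_laurent.rep_eq skew_times_assoc skew_times_one skew_times_add_left
       skew_times_add_right add.assoc add.commute del: single_one)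

end

text \<open>The monomial \<open>a x\<^sup>i\<close>.\<close>

definition skew_monom :: "ratfun \<Rightarrow> int \<Rightarrow> skew_laurent" where
  "skew_monom a i = Abs_skew_laurent (Poly_Mapping.single i a)"

abbreviation skew_const :: "ratfun \<Rightarrow> skew_laurent" where
  "skew_const a \<equiv> skew_monom a 0"

abbreviation skew_x :: skew_laurent where
  "skew_x \<equiv> skew_monom 1 1"

lemma skew_monom_mult:
  "skew_monom a i * skew_monom b j = skew_monom (a * ratfun_shift (2 * of_int i) b) (i + j)"
  by (simp add: skew_monom_def times_skew_laurent.abs_eq skew_times_single)

lemma skew_x_const: "skew_x * skew_const a = skew_const (\<sigma> a) * skew_x"
  by (simp add: skew_monom_mult)

text \<open>The left module \<open>R / R p\<close>; note that \<open>PIdl\<close> is the left ideal of left multiples.\<close>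

definition left_quotient :: "'r::ring_1 \<Rightarrow> ('r, 'r set) module" where
  "left_quotient p =
     (let R = ring_of_type_algebra :: 'r ring; I = PIdl\<^bsub>R\<^esub> p
      in \<lparr>carrier = a_rcosets\<^bsub>R\<^esub> I, monoid.mult = undefined, one = undefined,
          ring.zero = I, add = set_add R,
          module.smult = (\<lambda>r T. \<Union>y\<in>T. I +>\<^bsub>R\<^esub> (r * y))\<rparr>)"

text \<open>
  Restriction of an \<open>R\<close>-module to \<open>sl\<^sub>2\<close> along \<open>e \<mapsto> x\<close>,
  \<open>f \<mapsto> (\<theta> - (h + 1)\<^sup>2) / 4 \<cdot> x\<^sup>-\<^sup>1\<close>, \<open>h \<mapsto> h\<close>.
\<close>

definition restrict_sl2 :: "complex \<Rightarrow> (skew_laurent, 'v) module \<Rightarrow> 'v sl2_struct" where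
  "restrict_sl2 \<theta> N = \<lparr>carrier = carrier N, monoid.mult = undefined, one = undefined,
     ring.zero = \<zero>\<^bsub>N\<^esub>, add = add N,
     module.smult = (\<lambda>c v. skew_const (ratfun_of_poly [:c:]) \<odot>\<^bsub>N\<^esub> v),
     act_e = (\<lambda>v. skew_x \<odot>\<^bsub>N\<^esub> v),
     act_f = (\<lambda>v. skew_monom (ratfun_of_poly ([:\<theta>:] - [:1, 1:]^2) / 4) (-1) \<odot>\<^bsub>N\<^esub> v),
     act_h = (\<lambda>v. skew_const (ratfun_of_poly [:0, 1:]) \<odot>\<^bsub>N\<^esub> v)\<rparr>"


section \<open>The parameter set\<close>

definition \<Omega> :: "real \<Rightarrow> complex set" where
  "\<Omega> \<omega> = {z. \<omega> \<le> Re z \<and> Re z < \<omega> + 2}"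

text \<open>
  The functions \<open>\<zeta>\<^sub>0, \<dots>, \<zeta>\<^bsub>m-1\<^esub>\<close> on \<open>\<Omega>\<^sub>\<omega>\<close> are extended by zero to all complex numbers and
  collected in a list.
\<close>

type_synonym parameter = "complex \<times> (complex \<Rightarrow>\<^sub>0 int) list"

definition \<Psi> :: "nat \<Rightarrow> real \<Rightarrow> parameter set" where
  "\<Psi> m \<omega> = {(c, zs). c \<noteq> 0 \<and> length zs = m \<and> (\<forall>z \<in> set zs. Poly_Mapping.keys z \<subseteq> \<Omega> \<omega>)}"

definition cyclic_action :: "nat \<Rightarrow> real \<Rightarrow> int \<Rightarrow> parameter \<Rightarrow> parameter" where
  "cyclic_action m \<omega> k = (\<lambda>\<zeta> \<in> \<Psi> m \<omega>. (fst \<zeta>, rotate (nat k) (snd \<zeta>)))"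

abbreviation \<Psi>_orbit :: "nat \<Rightarrow> real \<Rightarrow> parameter \<Rightarrow> parameter set" where
  "\<Psi>_orbit m \<omega> \<zeta> \<equiv> Group_Action.orbit (integer_mod_group m) (cyclic_action m \<omega>) \<zeta>"

definition regular_orbits :: "nat \<Rightarrow> real \<Rightarrow> parameter set set" where
  "regular_orbits m \<omega> =
     {Y \<in> orbits (integer_mod_group m) (\<Psi> m \<omega>) (cyclic_action m \<omega>). card Y = m}"

definition is_regular :: "nat \<Rightarrow> real \<Rightarrow> parameter \<Rightarrow> bool" where
  "is_regular m \<omega> \<zeta> \<longleftrightarrow> \<zeta> \<in> \<Psi> m \<omega> \<and> card (\<Psi>_orbit m \<omega> \<zeta>) = m"

definition g_ratfun :: "parameter \<Rightarrow> ratfun" where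
  "g_ratfun \<zeta> = ratfun_of_poly [:fst \<zeta>:] *
     (\<Prod>i<length (snd \<zeta>). \<Prod>z\<in>Poly_Mapping.keys (snd \<zeta> ! i).
        ratfun_of_poly [:- (z + 2 * of_nat i), 1:] powi Poly_Mapping.lookup (snd \<zeta> ! i) z)"

text \<open>The socle is taken over \<open>sl\<^sub>2\<close>, not over \<open>R\<close>.\<close>

definition socle_module :: "nat \<Rightarrow> complex \<Rightarrow> parameter \<Rightarrow> skew_laurent set sl2_struct" where
  "socle_module m \<theta> \<zeta> =
     socle (restrict_sl2 \<theta> (left_quotient (skew_x ^ m - skew_const (g_ratfun \<zeta>))))"

end

theory Submission
  imports Defs
begin

text \<open>
  Write \<open>K = \<complex>(h)\<close>. A torsion-free module with Casimir \<open>\<theta>\<close> embeds into its localization at the nonzero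
  polynomials in \<open>h\<close>, which is an \<open>R\<close>-module, and meets every nonzero \<open>R\<close>-submodule of it.
  In \<open>R / R(x\<^sup>m - g)\<close> the element \<open>x\<close> permutes the lines \<open>K x\<^sup>i\<close>, and the module is simple if \<open>g\<close> is
  \<open>aperiodic\<close>: no two of \<open>g, \<sigma>(g), \<dots>, \<sigma>\<^sup>m\<^sup>-\<^sup>1(g)\<close> differ by a factor \<open>\<sigma>\<^sup>m(a) / a\<close>. Since
  \<open>\<omega> \<le> Re z < \<omega> + 2m\<close> is a fundamental domain for the shift by \<open>2m\<close>, every \<open>g\<close> agrees up to such a
  factor with exactly one \<open>g\<^sub>\<zeta>\<close>; as \<open>\<sigma>\<close> rotates the parameter, aperiodicity means that \<open>\<zeta>\<close> is regular.

  The choice of \<open>\<omega>\<close> makes the socle of \<open>R / R(x\<^sup>m - g\<^sub>\<zeta>)\<close> the submodule generated by \<open>1\<close>. Indeed a nonzero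
  submodule contains \<open>p \<cdot> 1\<close> for some polynomial \<open>p \<noteq> 0\<close>, and for large \<open>k\<close> the vectors \<open>e\<^sup>m\<^sup>k p \<cdot> 1\<close> and
  \<open>f\<^sup>m\<^sup>k p \<cdot> 1\<close> give multiples of \<open>1\<close> by polynomials whose roots lie to the right and to the left of the
  line \<open>Re z = \<omega>\<close>; these are coprime.

  Conversely, the homogeneous components of a graded module of rank \<open>m\<close> have rank one, so a homogeneous
  vector \<open>u\<close> satisfies \<open>e\<^sup>m u = g u\<close> for some \<open>g\<close>, and \<open>e\<^sup>i u \<mapsto> x\<^sup>i\<close> is an embedding into
  \<open>R / R(x\<^sup>m - g)\<close>. If \<open>g\<close> were periodic, right multiplication by some \<open>a x\<^sup>j\<close> would be an endomorphism
  with a proper nonzero eigenspace.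
\<close>

section \<open>Rational functions up to coboundaries\<close>

text \<open>The localization is never formed. A module, on whatever type its carrier lives, is
  compared with the fixed space \<open>coord_module m g\<close> through an injective map respecting
  e, f and h (\<open>coord_embedding\<close>), and its properties are read off from the image. For
  aperiodic g = \<open>g_ratfun \<zeta>\<close> there is a least nonzero \<open>stable\<close>
  subspace of the coordinates, \<open>core\<close>, and a simple module embedded there has image
  exactly \<open>core\<close>. Isomorphisms thus reduce to equality of subsets; the only freedom
  left is g, which right multiplication by a x^j replaces by a cohomologous or shifted one.

  The obstacle is that e acts as x, but f only as a polynomial times x^-1, and vectors cannot be
  divided by polynomials. An sl2-submodule therefore need not be an R-submodule. Enlarging it to all
  vectors with a nonzero polynomial multiple in it makes it one, so that simplicity over R applies.
  Removing the polynomial again is the delicate half, and there the condition on \<omega>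
  enters.\<close>

lemma ratfun_of_poly_add: "ratfun_of_poly (p + q) = ratfun_of_poly p + ratfun_of_poly q"
  by simp

lemma ratfun_of_poly_mult: "ratfun_of_poly (p * q) = ratfun_of_poly p * ratfun_of_poly q"
  by simp

lemma ratfun_of_poly_eq_0_iff [simp]: "ratfun_of_poly p = 0 \<longleftrightarrow> p = 0"
  by (simp add: Zero_fract_def eq_fract)

lemma ratfun_of_poly_eq_iff [simp]: "ratfun_of_poly p = ratfun_of_poly q \<longleftrightarrow> p = q"
  by (simp add: eq_fract)

lemma ratfun_of_poly_1 [simp]: "ratfun_of_poly 1 = 1"
  by (simp add: One_fract_def)

lemma ratfun_of_poly_0 [simp]: "ratfun_of_poly 0 = 0"
  by simp

lemma ratfun_of_poly_const_1 [simp]: "ratfun_of_poly [:1:] = 1"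
  by (simp add: One_fract_def one_pCons)

lemma ratfun_of_poly_uminus: "ratfun_of_poly (- p) = - ratfun_of_poly p"
  by simp

lemma ratfun_of_poly_diff: "ratfun_of_poly (p - q) = ratfun_of_poly p - ratfun_of_poly q"
  by simp

lemma ratfun_shift_of_poly:
  "ratfun_shift s (ratfun_of_poly p) = ratfun_of_poly (pcompose p [:- s, 1:])"
  by (simp add: ratfun_shift_Fract pcompose_1)

lemma ratfun_shift_uminus: "ratfun_shift s (- a) = - ratfun_shift s a"
  using ratfun_shift_add [of s a "- a"] by (simp add: eq_neg_iff_add_eq_0 add.commute)

lemma ratfun_shift_eq_iff [simp]: "ratfun_shift s a = ratfun_shift s b \<longleftrightarrow> a = b"
  by (metis ratfun_shift_shift ratfun_shift_by_0 add.left_inverse)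

lemma ratfun_shift_eq_0_iff [simp]: "ratfun_shift s a = 0 \<longleftrightarrow> a = 0"
  by (metis ratfun_shift_eq_iff ratfun_shift_0)

lemma ratfun_shift_inverse: "ratfun_shift s (inverse a) = inverse (ratfun_shift s a)"
proof (cases "a = 0")
  case False
  then have "ratfun_shift s (inverse a) * ratfun_shift s a = 1"
    by (simp add: ratfun_shift_mult [symmetric])
  then show ?thesis
    by (metis inverse_unique mult.commute)
qed simp

lemma ratfun_shift_power: "ratfun_shift s (a ^ n) = ratfun_shift s a ^ n"
  by (induction n) (auto simp: ratfun_shift_mult)

lemma ratfun_shift_powi: "ratfun_shift s (a powi n) = ratfun_shift s a powi n"
  by (simp add: power_int_def ratfun_shift_power ratfun_shift_inverse)

lemma ratfun_shift_prod: "ratfun_shift s (prod f A) = (\<Prod>i\<in>A. ratfun_shift s (f i))"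
  by (induction A rule: infinite_finite_induct) (auto simp: ratfun_shift_mult)

section \<open>Orders of vanishing and leading coefficients of rational functions\<close>

lemma order_pcompose_shift:
  fixes p :: "complex poly"
  assumes "p \<noteq> 0"
  shows "order z (pcompose p [:- s, 1:]) = order (z - s) p"
proof -
  obtain q where q: "p = [:- (z - s), 1:] ^ order (z - s) p * q" "\<not> [:- (z - s), 1:] dvd q"
    using order_decomp [OF assms] by blast
  let ?n = "order (z - s) p"
  have pow: "pcompose (r ^ n) t = pcompose r t ^ n" for r t :: "complex poly" and n
    by (induction n) (auto simp: pcompose_mult pcompose_1)
  have eq: "pcompose p [:- s, 1:] = [:- z, 1:] ^ ?n * pcompose q [:- s, 1:]"
    by (subst q(1)) (simp add: pcompose_mult pow pcompose_pCons)
  have "poly (pcompose q [:- s, 1:]) z \<noteq> 0"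
    using q(2) by (simp add: poly_pcompose poly_eq_0_iff_dvd)
  then have 1: "order z (pcompose q [:- s, 1:]) = 0"
    by (rule order_0I)
  have "pcompose p [:- s, 1:] \<noteq> 0"
    using assms by simp
  then show ?thesis
    unfolding eq by (subst order_mult) (auto simp: 1 order_power_n_n)
qed

text \<open>The valuation of \<complex>(h) at z: positive at zeros, negative at poles. It is
  computed from the reduced fraction, but any fraction gives the same value. At 0 the value carries
  no meaning, so the rules below assume nonzero arguments.\<close>

definition ratfun_order :: "complex \<Rightarrow> ratfun \<Rightarrow> int" where
  "ratfun_order z a = (case quot_of_fract a of (p, q) \<Rightarrow> int (order z p) - int (order z q))"

text \<open>The leading coefficient at infinity. A shift of h moves the orders but fixes this
  number, so it survives as the constant c of a normal form.\<close>

definition ratfun_lead :: "ratfun \<Rightarrow> complex" where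
  "ratfun_lead a = (case quot_of_fract a of (p, q) \<Rightarrow> lead_coeff p / lead_coeff q)"

lemma quot_of_FractE:
  fixes p q :: "complex poly"
  assumes "p \<noteq> 0" "q \<noteq> 0"
  obtains p' q' where "quot_of_fract (Fract p q) = (p', q')" "p' \<noteq> 0" "q' \<noteq> 0" "p' * q = p * q'"
proof -
  obtain p' q' where eq: "quot_of_fract (Fract p q) = (p', q')"
    by (metis surj_pair)
  have q': "q' \<noteq> 0"
    using snd_quot_of_fract_nonzero [of "Fract p q"] eq by simp
  have "Fract p' q' = Fract p q"
    using quot_to_fract_quot_of_fract [of "Fract p q"] by (simp add: eq quot_to_fract_def)
  then have e: "p' * q = p * q'"
    using assms q' by (simp add: eq_fract)
  then have "p' \<noteq> 0"
    using assms q' by auto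
  then show ?thesis
    using that eq q' e by blast
qed

lemma ratfun_order_Fract:
  assumes "p \<noteq> 0" "q \<noteq> 0"
  shows "ratfun_order z (Fract p q) = int (order z p) - int (order z q)"
proof -
  obtain p' q' where *: "quot_of_fract (Fract p q) = (p', q')" "p' \<noteq> 0" "q' \<noteq> 0"
      "p' * q = p * q'"
    using quot_of_FractE [OF assms] .
  have "order z (p' * q) = order z (p * q')"
    by (simp add: *(4))
  then have "order z p' + order z q = order z p + order z q'"
    using assms *(2,3) by (metis order_mult mult_eq_0_iff)
  then show ?thesis
    by (simp add: ratfun_order_def *)
qed

lemma ratfun_lead_Fract:
  assumes "p \<noteq> 0" "q \<noteq> 0"
  shows "ratfun_lead (Fract p q) = lead_coeff p / lead_coeff q"
proof -
  obtain p' q' where *: "quot_of_fract (Fract p q) = (p', q')" "p' \<noteq> 0" "q' \<noteq> 0"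
      "p' * q = p * q'"
    using quot_of_FractE [OF assms] .
  have "lead_coeff (p' * q) = lead_coeff (p * q')"
    by (simp add: *(4))
  then have "lead_coeff p' * lead_coeff q = lead_coeff p * lead_coeff q'"
    by (simp add: lead_coeff_mult)
  then show ?thesis
    using assms * by (simp add: ratfun_lead_def * frac_eq_eq)
qed

lemma ratfun_nonzeroE:
  fixes a :: ratfun
  assumes "a \<noteq> 0"
  obtains p q where "a = Fract p q" "p \<noteq> 0" "q \<noteq> 0"
  using assms by (metis Fract_cases_nonzero)

lemma ratfun_order_mult:
  assumes "a \<noteq> 0" "b \<noteq> 0"
  shows "ratfun_order z (a * b) = ratfun_order z a + ratfun_order z b"
  using assms
  by - (erule ratfun_nonzeroE, erule ratfun_nonzeroE, simp add: ratfun_order_Fract order_mult)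

lemma ratfun_lead_mult:
  assumes "a \<noteq> 0" "b \<noteq> 0"
  shows "ratfun_lead (a * b) = ratfun_lead a * ratfun_lead b"
  using assms
  by - (erule ratfun_nonzeroE, erule ratfun_nonzeroE, simp add: ratfun_lead_Fract lead_coeff_mult)

lemma ratfun_order_shift: "a \<noteq> 0 \<Longrightarrow> ratfun_order z (ratfun_shift s a) = ratfun_order (z - s) a"
  by (erule ratfun_nonzeroE) (simp add: ratfun_shift_Fract ratfun_order_Fract order_pcompose_shift)

lemma ratfun_lead_shift: "a \<noteq> 0 \<Longrightarrow> ratfun_lead (ratfun_shift s a) = ratfun_lead a"
  by (erule ratfun_nonzeroE) (simp add: ratfun_shift_Fract ratfun_lead_Fract lead_coeff_comp)

lemma ratfun_lead_nonzero: "a \<noteq> 0 \<Longrightarrow> ratfun_lead a \<noteq> 0"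
  by (erule ratfun_nonzeroE) (simp add: ratfun_lead_Fract)

lemma ratfun_order_1 [simp]: "ratfun_order z 1 = 0"
  using ratfun_order_Fract [of 1 1 z] by simp

lemma ratfun_lead_1 [simp]: "ratfun_lead 1 = 1"
  using ratfun_lead_Fract [of 1 1] by simp

lemma ratfun_order_prod:
  "(\<And>i. i \<in> A \<Longrightarrow> f i \<noteq> 0) \<Longrightarrow> ratfun_order z (prod f A) = (\<Sum>i\<in>A. ratfun_order z (f i))"
  by (induction A rule: infinite_finite_induct) (auto simp: ratfun_order_mult)

lemma ratfun_lead_prod:
  "(\<And>i. i \<in> A \<Longrightarrow> f i \<noteq> 0) \<Longrightarrow> ratfun_lead (prod f A) = (\<Prod>i\<in>A. ratfun_lead (f i))"
  by (induction A rule: infinite_finite_induct) (auto simp: ratfun_lead_mult)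

lemma ratfun_order_inverse: "a \<noteq> 0 \<Longrightarrow> ratfun_order z (inverse a) = - ratfun_order z a"
  using ratfun_order_mult [of a "inverse a" z] by simp

lemma ratfun_lead_inverse: "a \<noteq> 0 \<Longrightarrow> ratfun_lead (inverse a) = inverse (ratfun_lead a)"
  using ratfun_lead_mult [of a "inverse a"] by (simp add: ratfun_lead_nonzero field_simps)

lemma ratfun_order_power: "a \<noteq> 0 \<Longrightarrow> ratfun_order z (a ^ n) = int n * ratfun_order z a"
  by (induction n) (auto simp: ratfun_order_mult algebra_simps)

lemma ratfun_lead_power: "a \<noteq> 0 \<Longrightarrow> ratfun_lead (a ^ n) = ratfun_lead a ^ n"
  by (induction n) (auto simp: ratfun_lead_mult)

lemma ratfun_order_powi: "a \<noteq> 0 \<Longrightarrow> ratfun_order z (a powi n) = n * ratfun_order z a"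
  by (simp add: power_int_def ratfun_order_power ratfun_order_inverse)

lemma ratfun_lead_powi: "a \<noteq> 0 \<Longrightarrow> ratfun_lead (a powi n) = ratfun_lead a powi n"
  by (simp add: power_int_def ratfun_lead_power ratfun_lead_inverse)

lemma order_linear: "order z [:- w, 1:] = (if z = w then 1 else 0 :: nat)" for z w :: complex
  using order_power_n_n [of w 1] by (auto intro: order_0I)

lemma ratfun_order_const: "c \<noteq> 0 \<Longrightarrow> ratfun_order z (ratfun_of_poly [:c:]) = 0"
  by (auto simp: ratfun_order_Fract intro: order_0I)

lemma ratfun_order_finite_support:
  assumes "a \<noteq> 0"
  shows "finite {z. ratfun_order z a \<noteq> 0}"
proof -
  obtain p q where pq: "a = Fract p q" "p \<noteq> 0" "q \<noteq> 0"
    using assms by (rule ratfun_nonzeroE)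
  have "{z. ratfun_order z a \<noteq> 0} \<subseteq> {z. poly p z = 0} \<union> {z. poly q z = 0}"
    using pq by (auto simp: ratfun_order_Fract order_root)
  then show ?thesis
    using pq poly_roots_finite finite_subset by blast
qed

text \<open>With a = p/q, invariance gives a one and the same value c at all points n s beyond the
  last pole among them. As s is nonzero there are infinitely many such points, so p - c q
  vanishes.\<close>

lemma invariant_ratfun_const:
  assumes "ratfun_shift s a = a" "s \<noteq> 0"
  obtains c where "a = ratfun_of_poly [:c:]"
proof -
  obtain p q where pq: "a = Fract p q" "q \<noteq> 0"
    by (rule Fract_cases)
  have "pcompose p [:- s, 1:] * q = p * pcompose q [:- s, 1:]"
    using assms pq by (simp add: ratfun_shift_Fract eq_fract)
  then have "poly (pcompose p [:- s, 1:] * q) z = poly (p * pcompose q [:- s, 1:]) z" for z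
    by simp
  then have eq: "poly p (z - s) * poly q z = poly p z * poly q (z - s)" for z
    by (simp add: poly_pcompose)
  define f where "f = (\<lambda>n::nat. of_nat n * s)"
  have inj: "inj f"
    using assms by (auto simp: f_def inj_on_def)
  have "finite (f -` {z. poly q z = 0})"
    using pq inj by (intro finite_vimageI poly_roots_finite)
  then obtain N where N: "\<forall>n\<ge>N. poly q (f n) \<noteq> 0"
    by (metis (mono_tags, lifting) finite_nat_set_iff_bounded_le mem_Collect_eq not_less_eq_eq vimageI)
  define c where "c = poly p (f N) / poly q (f N)"
  have val: "poly p (f (N + k)) = c * poly q (f (N + k))" for k
  proof (induction k)
    case 0
    then show ?case using N by (simp add: c_def)
  next
    case (Suc k)
    have "f (N + Suc k) - s = f (N + k)"
      by (simp add: f_def algebra_simps)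
    then have "poly p (f (N + k)) * poly q (f (N + Suc k)) =
        poly p (f (N + Suc k)) * poly q (f (N + k))"
      using eq [of "f (N + Suc k)"] by simp
    then have "c * poly q (f (N + k)) * poly q (f (N + Suc k)) =
        poly p (f (N + Suc k)) * poly q (f (N + k))"
      using Suc by simp
    moreover have "poly q (f (N + k)) \<noteq> 0"
      using N by simp
    ultimately show ?case
      by (simp add: mult.commute)
  qed
  have "p - smult c q = 0"
  proof (rule ccontr)
    assume "p - smult c q \<noteq> 0"
    then have "finite {z. poly (p - smult c q) z = 0}"
      by (rule poly_roots_finite)
    moreover have "range (\<lambda>k. f (N + k)) \<subseteq> {z. poly (p - smult c q) z = 0}"
      using val by auto
    moreover have "infinite (range (\<lambda>k. f (N + k)))"
      using inj by (intro range_inj_infinite injI) (auto dest: injD)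
    ultimately show False
      using finite_subset by blast
  qed
  then have "a = ratfun_of_poly [:c:]"
    using pq by (simp add: eq_fract)
  then show ?thesis
    using that by blast
qed

text \<open>
  Two rank one modules on which \<open>x\<^sup>m\<close> acts through \<open>g\<close> and \<open>g'\<close> are isomorphic iff these
  cocycles are cohomologous.
\<close>

definition cohomologous :: "nat \<Rightarrow> ratfun \<Rightarrow> ratfun \<Rightarrow> bool" where
  "cohomologous m g g' \<longleftrightarrow> (\<exists>a. a \<noteq> 0 \<and> g * a = g' * ratfun_shift (2 * of_nat m) a)"

lemma cohomologous_refl [simp]: "cohomologous m g g"
  unfolding cohomologous_def by (rule exI [of _ 1]) simp

lemma cohomologous_sym:
  assumes "cohomologous m g g'"
  shows "cohomologous m g' g"
proof -
  obtain a where a: "a \<noteq> 0" "g * a = g' * ratfun_shift (2 * of_nat m) a"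
    using assms by (auto simp: cohomologous_def)
  then have "g' * inverse a = g * ratfun_shift (2 * of_nat m) (inverse a)"
    by (subst ratfun_shift_inverse, subst (1) divide_inverse [symmetric],
        subst (1) divide_inverse [symmetric], subst frac_eq_eq) auto
  then show ?thesis
    using a(1) by (auto simp: cohomologous_def intro: exI [of _ "inverse a"])
qed

lemma cohomologous_mult:
  assumes "cohomologous m g g'" "cohomologous m k k'"
  shows "cohomologous m (g * k) (g' * k')"
proof -
  obtain a b where ab: "a \<noteq> 0" "g * a = g' * ratfun_shift (2 * of_nat m) a"
      "b \<noteq> 0" "k * b = k' * ratfun_shift (2 * of_nat m) b"
    using assms by (auto simp: cohomologous_def)
  have "(g * k) * (a * b) = (g * a) * (k * b)"
    by (simp only: mult_ac)
  also have "\<dots> = (g' * k') * ratfun_shift (2 * of_nat m) (a * b)"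
    unfolding ab ratfun_shift_mult by (simp only: mult_ac)
  finally show ?thesis
    using ab unfolding cohomologous_def by (intro exI [of _ "a * b"]) simp
qed

lemma cohomologous_inverse:
  assumes "cohomologous m g g'"
  shows "cohomologous m (inverse g) (inverse g')"
proof (cases "g = 0 \<or> g' = 0")
  case True
  then have "g = 0 \<and> g' = 0"
    using assms by (auto simp: cohomologous_def)
  then show ?thesis by simp
next
  case False
  obtain a where a: "a \<noteq> 0" "g * a = g' * ratfun_shift (2 * of_nat m) a"
    using assms by (auto simp: cohomologous_def)
  then have "inverse g * inverse a = inverse g' * ratfun_shift (2 * of_nat m) (inverse a)"
    by (metis inverse_mult_distrib ratfun_shift_inverse)
  then show ?thesis
    using a(1) by (auto simp: cohomologous_def intro: exI [of _ "inverse a"])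
qed

lemma cohomologous_trans:
  assumes "cohomologous m g g'" "cohomologous m g' g''"
  shows "cohomologous m g g''"
proof -
  obtain a b where ab: "a \<noteq> 0" "g * a = g' * ratfun_shift (2 * of_nat m) a"
      "b \<noteq> 0" "g' * b = g'' * ratfun_shift (2 * of_nat m) b"
    using assms by (auto simp: cohomologous_def)
  have "g * (a * b) = g' * b * ratfun_shift (2 * of_nat m) a"
    using ab(2) by (metis mult.assoc mult.commute)
  also have "\<dots> = g'' * ratfun_shift (2 * of_nat m) (a * b)"
    unfolding ab(4) ratfun_shift_mult by (simp only: mult_ac)
  finally show ?thesis
    using ab unfolding cohomologous_def by (intro exI [of _ "a * b"]) simp
qed

lemma cohomologous_power: "cohomologous m g g' \<Longrightarrow> cohomologous m (g ^ n) (g' ^ n)"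
  by (induction n) (auto intro: cohomologous_mult)

lemma cohomologous_powi: "cohomologous m g g' \<Longrightarrow> cohomologous m (g powi n) (g' powi n)"
  by (auto simp: power_int_def intro: cohomologous_power cohomologous_inverse)

lemma cohomologous_shift:
  assumes "cohomologous m g g'"
  shows "cohomologous m (ratfun_shift s g) (ratfun_shift s g')"
proof -
  obtain a where a: "a \<noteq> 0" "g * a = g' * ratfun_shift (2 * of_nat m) a"
    using assms by (auto simp: cohomologous_def)
  then have "ratfun_shift s (g * a) = ratfun_shift s (g' * ratfun_shift (2 * of_nat m) a)"
    by simp
  then have "ratfun_shift s g * ratfun_shift s a =
      ratfun_shift s g' * ratfun_shift (2 * of_nat m) (ratfun_shift s a)"
    by (simp add: ratfun_shift_mult ratfun_shift_shift add.commute)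
  then show ?thesis
    using a(1) by (auto simp: cohomologous_def intro: exI [of _ "ratfun_shift s a"])
qed

text \<open>The coboundary is that of g itself, and the relation becomes commutativity. Zeros and
  poles may therefore be moved by multiples of 2m.\<close>

lemma cohomologous_shift_period1: "cohomologous m (ratfun_shift (2 * of_nat m) g) g"
proof (cases "g = 0")
  case False
  then show ?thesis
    by (auto simp: cohomologous_def mult.commute)
qed simp

lemma cohomologous_shift_period: "cohomologous m (ratfun_shift (2 * of_nat m * of_int n) g) g"
proof (induction n rule: int_induct [where k = 0])
  case base
  then show ?case by simp
next
  case (step1 i)
  have "ratfun_shift (2 * of_nat m * of_int (i + 1)) g =
      ratfun_shift (2 * of_nat m) (ratfun_shift (2 * of_nat m * of_int i) g)"
    by (simp add: ratfun_shift_shift algebra_simps)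
  then show ?case
    using cohomologous_trans [OF cohomologous_shift_period1 step1(2)] by simp
next
  case (step2 i)
  have "ratfun_shift (2 * of_nat m * of_int i) g =
      ratfun_shift (2 * of_nat m) (ratfun_shift (2 * of_nat m * of_int (i - 1)) g)"
    by (simp add: ratfun_shift_shift algebra_simps)
  then show ?case
    using cohomologous_trans [OF cohomologous_sym [OF cohomologous_shift_period1] ] step2(2)
    by simp
qed

subsection \<open>The normal forms\<close>

definition linear_ratfun :: "complex \<Rightarrow> ratfun" where
  "linear_ratfun z = ratfun_of_poly [:- z, 1:]"

lemma ratfun_order_linear:
  "ratfun_order z (linear_ratfun w) = (if z = w then 1 else 0)"
  by (simp add: linear_ratfun_def ratfun_order_Fract order_linear)

text \<open>The contribution of the i-th entry of a parameter. Keeping i as an argument turns a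
  shift by 2j into i + j.\<close>

definition divisor_ratfun :: "(complex \<Rightarrow>\<^sub>0 int) \<Rightarrow> nat \<Rightarrow> ratfun" where
  "divisor_ratfun z i =
     (\<Prod>w\<in>Poly_Mapping.keys z. linear_ratfun (w + 2 * of_nat i) powi Poly_Mapping.lookup z w)"

lemma g_ratfun_eq:
  "g_ratfun (c, zs) = ratfun_of_poly [:c:] * (\<Prod>i<length zs. divisor_ratfun (zs ! i) i)"
  by (simp add: g_ratfun_def divisor_ratfun_def linear_ratfun_def)

lemma linear_ratfun_nonzero [simp]: "linear_ratfun z \<noteq> 0"
  by (simp add: linear_ratfun_def)

lemma divisor_ratfun_nonzero [simp]: "divisor_ratfun z i \<noteq> 0"
  by (simp add: divisor_ratfun_def power_int_eq_0_iff)

lemma g_ratfun_nonzero: "\<zeta> \<in> \<Psi> m \<omega> \<Longrightarrow> g_ratfun \<zeta> \<noteq> 0"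
  by (cases \<zeta>) (auto simp: g_ratfun_eq \<Psi>_def)

lemma divisor_ratfun_superset:
  assumes "finite A" "Poly_Mapping.keys z \<subseteq> A"
  shows "divisor_ratfun z i = (\<Prod>w\<in>A. linear_ratfun (w + 2 * of_nat i) powi Poly_Mapping.lookup z w)"
  unfolding divisor_ratfun_def
  by (rule prod.mono_neutral_left) (use assms in \<open>auto simp: in_keys_iff\<close>)

lemma divisor_ratfun_add_single:
  "divisor_ratfun (z + Poly_Mapping.single w k) i =
     divisor_ratfun z i * linear_ratfun (w + 2 * of_nat i) powi k"
proof -
  let ?A = "insert w (Poly_Mapping.keys z)"
  have "Poly_Mapping.keys (z + Poly_Mapping.single w k) \<subseteq> ?A"
    using Poly_Mapping.keys_add [of z "Poly_Mapping.single w k"] by (auto split: if_splits)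
  then have "divisor_ratfun (z + Poly_Mapping.single w k) i =
      (\<Prod>v\<in>?A. linear_ratfun (v + 2 * of_nat i) powi
         (Poly_Mapping.lookup z v + (k when w = v)))"
    by (subst divisor_ratfun_superset [of ?A]) (auto simp: lookup_add lookup_single)
  also have "\<dots> = (\<Prod>v\<in>?A. linear_ratfun (v + 2 * of_nat i) powi Poly_Mapping.lookup z v) *
      (\<Prod>v\<in>?A. linear_ratfun (v + 2 * of_nat i) powi (k when w = v))"
    by (subst prod.distrib [symmetric]) (intro prod.cong refl power_int_add, simp)
  also have "(\<Prod>v\<in>?A. linear_ratfun (v + 2 * of_nat i) powi (k when w = v)) =
      linear_ratfun (w + 2 * of_nat i) powi k"
    by (subst prod.mono_neutral_right [of ?A "{w}"]) (auto simp: when_def)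
  also have "(\<Prod>v\<in>?A. linear_ratfun (v + 2 * of_nat i) powi Poly_Mapping.lookup z v) =
      divisor_ratfun z i"
    by (subst divisor_ratfun_superset [of ?A]) auto
  finally show ?thesis .
qed

lemma linear_ratfun_shift: "ratfun_shift s (linear_ratfun z) = linear_ratfun (z + s)"
  by (simp add: linear_ratfun_def ratfun_shift_of_poly pcompose_pCons)

lemma divisor_ratfun_shift:
  "ratfun_shift (2 * of_nat j) (divisor_ratfun z i) = divisor_ratfun z (i + j)"
  by (simp add: divisor_ratfun_def ratfun_shift_prod ratfun_shift_powi linear_ratfun_shift
      algebra_simps)

text \<open>Applying \<sigma> moves the entry at position i to position i + 1. The former head,
  which \<open>rotate1\<close> has put last, lands at position m instead of 0; the error is a shift
  by 2m, hence a coboundary.\<close>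

lemma g_ratfun_rotate1:
  "cohomologous (length zs) (ratfun_shift 2 (g_ratfun (c, rotate1 zs))) (g_ratfun (c, zs))"
proof (cases zs)
  case Nil
  then show ?thesis by (simp add: g_ratfun_eq ratfun_shift_const)
next
  case (Cons y ys)
  define P where "P = ratfun_of_poly [:c:] * (\<Prod>i<length ys. divisor_ratfun (ys ! i) (Suc i))"
  have 1: "ratfun_shift 2 (divisor_ratfun z i) = divisor_ratfun z (Suc i)" for z i
    using divisor_ratfun_shift [of 1 z i] by simp
  have "ratfun_shift 2 (g_ratfun (c, rotate1 zs)) =
      P * ratfun_shift (2 * of_nat (length zs)) (divisor_ratfun y 0)"
    unfolding Cons divisor_ratfun_shift
    by (simp add: g_ratfun_eq ratfun_shift_mult ratfun_shift_prod 1 ratfun_shift_const nth_append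
        P_def mult.assoc)
  moreover have "g_ratfun (c, zs) = P * divisor_ratfun y 0"
    unfolding Cons by (simp add: g_ratfun_eq prod.lessThan_Suc_shift P_def del: prod.lessThan_Suc)
  ultimately show ?thesis
    by (metis cohomologous_mult cohomologous_refl cohomologous_shift_period1)
qed

lemma g_ratfun_rotate:
  "cohomologous (length zs) (ratfun_shift (2 * of_nat j) (g_ratfun (c, rotate j zs))) (g_ratfun (c, zs))"
proof (induction j)
  case 0
  then show ?case by simp
next
  case (Suc j)
  have "ratfun_shift (2 * of_nat (Suc j)) (g_ratfun (c, rotate (Suc j) zs)) =
      ratfun_shift (2 * of_nat j) (ratfun_shift 2 (g_ratfun (c, rotate1 (rotate j zs))))"
    by (simp add: ratfun_shift_shift algebra_simps)
  moreover have "cohomologous (length zs) \<dots> (ratfun_shift (2 * of_nat j) (g_ratfun (c, rotate j zs)))"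
    using cohomologous_shift [OF g_ratfun_rotate1 [of "rotate j zs" c]] by simp
  ultimately show ?case
    using cohomologous_trans [OF _ Suc] by simp
qed

text \<open>The translates of \<Omega> by 2N tile the plane. N is the index of the strip containing
  z, and division by m splits N = i + m n.\<close>

lemma strip_decompose:
  assumes "m > 0"
  obtains i n w where "i < m" "w \<in> \<Omega> \<omega>" "z = w + 2 * of_nat i + 2 * of_nat m * of_int n"
proof -
  define N where "N = \<lfloor>(Re z - \<omega>) / 2\<rfloor>"
  define i where "i = nat (N mod int m)"
  define n where "n = N div int m"
  define w where "w = z - 2 * of_int N"
  have N: "N = int i + int m * n"
    using assms by (simp add: i_def n_def)
  have "of_int N \<le> (Re z - \<omega>) / 2" "(Re z - \<omega>) / 2 < of_int N + 1"
    unfolding N_def by linarith+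
  then have "w \<in> \<Omega> \<omega>"
    by (auto simp: \<Omega>_def w_def field_simps)
  moreover have "i < m"
    using assms by (auto simp: i_def nat_less_iff)
  moreover have "z = w + 2 * of_nat i + 2 * of_nat m * of_int n"
    by (simp add: w_def N algebra_simps)
  ultimately show ?thesis
    using that by blast
qed

text \<open>A linear factor is moved by a multiple of 2m into one of the m strips and absorbed by
  the entry of that strip. Negative k stands for poles.\<close>

lemma normal_form_step:
  assumes "m > 0" "\<zeta> \<in> \<Psi> m \<omega>" "cohomologous m g (g_ratfun \<zeta>)"
  obtains \<zeta>' where "\<zeta>' \<in> \<Psi> m \<omega>" "cohomologous m (g * linear_ratfun z powi k) (g_ratfun \<zeta>')"
proof -
  obtain c zs where \<zeta>: "\<zeta> = (c, zs)"
    by force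
  obtain i n w where *: "i < m" "w \<in> \<Omega> \<omega>" "z = w + 2 * of_nat i + 2 * of_nat m * of_int n"
    using strip_decompose [OF assms(1)] by blast
  define zs' where "zs' = zs[i := zs ! i + Poly_Mapping.single w k]"
  have len: "length zs = m"
    using assms \<zeta> by (auto simp: \<Psi>_def)
  have "(c, zs') \<in> \<Psi> m \<omega>"
    using assms(2) * unfolding \<zeta>
    by (auto simp: \<Psi>_def zs'_def set_conv_nth nth_list_update split: if_splits
        dest!: subsetD [OF Poly_Mapping.keys_add])
  have "g_ratfun (c, zs') = ratfun_of_poly [:c:] *
      (\<Prod>j<m. divisor_ratfun (zs ! j) j *
         (if j = i then linear_ratfun (w + 2 * of_nat i) powi k else 1))"
    using * len by (auto simp: g_ratfun_eq zs'_def nth_list_update divisor_ratfun_add_single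
      simp del: mult_fract intro!: prod.cong)
  also have "\<dots> = g_ratfun \<zeta> * linear_ratfun (w + 2 * of_nat i) powi k"
    using * len by (simp add: prod.distrib \<zeta> g_ratfun_eq mult.assoc prod.delta)
  finally have g': "g_ratfun (c, zs') = g_ratfun \<zeta> * linear_ratfun (w + 2 * of_nat i) powi k" .
  have "linear_ratfun z = ratfun_shift (2 * of_nat m * of_int n) (linear_ratfun (w + 2 * of_nat i))"
    by (simp add: linear_ratfun_shift *)
  then have "cohomologous m (linear_ratfun z) (linear_ratfun (w + 2 * of_nat i))"
    by (metis cohomologous_shift_period)
  then have "cohomologous m (g * linear_ratfun z powi k) (g_ratfun (c, zs'))"
    unfolding g' by (intro cohomologous_mult cohomologous_powi assms)
  then show ?thesis
    using that \<open>(c, zs') \<in> \<Psi> m \<omega>\<close> by blast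
qed

text \<open>Roots are split off one by one, and the constant left at the end is absorbed by c. The
  sign k lets one induction serve numerator and denominator.\<close>

lemma normal_form_poly_step:
  assumes "m > 0" "p \<noteq> 0" "k = 1 \<or> k = -1"
  shows "\<zeta> \<in> \<Psi> m \<omega> \<Longrightarrow> cohomologous m g (g_ratfun \<zeta>) \<Longrightarrow>
    \<exists>\<zeta>'\<in>\<Psi> m \<omega>. cohomologous m (g * ratfun_of_poly p powi k) (g_ratfun \<zeta>')"
  using assms(2)
proof (induction "degree p" arbitrary: p g \<zeta>)
  case 0
  then obtain b where b: "p = [:b:]" "b \<noteq> 0"
    by (metis degree_eq_zeroE pCons_0_0)
  obtain c zs where \<zeta>: "\<zeta> = (c, zs)"
    by force
  obtain b' where b': "b' \<noteq> 0" "ratfun_of_poly p powi k = ratfun_of_poly [:b':]"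
  proof (cases "k = 1")
    case False
    then have "ratfun_of_poly p powi k = ratfun_of_poly [:inverse b:]"
      using assms(3) b by (auto simp: eq_fract one_pCons)
    then show ?thesis using that b by (metis inverse_nonzero_iff_nonzero)
  qed (use that b in simp)
  have "g_ratfun (c * b', zs) = g_ratfun \<zeta> * ratfun_of_poly p powi k"
    unfolding b' by (simp add: g_ratfun_eq \<zeta> algebra_simps flip: mult_fract)
      (simp add: mult.commute mult.left_commute flip: mult.assoc)
  moreover have "(c * b', zs) \<in> \<Psi> m \<omega>"
    using 0 b' \<zeta> by (auto simp: \<Psi>_def)
  ultimately show ?case
    using 0 by (metis cohomologous_mult cohomologous_refl)
next
  case (Suc n)
  then have "\<not> constant (poly p)"
    using constant_degree [of p] by simp
  then obtain z where "poly p z = 0"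
    using fundamental_theorem_of_algebra by blast
  then obtain q where q: "p = [:- z, 1:] * q"
    by (auto simp: poly_eq_0_iff_dvd)
  have "q \<noteq> 0"
    using Suc q by auto
  then have "degree q = n"
    using Suc(2) unfolding q by (subst (asm) degree_mult_eq) auto
  obtain \<zeta>' where \<zeta>': "\<zeta>' \<in> \<Psi> m \<omega>" "cohomologous m (g * linear_ratfun z powi k) (g_ratfun \<zeta>')"
    using normal_form_step [OF assms(1) Suc(3,4)] by blast
  have "g * linear_ratfun z powi k * ratfun_of_poly q powi k = g * ratfun_of_poly p powi k"
    unfolding q linear_ratfun_def ratfun_of_poly_mult power_int_mult_distrib by (simp add: mult.assoc)
  then show ?case
    using Suc(1) [OF \<open>degree q = n\<close> [symmetric] \<zeta>' \<open>q \<noteq> 0\<close>] by metis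
qed

lemma normal_form_exists:
  assumes "m > 0" "g \<noteq> 0"
  obtains \<zeta> where "\<zeta> \<in> \<Psi> m \<omega>" "cohomologous m g (g_ratfun \<zeta>)"
proof -
  obtain p q where pq: "g = Fract p q" "p \<noteq> 0" "q \<noteq> 0"
    using assms(2) by (rule ratfun_nonzeroE)
  \<comment> \<open>The parameter of the constant function 1, from which numerator and denominator
    are built up.\<close>
  let ?\<zeta>0 = "(1, replicate m 0) :: parameter"
  have "?\<zeta>0 \<in> \<Psi> m \<omega>" "g_ratfun ?\<zeta>0 = 1"
    by (auto simp: \<Psi>_def g_ratfun_def)
  then obtain \<zeta>1 where "\<zeta>1 \<in> \<Psi> m \<omega>" "cohomologous m (1 * ratfun_of_poly p powi 1) (g_ratfun \<zeta>1)"
    using normal_form_poly_step [OF assms(1) pq(2), of 1 ?\<zeta>0 \<omega> 1] by auto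
  then obtain \<zeta>2 where "\<zeta>2 \<in> \<Psi> m \<omega>"
      "cohomologous m (1 * ratfun_of_poly p powi 1 * ratfun_of_poly q powi (-1)) (g_ratfun \<zeta>2)"
    using normal_form_poly_step [OF assms(1) pq(3), of "-1" \<zeta>1 \<omega> "1 * ratfun_of_poly p powi 1"]
    by blast
  then show ?thesis
    using that pq by (simp add: power_int_minus del: mult_fract) (simp add: that)
qed

lemma ratfun_order_g_ratfun:
  assumes "\<zeta> \<in> \<Psi> m \<omega>"
  shows "ratfun_order z (g_ratfun \<zeta>) = (\<Sum>i<m. Poly_Mapping.lookup (snd \<zeta> ! i) (z - 2 * of_nat i))"
proof -
  obtain c zs where \<zeta>: "\<zeta> = (c, zs)" "c \<noteq> 0" "length zs = m"
    using assms by (auto simp: \<Psi>_def)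
  have "ratfun_order z (divisor_ratfun y i) = Poly_Mapping.lookup y (z - 2 * of_nat i)" for y i
  proof -
    have "ratfun_order z (divisor_ratfun y i) =
        (\<Sum>w\<in>Poly_Mapping.keys y. Poly_Mapping.lookup y w * (if w = z - 2 * of_nat i then 1 else 0))"
      unfolding divisor_ratfun_def
      by (subst ratfun_order_prod)
        (auto simp: power_int_eq_0_iff ratfun_order_powi ratfun_order_linear eq_diff_eq
          simp del: mult_cancel_left intro!: sum.cong arg_cong2 [of _ _ _ _ times])
    also have "\<dots> = Poly_Mapping.lookup y (z - 2 * of_nat i)"
      by (simp add: mult_delta_right sum.delta in_keys_iff)
    finally show ?thesis .
  qed
  then show ?thesis
    using \<zeta> by (simp add: g_ratfun_eq ratfun_order_mult ratfun_order_const ratfun_order_prod)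
qed

lemma ratfun_lead_g_ratfun:
  assumes "\<zeta> \<in> \<Psi> m \<omega>"
  shows "ratfun_lead (g_ratfun \<zeta>) = fst \<zeta>"
proof -
  obtain c zs where \<zeta>: "\<zeta> = (c, zs)" "c \<noteq> 0"
    using assms by (auto simp: \<Psi>_def)
  have "ratfun_lead (divisor_ratfun y i) = 1" for y i
    unfolding divisor_ratfun_def
    by (subst ratfun_lead_prod)
      (auto simp: power_int_eq_0_iff ratfun_lead_powi ratfun_lead_Fract linear_ratfun_def)
  then show ?thesis
    using \<zeta> by (simp add: g_ratfun_eq ratfun_lead_mult ratfun_lead_Fract ratfun_lead_prod)
qed

lemma ratfun_order_g_ratfun_strip:
  assumes "\<zeta> \<in> \<Psi> m \<omega>" "ratfun_order z (g_ratfun \<zeta>) \<noteq> 0"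
  shows "\<omega> \<le> Re z" "Re z < \<omega> + 2 * real m"
proof -
  obtain i where i: "i < m" "Poly_Mapping.lookup (snd \<zeta> ! i) (z - 2 * of_nat i) \<noteq> 0"
    using assms(2) unfolding ratfun_order_g_ratfun [OF assms(1)]
    by (meson lessThan_iff sum.not_neutral_contains_not_neutral)
  then have "z - 2 * of_nat i \<in> \<Omega> \<omega>"
    using assms(1) by (fastforce simp: \<Psi>_def in_keys_iff)
  moreover have "real i \<le> real m - 1"
    using i by linarith
  ultimately show "\<omega> \<le> Re z" "Re z < \<omega> + 2 * real m"
    by (auto simp: \<Omega>_def)
qed

text \<open>At a point of the i-th strip only the i-th entry contributes, because the half-open
  strips are disjoint. So the entries can be recovered from g.\<close>

lemma ratfun_order_g_ratfun_eq:
  assumes "\<zeta> \<in> \<Psi> m \<omega>" "i < m" "w \<in> \<Omega> \<omega>"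
  shows "ratfun_order (w + 2 * of_nat i) (g_ratfun \<zeta>) = Poly_Mapping.lookup (snd \<zeta> ! i) w"
proof -
  have *: "Poly_Mapping.lookup (snd \<zeta> ! j) (w + 2 * of_nat i - 2 * of_nat j) = 0"
    if "j < m" "j \<noteq> i" for j
  proof (rule ccontr)
    assume "\<not> ?thesis"
    then have "w + 2 * of_nat i - 2 * of_nat j \<in> \<Omega> \<omega>"
      using assms(1) that by (fastforce simp: \<Psi>_def in_keys_iff)
    then have "\<bar>real i - real j\<bar> < 1"
      using assms(3) by (auto simp: \<Omega>_def)
    then show False
      using that(2) by linarith
  qed
  have "ratfun_order (w + 2 * of_nat i) (g_ratfun \<zeta>) =
      (\<Sum>j\<in>{i}. Poly_Mapping.lookup (snd \<zeta> ! j) (w + 2 * of_nat i - 2 * of_nat j))"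
    unfolding ratfun_order_g_ratfun [OF assms(1)]
    by (rule sum.mono_neutral_right) (use assms * in auto)
  then show ?thesis by simp
qed

text \<open>
  The order \<open>D\<close> of a coboundary primitive satisfies \<open>D(z - 2m) - D(z) = 0\<close> outside a strip of
  width \<open>2m\<close>; having finite support, it vanishes on both sides of that strip and at its shift.
\<close>

lemma normal_form_unique:
  assumes "m > 0" "\<zeta> \<in> \<Psi> m \<omega>" "\<zeta>' \<in> \<Psi> m \<omega>" "cohomologous m (g_ratfun \<zeta>) (g_ratfun \<zeta>')"
  shows "\<zeta> = \<zeta>'"
proof -
  obtain a where a: "a \<noteq> 0" "g_ratfun \<zeta> * a = g_ratfun \<zeta>' * ratfun_shift (2 * of_nat m) a"
    using assms(4) by (auto simp: cohomologous_def)
  note nz = g_ratfun_nonzero [OF assms(2)] g_ratfun_nonzero [OF assms(3)]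
  \<comment> \<open>The leading coefficient is insensitive to shifts, so that of a cancels and the
    constants c agree.\<close>
  have "ratfun_lead (g_ratfun \<zeta> * a) = ratfun_lead (g_ratfun \<zeta>' * ratfun_shift (2 * of_nat m) a)"
    using a by simp
  then have fst: "fst \<zeta> = fst \<zeta>'"
    using a(1) nz by (simp add: ratfun_lead_mult ratfun_lead_shift ratfun_lead_nonzero
      ratfun_lead_g_ratfun [OF assms(2)] ratfun_lead_g_ratfun [OF assms(3)])
  define D where "D = (\<lambda>z. ratfun_order z a)"
  define M :: complex where "M = 2 * of_nat m"
  have eq: "ratfun_order z (g_ratfun \<zeta>) + D z = ratfun_order z (g_ratfun \<zeta>') + D (z - M)" for z
    using arg_cong [OF a(2), of "ratfun_order z"] a(1) nz
    by (simp add: ratfun_order_mult ratfun_order_shift D_def M_def)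
  have fin: "finite {z. D z \<noteq> 0}"
    using ratfun_order_finite_support [OF a(1)] by (simp add: D_def)
  have M: "M \<noteq> 0" "Re M = 2 * real m"
    using assms(1) by (auto simp: M_def)
  have far: "\<exists>k::nat. D (z + of_nat k * s) = 0" if "s \<noteq> 0" for z s
  proof (rule ccontr)
    assume "\<not> ?thesis"
    then have "range (\<lambda>k::nat. z + of_nat k * s) \<subseteq> {z. D z \<noteq> 0}"
      by auto
    moreover have "infinite (range (\<lambda>k::nat. z + of_nat k * s))"
      using that by (intro range_inj_infinite) (auto simp: inj_on_def)
    ultimately show False
      using fin finite_subset by blast
  qed
  \<comment> \<open>To the left of the strip neither g has zeros or poles. The fact
    \<open>right\<close> says the same beyond its right end, rewritten at z + 2m so that it starts
    at \<omega>.\<close>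
  have left: "D z = D (z - M)" if "Re z < \<omega>" for z
    using eq [of z] that ratfun_order_g_ratfun_strip [OF assms(2), of z]
      ratfun_order_g_ratfun_strip [OF assms(3), of z] by force
  have right: "D z = D (z + M)" if "Re z \<ge> \<omega>" for z
    using eq [of "z + M"] that ratfun_order_g_ratfun_strip [OF assms(2), of "z + M"]
      ratfun_order_g_ratfun_strip [OF assms(3), of "z + M"] by (force simp: M)
  have left0: "D z = 0" if "Re z < \<omega>" for z
  proof -
    have "D z = D (z + of_nat k * (- M))" for k :: nat
    proof (induction k)
      case (Suc k)
      have "0 \<le> real k * (real m * 2)"
        by simp
      moreover have "Re (z + of_nat k * (- M)) = Re z - real k * (real m * 2)"
        by (simp add: M)
      ultimately have "Re (z + of_nat k * (- M)) < \<omega>"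
        using that by linarith
      then show ?case
        using left [of "z + of_nat k * (- M)"] Suc by (simp add: algebra_simps)
    qed simp
    then show ?thesis
      using far [of "- M" z] M by auto
  qed
  have right0: "D z = 0" if "Re z \<ge> \<omega>" for z
  proof -
    have "D z = D (z + of_nat k * M)" for k :: nat
    proof (induction k)
      case (Suc k)
      have "0 \<le> real k * (real m * 2)"
        by simp
      moreover have "Re (z + of_nat k * M) = Re z + real k * (real m * 2)"
        by (simp add: M)
      ultimately have "Re (z + of_nat k * M) \<ge> \<omega>"
        using that by linarith
      then show ?case
        using right [of "z + of_nat k * M"] Suc by (simp add: algebra_simps)
    qed simp
    then show ?thesis
      using far [of M z] M by auto
  qed
  have D0: "D z = 0" for z
    using left0 right0 by (cases "Re z < \<omega>") auto
  \<comment> \<open>Both g have the same orders because D = 0. Inside \<Omega> these orders are the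
    entries; outside the entries vanish.\<close>
  have snd: "Poly_Mapping.lookup (snd \<zeta> ! i) w = Poly_Mapping.lookup (snd \<zeta>' ! i) w" if "i < m" for i w
  proof (cases "w \<in> \<Omega> \<omega>")
    case True
    then show ?thesis
      using eq [of "w + 2 * of_nat i"] that assms(2,3) by (simp add: D0 ratfun_order_g_ratfun_eq)
  next
    case False
    have "Poly_Mapping.lookup (snd \<xi> ! i) w = 0" if "\<xi> \<in> \<Psi> m \<omega>" for \<xi>
    proof (rule ccontr)
      assume "\<not> ?thesis"
      then have "w \<in> Poly_Mapping.keys (snd \<xi> ! i)"
        by (simp add: in_keys_iff)
      then show False
        using that False \<open>i < m\<close> by (fastforce simp: \<Psi>_def)
    qed
    then show ?thesis using assms(2,3) by simp
  qed
  have len: "length (snd \<zeta>) = m" "length (snd \<zeta>') = m"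
    using assms by (auto simp: \<Psi>_def)
  have "snd \<zeta> = snd \<zeta>'"
    by (rule nth_equalityI) (auto simp: len snd intro: poly_mapping_eqI)
  then show ?thesis
    using fst by (simp add: prod_eq_iff)
qed

section \<open>Extension of scalars to the field of fractions\<close>

lemma ring_of_type_algebra_simps [simp]:
  "carrier ring_of_type_algebra = UNIV"
  "x \<otimes>\<^bsub>ring_of_type_algebra\<^esub> y = x * y"
  "\<one>\<^bsub>ring_of_type_algebra\<^esub> = 1"
  "\<zero>\<^bsub>ring_of_type_algebra\<^esub> = 0"
  "x \<oplus>\<^bsub>ring_of_type_algebra\<^esub> y = x + y"
  by (simp_all add: ring_of_type_algebra_def)

lemma ring_of_type_algebra_a_inv [simp]:
  "\<ominus>\<^bsub>ring_of_type_algebra\<^esub> x = - (x :: 'a :: comm_ring_1)"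
proof -
  interpret cring "ring_of_type_algebra :: 'a ring" ..
  show ?thesis
    by (rule sum_zero_eq_neg [symmetric]) auto
qed

locale idom_module = module "ring_of_type_algebra :: 'k::idom ring" M
  for M :: "('k::idom, 'v) module" (structure)
begin

abbreviation tensor_generators :: "(('k fract \<times> 'v) \<Rightarrow>\<^sub>0 int) monoid" where
  "tensor_generators \<equiv> free_Abelian_group (UNIV \<times> carrier M)"

abbreviation relation_subgroup :: "(('k fract \<times> 'v) \<Rightarrow>\<^sub>0 int) set" where
  "relation_subgroup \<equiv> generate tensor_generators (tensor_relations M)"

abbreviation tensor :: "('k fract, (('k fract \<times> 'v) \<Rightarrow>\<^sub>0 int) set) module" where
  "tensor \<equiv> fract_tensor M"

definition tensor_class :: "(('k fract \<times> 'v) \<Rightarrow>\<^sub>0 int) \<Rightarrow> (('k fract \<times> 'v) \<Rightarrow>\<^sub>0 int) set" where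
  "tensor_class c = relation_subgroup #>\<^bsub>tensor_generators\<^esub> c"

definition scale_generators ::
    "'k fract \<Rightarrow> (('k fract \<times> 'v) \<Rightarrow>\<^sub>0 int) \<Rightarrow> (('k fract \<times> 'v) \<Rightarrow>\<^sub>0 int)" where
  "scale_generators k = frag_extend (\<lambda>(l, v). frag_of (k * l, v))"

definition pure_tensor :: "'k fract \<Rightarrow> 'v \<Rightarrow> (('k fract \<times> 'v) \<Rightarrow>\<^sub>0 int) set" where
  "pure_tensor k v = tensor_class (frag_of (k, v))"

lemma tensor_relations_subset: "tensor_relations M \<subseteq> carrier tensor_generators"
  unfolding tensor_relations_def
  by (auto dest!: subsetD [OF keys_diff] split: if_splits)

lemma relation_subgroup: "subgroup relation_subgroup tensor_generators"
  by (rule group.generate_is_subgroup) (simp_all add: tensor_relations_subset)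

lemma relation_normal: "relation_subgroup \<lhd> tensor_generators"
  by (rule comm_group.subgroup_imp_normal [OF abelian_free_Abelian_group relation_subgroup])

lemma relation_keys: "c \<in> relation_subgroup \<Longrightarrow> Poly_Mapping.keys c \<subseteq> UNIV \<times> carrier M"
  by (metis carrier_free_Abelian_group_iff relation_subgroup subgroup.mem_carrier)

lemma relation_0: "0 \<in> relation_subgroup"
  using subgroup.one_closed [OF relation_subgroup] by simp

lemma relation_add: "c \<in> relation_subgroup \<Longrightarrow> d \<in> relation_subgroup \<Longrightarrow> c + d \<in> relation_subgroup"
  using subgroup.m_closed [OF relation_subgroup] by simp

lemma relation_uminus: "c \<in> relation_subgroup \<Longrightarrow> - c \<in> relation_subgroup"
  using subgroup.m_inv_closed [OF relation_subgroup, of c] relation_keys by simp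

lemma relation_diff: "c \<in> relation_subgroup \<Longrightarrow> d \<in> relation_subgroup \<Longrightarrow> c - d \<in> relation_subgroup"
  using relation_add [of c "- d"] relation_uminus by simp

lemma relation_incl: "c \<in> tensor_relations M \<Longrightarrow> c \<in> relation_subgroup"
  by (rule generate.incl)

lemma tensor_class_eq: "tensor_class c = (\<lambda>n. n + c) ` relation_subgroup"
  by (auto simp: tensor_class_def r_coset_def)

lemma tensor_class_eq_iff: "tensor_class c = tensor_class d \<longleftrightarrow> c - d \<in> relation_subgroup"
proof
  assume "tensor_class c = tensor_class d"
  moreover have "c \<in> tensor_class c"
    using relation_0 by (force simp: tensor_class_eq)
  ultimately show "c - d \<in> relation_subgroup"
    by (auto simp: tensor_class_eq)
next
  assume *: "c - d \<in> relation_subgroup"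
  have "n + c \<in> tensor_class d" if "n \<in> relation_subgroup" for n
    using relation_add [OF that *] by (force simp: tensor_class_eq image_iff algebra_simps)
  moreover have "n + d \<in> tensor_class c" if "n \<in> relation_subgroup" for n
    using relation_diff [OF that *] by (force simp: tensor_class_eq image_iff algebra_simps)
  ultimately show "tensor_class c = tensor_class d"
    by (auto simp: tensor_class_eq)
qed

lemma tensor_carrier: "carrier tensor = tensor_class ` {c. Poly_Mapping.keys c \<subseteq> UNIV \<times> carrier M}"
  by (auto simp: fract_tensor_def Let_def RCOSETS_def tensor_class_def)

lemma tensor_class_carrier [simp]:
  "Poly_Mapping.keys c \<subseteq> UNIV \<times> carrier M \<Longrightarrow> tensor_class c \<in> carrier tensor"
  by (auto simp: tensor_carrier)

lemma tensor_carrierE: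
  assumes "T \<in> carrier tensor"
  obtains c where "Poly_Mapping.keys c \<subseteq> UNIV \<times> carrier M" "T = tensor_class c"
  using assms by (auto simp: tensor_carrier)

lemma tensor_zero: "\<zero>\<^bsub>tensor\<^esub> = tensor_class 0"
  by (simp add: fract_tensor_def Let_def tensor_class_eq)

lemma tensor_add:
  assumes "Poly_Mapping.keys c \<subseteq> UNIV \<times> carrier M" "Poly_Mapping.keys d \<subseteq> UNIV \<times> carrier M"
  shows "tensor_class c \<oplus>\<^bsub>tensor\<^esub> tensor_class d = tensor_class (c + d)"
  using normal.rcos_sum [OF relation_normal, of c d] assms
  by (simp add: fract_tensor_def Let_def tensor_class_def)

lemma scale_generators_simps [simp]:
  "scale_generators k 0 = 0"
  "scale_generators k (frag_of (l, v)) = frag_of (k * l, v)"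
  "scale_generators k (c + d) = scale_generators k c + scale_generators k d"
  "scale_generators k (c - d) = scale_generators k c - scale_generators k d"
  "scale_generators k (- c) = - scale_generators k c"
  by (simp_all add: scale_generators_def frag_extend_add frag_extend_diff frag_extend_minus)

lemma keys_scale_generators:
  assumes "Poly_Mapping.keys c \<subseteq> UNIV \<times> carrier M"
  shows "Poly_Mapping.keys (scale_generators k c) \<subseteq> UNIV \<times> carrier M"
proof -
  have "(\<Union>x\<in>Poly_Mapping.keys c. Poly_Mapping.keys (case x of (l, v) \<Rightarrow> frag_of (k * l, v)))
      \<subseteq> UNIV \<times> carrier M"
    using assms by (auto split: if_splits)
  then show ?thesis
    unfolding scale_generators_def using keys_frag_extend by (rule order_trans [rotated])
qed

text \<open>Needed for the scalar action to be well defined on cosets. Each of the three families of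
  relations is stable under scaling the left factor.\<close>

lemma scale_relation:
  assumes "c \<in> relation_subgroup"
  shows "scale_generators k c \<in> relation_subgroup"
  using assms
proof (induction rule: generate.induct)
  case one
  then show ?case by (simp add: relation_0)
next
  have *: "scale_generators k h \<in> tensor_relations M" if h: "h \<in> tensor_relations M" for h
  proof -
    consider (1) l l' v where "h = frag_of (l + l', v) - frag_of (l, v) - frag_of (l', v)" "v \<in> carrier M"
      | (2) l v v' where "h = frag_of (l, v \<oplus> v') - frag_of (l, v) - frag_of (l, v')"
          "v \<in> carrier M" "v' \<in> carrier M"
      | (3) l a v where "h = frag_of (l * Fract a 1, v) - frag_of (l, a \<odot> v)" "v \<in> carrier M"
      using h unfolding tensor_relations_def by blast
    then show ?thesis
    proof cases
      case 1
      then have "scale_generators k h =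
          frag_of (k * l + k * l', v) - frag_of (k * l, v) - frag_of (k * l', v)"
        by (simp add: distrib_left)
      then show ?thesis
        using 1 unfolding tensor_relations_def by blast
    next
      case 2
      then have "scale_generators k h =
          frag_of (k * l, v \<oplus> v') - frag_of (k * l, v) - frag_of (k * l, v')"
        by simp
      then show ?thesis
        using 2 unfolding tensor_relations_def by blast
    next
      case 3
      then have "scale_generators k h = frag_of ((k * l) * Fract a 1, v) - frag_of (k * l, a \<odot> v)"
        by (simp add: mult.assoc)
      then show ?thesis
        using 3 unfolding tensor_relations_def by blast
    qed
  qed
  {
    case (incl h)
    then show ?case using * relation_incl by blast
  next
    case (inv h)
    then have "inv\<^bsub>tensor_generators\<^esub> h = - h"
      using tensor_relations_subset by auto
    then show ?case using * [OF inv] relation_incl relation_uminus by simp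
  }
next
  case (eng h1 h2)
  then show ?case by (simp add: relation_add)
qed

lemma tensor_smult:
  assumes "Poly_Mapping.keys c \<subseteq> UNIV \<times> carrier M"
  shows "k \<odot>\<^bsub>tensor\<^esub> tensor_class c = tensor_class (scale_generators k c)"
proof -
  have "tensor_class (scale_generators k d) = tensor_class (scale_generators k c)"
    if d: "d \<in> tensor_class c" for d
  proof -
    obtain n where "d = n + c" "n \<in> relation_subgroup"
      using d by (auto simp: tensor_class_eq)
    then show ?thesis
      using scale_relation by (simp add: tensor_class_eq_iff)
  qed
  then have "(\<Union>d\<in>tensor_class c. tensor_class (scale_generators k d)) =
      (\<Union>d\<in>tensor_class c. tensor_class (scale_generators k c))"
    by (intro SUP_cong refl)
  moreover have "tensor_class c \<noteq> {}"
    using relation_0 by (auto simp: tensor_class_eq)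
  ultimately have "(\<Union>d\<in>tensor_class c. tensor_class (scale_generators k d)) =
      tensor_class (scale_generators k c)"
    by simp
  then show ?thesis
    by (simp add: fract_tensor_def Let_def tensor_class_def scale_generators_def)
qed

lemma scale_generators_scale:
  "scale_generators k (scale_generators l c) = scale_generators (k * l) c"
  by (induction c rule: frag_induction [OF subset_UNIV]) (auto simp: mult.assoc)

lemma scale_generators_one: "scale_generators 1 c = c"
  by (induction c rule: frag_induction [OF subset_UNIV]) auto

text \<open>Distributivity in the scalar fails for formal sums; it holds only modulo the first
  family of relations.\<close>

lemma scale_generators_add_left:
  assumes "Poly_Mapping.keys c \<subseteq> UNIV \<times> carrier M"
  shows "scale_generators (k + l) c - (scale_generators k c + scale_generators l c) \<in> relation_subgroup"
  using assms
proof (induction c rule: free_Abelian_group_induct [consumes 1, case_names zero diff of])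
  case zero
  then show ?case by (simp add: relation_0)
next
  case (diff x y)
  then show ?case
    using relation_diff [OF diff(3,4)] by (simp add: algebra_simps)
next
  case (of a)
  then obtain j v where a: "a = (j, v)" "v \<in> carrier M"
    by auto
  then have "frag_of (k * j + l * j, v) - frag_of (k * j, v) - frag_of (l * j, v) \<in> relation_subgroup"
    by (intro relation_incl) (auto simp: tensor_relations_def)
  then show ?case
    using \<open>a = (j, v)\<close> by (simp add: algebra_simps)
qed

lemma tensor_comm_group: "comm_group (add_monoid tensor)"
proof (rule comm_groupI; simp)
  show "\<zero>\<^bsub>tensor\<^esub> \<in> carrier tensor"
    by (simp add: tensor_zero)
next
  fix x y assume "x \<in> carrier tensor" "y \<in> carrier tensor"
  then obtain c d where "Poly_Mapping.keys c \<subseteq> UNIV \<times> carrier M" "x = tensor_class c"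
      "Poly_Mapping.keys d \<subseteq> UNIV \<times> carrier M" "y = tensor_class d"
    by (metis tensor_carrierE)
  then show "x \<oplus>\<^bsub>tensor\<^esub> y \<in> carrier tensor" "x \<oplus>\<^bsub>tensor\<^esub> y = y \<oplus>\<^bsub>tensor\<^esub> x"
    using order_trans [OF keys_add [of c d]] by (auto simp: tensor_add add.commute)
next
  fix x y z assume "x \<in> carrier tensor" "y \<in> carrier tensor" "z \<in> carrier tensor"
  then obtain c d e where *: "Poly_Mapping.keys c \<subseteq> UNIV \<times> carrier M" "x = tensor_class c"
      "Poly_Mapping.keys d \<subseteq> UNIV \<times> carrier M" "y = tensor_class d"
      "Poly_Mapping.keys e \<subseteq> UNIV \<times> carrier M" "z = tensor_class e"
    by (metis tensor_carrierE)
  have "Poly_Mapping.keys (c + d) \<subseteq> UNIV \<times> carrier M" "Poly_Mapping.keys (d + e) \<subseteq> UNIV \<times> carrier M"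
    by (rule order_trans [OF keys_add], use * in blast)+
  then show "x \<oplus>\<^bsub>tensor\<^esub> y \<oplus>\<^bsub>tensor\<^esub> z = x \<oplus>\<^bsub>tensor\<^esub> (y \<oplus>\<^bsub>tensor\<^esub> z)"
    using * by (simp add: tensor_add add.assoc)
next
  fix x assume "x \<in> carrier tensor"
  then obtain c where *: "Poly_Mapping.keys c \<subseteq> UNIV \<times> carrier M" "x = tensor_class c"
    by (metis tensor_carrierE)
  show "\<zero>\<^bsub>tensor\<^esub> \<oplus>\<^bsub>tensor\<^esub> x = x"
    using * by (simp add: tensor_zero tensor_add)
  have "tensor_class (- c) \<oplus>\<^bsub>tensor\<^esub> x = \<zero>\<^bsub>tensor\<^esub>"
    using * by (simp add: tensor_zero tensor_add)
  then show "\<exists>y\<in>carrier tensor. y \<oplus>\<^bsub>tensor\<^esub> x = \<zero>\<^bsub>tensor\<^esub>"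
    using * by (intro bexI [of _ "tensor_class (- c)"]) auto
qed

lemma tensor_vectorspace: "vectorspace (ring_of_type_algebra :: 'k fract ring) tensor"
proof -
  interpret K: Ring.field "ring_of_type_algebra :: 'k fract ring"
    by (rule field_from_type_algebra)
  interpret T: abelian_group tensor
    by (rule comm_group_abelian_groupI [OF tensor_comm_group])
  have "module (ring_of_type_algebra :: 'k fract ring) tensor"
  proof (rule moduleI)
    show "cring (ring_of_type_algebra :: 'k fract ring)"
      by (rule K.is_cring)
    show "abelian_group tensor"
      by (rule T.abelian_group_axioms)
    fix k l :: "'k fract" and x y
    assume "x \<in> carrier tensor"
    then obtain c where c: "Poly_Mapping.keys c \<subseteq> UNIV \<times> carrier M" "x = tensor_class c"
      by (metis tensor_carrierE)
    note k = keys_scale_generators [OF c(1)]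
    show "k \<odot>\<^bsub>tensor\<^esub> x \<in> carrier tensor"
      using c k by (simp add: tensor_smult)
    show "(k \<oplus>\<^bsub>ring_of_type_algebra\<^esub> l) \<odot>\<^bsub>tensor\<^esub> x = k \<odot>\<^bsub>tensor\<^esub> x \<oplus>\<^bsub>tensor\<^esub> l \<odot>\<^bsub>tensor\<^esub> x"
      using c k scale_generators_add_left by (simp add: tensor_smult tensor_add tensor_class_eq_iff)
    show "(k \<otimes>\<^bsub>ring_of_type_algebra\<^esub> l) \<odot>\<^bsub>tensor\<^esub> x = k \<odot>\<^bsub>tensor\<^esub> (l \<odot>\<^bsub>tensor\<^esub> x)"
      using c k by (simp add: tensor_smult scale_generators_scale)
    show "\<one>\<^bsub>ring_of_type_algebra\<^esub> \<odot>\<^bsub>tensor\<^esub> x = x"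
      using c by (simp add: tensor_smult scale_generators_one)
    assume "y \<in> carrier tensor"
    then obtain d where d: "Poly_Mapping.keys d \<subseteq> UNIV \<times> carrier M" "y = tensor_class d"
      by (metis tensor_carrierE)
    have "Poly_Mapping.keys (c + d) \<subseteq> UNIV \<times> carrier M"
      by (rule order_trans [OF keys_add], use c d in blast)
    then show "k \<odot>\<^bsub>tensor\<^esub> (x \<oplus>\<^bsub>tensor\<^esub> y) = k \<odot>\<^bsub>tensor\<^esub> x \<oplus>\<^bsub>tensor\<^esub> k \<odot>\<^bsub>tensor\<^esub> y"
      using c d k keys_scale_generators [OF d(1)] by (simp add: tensor_smult tensor_add)
  qed
  then show ?thesis
    by (simp add: vectorspace_def K.field_axioms)
qed

sublocale T: vectorspace "ring_of_type_algebra :: 'k fract ring" tensor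
  by (rule tensor_vectorspace)

lemma pure_tensor_carrier [simp]: "v \<in> carrier M \<Longrightarrow> pure_tensor k v \<in> carrier tensor"
  unfolding pure_tensor_def by (rule tensor_class_carrier) simp

lemma pure_tensor_add_right:
  assumes "v \<in> carrier M" "w \<in> carrier M"
  shows "pure_tensor k (v \<oplus> w) = pure_tensor k v \<oplus>\<^bsub>tensor\<^esub> pure_tensor k w"
proof -
  have "frag_of (k, v \<oplus> w) - frag_of (k, v) - frag_of (k, w) \<in> relation_subgroup"
    using assms by (intro relation_incl) (auto simp: tensor_relations_def)
  then show ?thesis
    using assms by (simp add: pure_tensor_def tensor_add tensor_class_eq_iff algebra_simps)
qed

lemma pure_tensor_balance:
  assumes "v \<in> carrier M"
  shows "pure_tensor k (a \<odot> v) = pure_tensor (k * Fract a 1) v"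
proof -
  have "frag_of (k * Fract a 1, v) - frag_of (k, a \<odot> v) \<in> relation_subgroup"
    using assms by (intro relation_incl) (auto simp: tensor_relations_def)
  then show ?thesis
    using assms by (metis pure_tensor_def tensor_class_eq_iff)
qed

lemma smult_pure_tensor:
  "v \<in> carrier M \<Longrightarrow> k \<odot>\<^bsub>tensor\<^esub> pure_tensor l v = pure_tensor (k * l) v"
  by (simp add: pure_tensor_def tensor_smult)

lemma pure_tensor_zero: "pure_tensor k \<zero> = \<zero>\<^bsub>tensor\<^esub>"
  using pure_tensor_add_right [of \<zero> \<zero> k]
  by (metis T.M.add.r_cancel_one' l_zero local.zero_closed pure_tensor_carrier)

lemma pure_tensor_finsum:
  assumes "finite I" "\<And>i. i \<in> I \<Longrightarrow> w i \<in> carrier M"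
  shows "pure_tensor k (finsum M w I) = finsum tensor (\<lambda>i. pure_tensor k (w i)) I"
  using assms
proof (induction I)
  case empty
  then show ?case by (simp add: pure_tensor_zero)
next
  case (insert i I)
  then show ?case
    by (simp add: pure_tensor_add_right M.finsum_insert T.M.finsum_insert Pi_def finsum_closed)
qed

section \<open>Denominators and the kernel of v -> 1 (x) v\<close>

definition integral_part :: "'k fract \<Rightarrow> 'k" where
  "integral_part k = (THE a. k = Fract a 1)"

lemma integral_part_Fract [simp]: "integral_part (Fract a 1) = a"
  unfolding integral_part_def by (rule the_equality) (auto simp: eq_fract)

text \<open>Every multiple of the denominator is asked to be one as well, so that denominators of
  several fractions combine by multiplication.\<close>

lemma denominator_exists:
  obtains a where "a \<noteq> (0 :: 'k)" "\<And>b. \<exists>c. k * Fract (a * b) 1 = Fract c 1"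
proof -
  obtain p q where pq: "k = Fract p q" "q \<noteq> 0"
    by (rule Fract_cases)
  have "k * Fract (q * b) 1 = Fract (p * b) 1" for b
    using pq by (simp add: eq_fract algebra_simps)
  then show ?thesis
    using that pq by blast
qed

text \<open>
  A formal sum \<open>\<Sum> (k\<^sub>i, v\<^sub>i)\<close> can be evaluated in \<open>M\<close> after multiplication by a common denominator
  of the \<open>k\<^sub>i\<close>; the sums evaluating to zero for all large enough denominators form a subgroup that
  contains the relations.
\<close>

lemma pure_tensor_eq_zeroD:
  assumes "v \<in> carrier M" "pure_tensor 1 v = \<zero>\<^bsub>tensor\<^esub>"
  obtains a where "a \<noteq> 0" "a \<odot> v = \<zero>"
proof -
  \<comment> \<open>Evaluation of a generator after multiplication by a, with default \<zero> where
    a does not clear the denominator. There the relations need not be respected, so E below admits c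
    only if all multiples of some nonzero a send it to \<zero>.\<close>
  define f where "f = (\<lambda>a (k, v). if \<exists>c. k * Fract a 1 = Fract c 1
    then integral_part (k * Fract a 1) \<odot> v else \<zero>)"
  have f: "f a (k, v) = c \<odot> v" if "k * Fract a 1 = Fract c 1" for a k v c
    using that by (auto simp: f_def)
  have group: "group (add_monoid M)"
    using a_comm_group by (simp add: comm_group_def)
  have "f a ` (UNIV \<times> carrier M) \<subseteq> carrier (add_monoid M)" for a
    by (auto simp: f_def)
  then have "\<exists>h. h \<in> hom tensor_generators (add_monoid M) \<and>
      (\<forall>x\<in>UNIV \<times> carrier M. h (frag_of x) = f a x)" for a
    using comm_group.free_Abelian_group_universal [OF a_comm_group, of "f a" "UNIV \<times> carrier M"] by metis
  then obtain h where hom: "\<And>a. h a \<in> hom tensor_generators (add_monoid M)"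
      and h: "\<And>a k v. v \<in> carrier M \<Longrightarrow> h a (frag_of (k, v)) = f a (k, v)"
    by (metis SigmaI UNIV_I)
  have h_closed: "h a c \<in> carrier M" if "Poly_Mapping.keys c \<subseteq> UNIV \<times> carrier M" for a c
    using hom_in_carrier [OF hom] that by fastforce
  have h_add: "h a (c + d) = h a c \<oplus> h a d"
    if "Poly_Mapping.keys c \<subseteq> UNIV \<times> carrier M" "Poly_Mapping.keys d \<subseteq> UNIV \<times> carrier M" for a c d
    using hom_mult [OF hom, of c d] that by simp
  have h_0: "h a 0 = \<zero>" for a
    using hom_one [OF hom _ group, of a] by simp
  have h_uminus: "h a (- c) = \<ominus> h a c" if "Poly_Mapping.keys c \<subseteq> UNIV \<times> carrier M" for a c
    using h_add [of "- c" c a] that h_0 h_closed [of c a] h_closed [of "- c" a]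
    by (simp add: M.minus_equality)
  define E where "E = {c. Poly_Mapping.keys c \<subseteq> UNIV \<times> carrier M \<and>
    (\<exists>a. a \<noteq> 0 \<and> (\<forall>b. h (a * b) c = \<zero>))}"
  have E_uminus: "- c \<in> E" if "c \<in> E" for c
    using that h_uminus by (auto simp: E_def) 
  have E_add: "c + d \<in> E" if c: "c \<in> E" and d: "d \<in> E" for c d
  proof -
    obtain a a' where a: "a \<noteq> 0" "\<And>b. h (a * b) c = \<zero>" "a' \<noteq> 0" "\<And>b. h (a' * b) d = \<zero>"
      using c d by (auto simp: E_def)
    have "h (a * a' * b) c = \<zero>" for b
      using a(2) [of "a' * b"] by (simp add: mult.assoc)
    moreover have "h (a * a' * b) d = \<zero>" for b
      using a(4) [of "a * b"] by (simp add: mult.assoc mult.left_commute)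
    ultimately have "h (a * a' * b) (c + d) = \<zero>" for b
      using c d by (simp add: h_add E_def)
    moreover have "Poly_Mapping.keys (c + d) \<subseteq> UNIV \<times> carrier M"
      by (rule order_trans [OF keys_add], use c d in \<open>auto simp: E_def\<close>)
    ultimately show ?thesis
      using a by (auto simp: E_def intro!: exI [of _ "a * a'"])
  qed
  have h_diff: "h a (c - d) = h a c \<ominus> h a d"
    if "Poly_Mapping.keys c \<subseteq> UNIV \<times> carrier M" "Poly_Mapping.keys d \<subseteq> UNIV \<times> carrier M" for a c d
    using h_add [of c "- d" a] h_uminus [of d a] that by (simp add: a_minus_def)
  have cancel: "x \<oplus> y \<ominus> x \<ominus> y = \<zero>" if "x \<in> carrier M" "y \<in> carrier M" for x y
  proof -
    have "x \<oplus> y \<ominus> x = y"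
      using that by (simp add: M.a_comm [of x y] a_minus_def M.a_assoc M.r_neg)
    then show ?thesis
      using that by (simp add: M.r_neg a_minus_def)
  qed
  have rel: "c \<in> E" if "c \<in> tensor_relations M" for c
  proof -
    have keys: "Poly_Mapping.keys c \<subseteq> UNIV \<times> carrier M"
      using subsetD [OF tensor_relations_subset that] by (simp only: carrier_free_Abelian_group_iff)
    have kd: "Poly_Mapping.keys (frag_of x - frag_of y) \<subseteq> UNIV \<times> carrier M"
      if "x \<in> UNIV \<times> carrier M" "y \<in> UNIV \<times> carrier M" for x y :: "'k fract \<times> 'v"
      by (rule order_trans [OF keys_diff], use that in auto)
    have "\<exists>a. a \<noteq> 0 \<and> (\<forall>b. h (a * b) c = \<zero>)"
      using that unfolding tensor_relations_def
    proof (elim UnE CollectE exE conjE)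
      fix k l v assume c: "c = frag_of (k + l, v) - frag_of (k, v) - frag_of (l, v)" "v \<in> carrier M"
      obtain a1 where a1: "a1 \<noteq> 0" "\<And>b. \<exists>c. k * Fract (a1 * b) 1 = Fract c 1"
        using denominator_exists [of k] by metis
      obtain a2 where a2: "a2 \<noteq> 0" "\<And>b. \<exists>c. l * Fract (a2 * b) 1 = Fract c 1"
        using denominator_exists [of l] by metis
      have "h (a1 * a2 * b) c = \<zero>" for b
      proof -
        obtain r s where r: "k * Fract (a1 * a2 * b) 1 = Fract r 1"
            and s: "l * Fract (a1 * a2 * b) 1 = Fract s 1"
          using a1(2) [of "a2 * b"] a2(2) [of "a1 * b"] by (metis mult.assoc mult.left_commute)
        have rs: "(k + l) * Fract (a1 * a2 * b) 1 = Fract (r + s) 1"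
          using r s by (simp add: distrib_right)
        show ?thesis
          using c kd by (simp add: h_diff h f [OF r] f [OF s] f [OF rs] smult_l_distr [simplified] cancel)
      qed
      then show ?thesis
        using a1 a2 by (intro exI [of _ "a1 * a2"]) auto
    next
      fix k v w assume c: "c = frag_of (k, v \<oplus> w) - frag_of (k, v) - frag_of (k, w)"
        "v \<in> carrier M" "w \<in> carrier M"
      obtain a where a: "a \<noteq> 0" "\<And>b. \<exists>c. k * Fract (a * b) 1 = Fract c 1"
        using denominator_exists [of k] by metis
      have "h (a * b) c = \<zero>" for b
      proof -
        obtain r where r: "k * Fract (a * b) 1 = Fract r 1"
          using a(2) by blast
        show ?thesis
          using c kd by (simp add: h_diff h f [OF r] smult_r_distr cancel)
      qed
      then show ?thesis
        using a by blast
    next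
      fix k a' v assume c: "c = frag_of (k * Fract a' 1, v) - frag_of (k, a' \<odot> v)" "v \<in> carrier M"
      obtain a where a: "a \<noteq> 0" "\<And>b. \<exists>c. k * Fract (a * b) 1 = Fract c 1"
        using denominator_exists [of k] by metis
      have "h (a * b) c = \<zero>" for b
      proof -
        obtain r where r: "k * Fract (a * b) 1 = Fract r 1"
          using a(2) by blast
        have "k * Fract a' 1 * Fract (a * b) 1 = Fract a' 1 * (k * Fract (a * b) 1)"
          by (simp only: mult_ac)
        then have r': "k * Fract a' 1 * Fract (a * b) 1 = Fract (r * a') 1"
          by (simp add: r mult.commute)
        show ?thesis
          using c by (simp add: h_diff h f [OF r] f [OF r'] smult_assoc1 [simplified])
      qed
      then show ?thesis
        using a by blast
    qed
    then show ?thesis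
      using keys by (simp add: E_def)
  qed
  have E: "c \<in> E" if "c \<in> relation_subgroup" for c
    using that
  proof (induction rule: generate.induct)
    case one
    then show ?case using h_0 by (auto simp: E_def intro: exI [of _ 1])
  next
    case (incl h)
    then show ?case by (rule rel)
  next
    case (inv h)
    then have "inv\<^bsub>tensor_generators\<^esub> h = - h"
      using tensor_relations_subset by auto
    then show ?case using rel [OF inv] E_uminus by simp
  next
    case (eng h1 h2)
    then show ?case using E_add by simp
  qed
  have "frag_of (1, v) \<in> E"
    using assms(2) by (intro E) (simp add: pure_tensor_def tensor_zero tensor_class_eq_iff)
  then obtain a where a: "a \<noteq> 0" "\<And>b. h (a * b) (frag_of (1, v)) = \<zero>"
    by (auto simp: E_def)
  have "a \<odot> v = \<zero>"
    using a(2) [of 1] f [of 1 a a v] assms(1) by (simp add: h)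
  then show ?thesis
    using that a by blast
qed

section \<open>Rank in terms of families in the module itself\<close>

lemma common_denominator:
  assumes "finite I"
  obtains a b where "a \<noteq> (0 :: 'k)" "\<And>i. i \<in> I \<Longrightarrow> k i = Fract (b i) a"
proof -
  have "\<exists>a b. a \<noteq> (0 :: 'k) \<and> (\<forall>i\<in>I. k i = Fract (b i) a)"
    using assms
  proof (induction I)
    case empty
    then show ?case by (intro exI [of _ 1]) auto
  next
    case (insert i I)
    obtain a b where ab: "a \<noteq> 0" "\<forall>j\<in>I. k j = Fract (b j) a"
      using insert by blast
    obtain p q where pq: "k i = Fract p q" "q \<noteq> 0"
      by (rule Fract_cases)
    have "k i = Fract (p * a) (a * q)" "\<forall>j\<in>I. k j = Fract (b j * q) (a * q)"
      using ab pq by (auto simp: eq_fract)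
    then show ?case
      using ab pq insert(2)
      by (intro exI [of _ "a * q"] exI [of _ "\<lambda>j. if j = i then p * a else b j * q"]) auto
  qed
  then show ?thesis using that by blast
qed

text \<open>Together with \<open>generically_spanning\<close>, this describes a basis of the tensor
  product of a torsion-free module by vectors of M with coefficients in the domain. It is the form
  in which the rank is used later.\<close>

definition independent_family :: "('i \<Rightarrow> 'v) \<Rightarrow> 'i set \<Rightarrow> bool" where
  "independent_family w I \<longleftrightarrow>
     (\<forall>b. finsum M (\<lambda>i. b i \<odot> w i) I = \<zero> \<longrightarrow> (\<forall>i\<in>I. b i = 0))"

definition generically_spanning :: "('i \<Rightarrow> 'v) \<Rightarrow> 'i set \<Rightarrow> bool" where
  "generically_spanning w I \<longleftrightarrow>
     (\<forall>v\<in>carrier M. \<exists>a b. a \<noteq> 0 \<and> a \<odot> v = finsum M (\<lambda>i. b i \<odot> w i) I)"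

lemma fract_combination:
  assumes "finite I" "\<And>i. i \<in> I \<Longrightarrow> w i \<in> carrier M" "\<And>i. i \<in> I \<Longrightarrow> k i = Fract (b i) a" "a \<noteq> 0"
  shows "Fract a 1 \<odot>\<^bsub>tensor\<^esub> finsum tensor (\<lambda>i. k i \<odot>\<^bsub>tensor\<^esub> pure_tensor 1 (w i)) I =
    pure_tensor 1 (finsum M (\<lambda>i. b i \<odot> w i) I)"
proof -
  have "Fract a 1 \<odot>\<^bsub>tensor\<^esub> finsum tensor (\<lambda>i. k i \<odot>\<^bsub>tensor\<^esub> pure_tensor 1 (w i)) I =
      finsum tensor (\<lambda>i. Fract a 1 \<odot>\<^bsub>tensor\<^esub> (k i \<odot>\<^bsub>tensor\<^esub> pure_tensor 1 (w i))) I"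
    using assms by (subst T.finsum_smult_ldistr) auto
  also have "\<dots> = finsum tensor (\<lambda>i. pure_tensor 1 (b i \<odot> w i)) I"
  proof (rule T.M.finsum_cong')
    fix i assume i: "i \<in> I"
    have "Fract a 1 * k i = Fract (b i) 1"
      using i assms by (simp add: eq_fract)
    then show "Fract a 1 \<odot>\<^bsub>tensor\<^esub> (k i \<odot>\<^bsub>tensor\<^esub> pure_tensor 1 (w i)) = pure_tensor 1 (b i \<odot> w i)"
      using i assms by (simp add: smult_pure_tensor pure_tensor_balance)
  qed (use assms in auto)
  also have "\<dots> = pure_tensor 1 (finsum M (\<lambda>i. b i \<odot> w i) I)"
    using assms by (subst pure_tensor_finsum) auto
  finally show ?thesis .
qed

context
  fixes w :: "'i \<Rightarrow> 'v" and I :: "'i set"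
  assumes fin: "finite I" and w: "\<And>i. i \<in> I \<Longrightarrow> w i \<in> carrier M"
    and tf: "torsion_free M" and indep: "independent_family w I"
begin

lemma pure_tensor_eq_zero: "v \<in> carrier M \<Longrightarrow> pure_tensor 1 v = \<zero>\<^bsub>tensor\<^esub> \<Longrightarrow> v = \<zero>"
  using tf unfolding torsion_free_def by (metis pure_tensor_eq_zeroD)

text \<open>A common denominator turns the relation into 1 (x) s = 0 for a combination s in M, and v
  -> 1 (x) v is injective on a torsion-free module.\<close>

lemma tensor_independent:
  assumes "finsum tensor (\<lambda>i. k i \<odot>\<^bsub>tensor\<^esub> pure_tensor 1 (w i)) I = \<zero>\<^bsub>tensor\<^esub>" "i \<in> I"
  shows "k i = 0"
proof -
  obtain a b where ab: "a \<noteq> 0" "\<And>i. i \<in> I \<Longrightarrow> k i = Fract (b i) a"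
    using common_denominator [OF fin] by metis
  have "pure_tensor 1 (finsum M (\<lambda>i. b i \<odot> w i) I) = \<zero>\<^bsub>tensor\<^esub>"
    using fract_combination [of I w k b a] fin w ab assms(1) by simp
  then have "finsum M (\<lambda>i. b i \<odot> w i) I = \<zero>"
    using w by (intro pure_tensor_eq_zero) (auto intro!: finsum_closed)
  then have "b i = 0"
    using indep assms(2) by (auto simp: independent_family_def)
  then show ?thesis
    using ab assms(2) by (simp add: fract_collapse)
qed

text \<open>Bases are sets in the vector space theory, so the family must have distinct members. Two
  equal ones would satisfy a relation with coefficients 1 and -1.\<close>

lemma inj_on_pure_tensor: "inj_on (\<lambda>i. pure_tensor 1 (w i)) I"
proof (rule inj_onI, rule ccontr)
  fix i j assume ij: "i \<in> I" "j \<in> I" "pure_tensor 1 (w i) = pure_tensor 1 (w j)" "i \<noteq> j"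
  define k where "k = (\<lambda>l. if l = i then 1 else if l = j then -1 else 0 :: 'k fract)"
  have I: "I = insert i (insert j (I - {i, j}))"
    using ij by auto
  have "finsum tensor (\<lambda>l. k l \<odot>\<^bsub>tensor\<^esub> pure_tensor 1 (w l)) (I - {i, j}) = \<zero>\<^bsub>tensor\<^esub>"
    using w by (intro T.M.add.finprod_one_eqI) (auto simp: k_def T.smult_l_null [simplified])
  moreover have "finsum tensor (\<lambda>l. k l \<odot>\<^bsub>tensor\<^esub> pure_tensor 1 (w l)) I =
     (k i \<odot>\<^bsub>tensor\<^esub> pure_tensor 1 (w i)) \<oplus>\<^bsub>tensor\<^esub> ((k j \<odot>\<^bsub>tensor\<^esub> pure_tensor 1 (w j)) \<oplus>\<^bsub>tensor\<^esub>
     finsum tensor (\<lambda>l. k l \<odot>\<^bsub>tensor\<^esub> pure_tensor 1 (w l)) (I - {i, j}))"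
    using fin w ij by (subst I) (simp add: Pi_def)
  moreover have "k j \<odot>\<^bsub>tensor\<^esub> pure_tensor 1 (w j) = \<ominus>\<^bsub>tensor\<^esub> pure_tensor 1 (w i)"
    using T.smult_l_minus [of 1 "pure_tensor 1 (w j)"] T.smult_one [of "pure_tensor 1 (w j)"] ij w
    by (simp add: k_def)
  moreover have "k i \<odot>\<^bsub>tensor\<^esub> pure_tensor 1 (w i) = pure_tensor 1 (w i)"
    using T.smult_one [of "pure_tensor 1 (w i)"] ij w by (simp add: k_def)
  ultimately have "finsum tensor (\<lambda>l. k l \<odot>\<^bsub>tensor\<^esub> pure_tensor 1 (w l)) I =
      pure_tensor 1 (w i) \<oplus>\<^bsub>tensor\<^esub> (\<ominus>\<^bsub>tensor\<^esub> pure_tensor 1 (w i) \<oplus>\<^bsub>tensor\<^esub> \<zero>\<^bsub>tensor\<^esub>)"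
    by (simp only:)
  then have "finsum tensor (\<lambda>l. k l \<odot>\<^bsub>tensor\<^esub> pure_tensor 1 (w l)) I = \<zero>\<^bsub>tensor\<^esub>"
    using ij w T.M.r_neg [of "pure_tensor 1 (w i)"] by simp
  then have "k i = 0"
    using tensor_independent ij by blast
  then show False
    by (simp add: k_def)
qed

lemma lincomb_pure_tensor:
  "T.lincomb k ((\<lambda>i. pure_tensor 1 (w i)) ` I) =
     finsum tensor (\<lambda>i. k (pure_tensor 1 (w i)) \<odot>\<^bsub>tensor\<^esub> pure_tensor 1 (w i)) I"
  unfolding T.lincomb_def
  using w by (subst T.M.add.finprod_reindex [OF _ inj_on_pure_tensor]) auto

lemma lin_indpt_pure_tensor: "T.lin_indpt ((\<lambda>i. pure_tensor 1 (w i)) ` I)"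
proof (rule T.finite_lin_indpt2)
  fix k assume "T.lincomb k ((\<lambda>i. pure_tensor 1 (w i)) ` I) = \<zero>\<^bsub>tensor\<^esub>"
  then have "k (pure_tensor 1 (w i)) = 0" if "i \<in> I" for i
    using tensor_independent [of "\<lambda>i. k (pure_tensor 1 (w i))" i] that
    unfolding lincomb_pure_tensor by blast
  then show "\<forall>v\<in>(\<lambda>i. pure_tensor 1 (w i)) ` I. k v = \<zero>\<^bsub>ring_of_type_algebra\<^esub>"
    by auto
qed (use fin w in auto)

lemma has_rankI:
  assumes "generically_spanning w I"
  shows "has_rank M (card I)"
proof -
  let ?B = "(\<lambda>i. pure_tensor 1 (w i)) ` I"
  have B: "finite ?B" "?B \<subseteq> carrier tensor"
    using fin w by auto
  have "\<exists>k. tensor_class c = T.lincomb k ?B" if "Poly_Mapping.keys c \<subseteq> UNIV \<times> carrier M" for c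
    using that
  proof (induction c rule: free_Abelian_group_induct [consumes 1, case_names zero diff of])
    case zero
    have "T.lincomb (\<lambda>_. 0) ?B = \<zero>\<^bsub>tensor\<^esub>"
      unfolding T.lincomb_def using B
      by (intro T.M.add.finprod_one_eqI) (auto simp: T.smult_l_null [simplified])
    then show ?case by (metis tensor_zero)
  next
    case (diff x y)
    obtain k l where kl: "tensor_class x = T.lincomb k ?B" "tensor_class y = T.lincomb l ?B"
      using diff by blast
    have "tensor_class (x - y) \<oplus>\<^bsub>tensor\<^esub> tensor_class y = tensor_class x"
      using diff order_trans [OF keys_diff, of x y] by (subst tensor_add) auto
    moreover have "tensor_class (x - y) \<in> carrier tensor"
      using diff order_trans [OF keys_diff, of x y] by (intro tensor_class_carrier) auto
    ultimately have "tensor_class (x - y) = tensor_class x \<ominus>\<^bsub>tensor\<^esub> tensor_class y"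
      using diff by (metis T.M.add.inv_solve_right' a_minus_def tensor_class_carrier)
    also have "\<dots> = T.lincomb (\<lambda>v. k v \<ominus>\<^bsub>ring_of_type_algebra\<^esub> l v) ?B"
      unfolding kl by (rule T.lincomb_diff [symmetric]) (use B in auto)
    finally show ?case by blast
  next
    case (of x)
    then obtain k v where x: "x = (k, v)" "v \<in> carrier M"
      by auto
    obtain a b where ab: "a \<noteq> 0" "a \<odot> v = finsum M (\<lambda>i. b i \<odot> w i) I"
      using assms x(2) by (auto simp: generically_spanning_def)
    define l where "l = (\<lambda>i. k * Fract (b i) a)"
    define l' where "l' = (\<lambda>t. l (inv_into I (\<lambda>i. pure_tensor 1 (w i)) t))"
    \<comment> \<open>Since k = (k/a) a, the scalar a moves across the tensor sign, where a v is a
      combination of the w i.\<close>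
    have "k * Fract 1 a * Fract a 1 = k"
      using ab(1) mult_fract_cancel [of a 1 1] by (simp add: mult.assoc fract_collapse)
    then have "pure_tensor k v = pure_tensor (k * Fract 1 a) (a \<odot> v)"
      using x(2) by (simp only: pure_tensor_balance)
    also have "\<dots> = finsum tensor (\<lambda>i. pure_tensor (k * Fract 1 a) (b i \<odot> w i)) I"
      using fin w by (simp add: ab pure_tensor_finsum)
    also have "\<dots> = finsum tensor (\<lambda>i. l i \<odot>\<^bsub>tensor\<^esub> pure_tensor 1 (w i)) I"
      using w by (intro T.M.finsum_cong')
        (auto simp: pure_tensor_balance smult_pure_tensor l_def mult.assoc)
    also have "\<dots> = T.lincomb l' ?B"
      unfolding lincomb_pure_tensor using w inj_on_pure_tensor
      by (intro T.M.finsum_cong') (auto simp: l'_def inv_into_f_f [OF inj_on_pure_tensor])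
    finally show ?case
      unfolding x pure_tensor_def by blast
  qed
  then have "carrier tensor \<subseteq> T.span ?B"
    using B by (auto simp: T.finite_span elim!: tensor_carrierE)
  then have gen: "T.span ?B = carrier tensor"
    using T.span_is_subset2 [OF B(2)] by auto
  then have "T.fin_dim"
    using B T.fin_dim_def by blast
  moreover have "T.basis ?B"
    using gen B lin_indpt_pure_tensor by (simp add: T.basis_def)
  then have "T.dim = card ?B"
    using B by (intro T.dim_basis)
  ultimately show ?thesis
    by (simp add: has_rank_def card_image inj_on_pure_tensor)
qed

text \<open>As many independent vectors as the dimension form a basis. Expand 1 (x) v in it, clear
  denominators, and return to M by injectivity.\<close>

lemma generically_spanningI:
  assumes "has_rank M (card I)"
  shows "generically_spanning w I"
  unfolding generically_spanning_def
proof
  fix v assume v: "v \<in> carrier M"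
  let ?B = "(\<lambda>i. pure_tensor 1 (w i)) ` I"
  have B: "finite ?B" "?B \<subseteq> carrier tensor"
    using fin w by auto
  have "T.basis ?B"
    using assms B lin_indpt_pure_tensor
    by (intro T.dim_li_is_basis) (simp_all add: has_rank_def card_image inj_on_pure_tensor)
  then have "pure_tensor 1 v \<in> T.span ?B"
    using v by (simp add: T.basis_def)
  then obtain k where "pure_tensor 1 v = T.lincomb k ?B"
    using B by (auto simp: T.finite_span)
  then have k: "pure_tensor 1 v =
      finsum tensor (\<lambda>i. k (pure_tensor 1 (w i)) \<odot>\<^bsub>tensor\<^esub> pure_tensor 1 (w i)) I"
    by (simp add: lincomb_pure_tensor)
  obtain a b where ab: "a \<noteq> 0" "\<And>i. i \<in> I \<Longrightarrow> k (pure_tensor 1 (w i)) = Fract (b i) a"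
    using common_denominator [OF fin, of "\<lambda>i. k (pure_tensor 1 (w i))"] by metis
  let ?s = "finsum M (\<lambda>i. b i \<odot> w i) I"
  have s: "?s \<in> carrier M"
    using w by (auto intro!: finsum_closed)
  have "pure_tensor 1 (a \<odot> v) = pure_tensor 1 ?s"
    using fract_combination [of I w "\<lambda>i. k (pure_tensor 1 (w i))" b a] fin w ab v
    by (simp add: k [symmetric] smult_pure_tensor pure_tensor_balance)
  moreover have "pure_tensor 1 (a \<odot> v) = pure_tensor 1 (a \<odot> v \<ominus> ?s) \<oplus>\<^bsub>tensor\<^esub> pure_tensor 1 ?s"
    using v s by (subst pure_tensor_add_right [symmetric]) (auto simp: a_minus_def M.a_assoc M.l_neg)
  ultimately have "pure_tensor 1 (a \<odot> v \<ominus> ?s) = \<zero>\<^bsub>tensor\<^esub>"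
    using v s T.M.add.r_cancel_one' [of "pure_tensor 1 ?s" "pure_tensor 1 (a \<odot> v \<ominus> ?s)"]
    by simp
  then have "a \<odot> v \<ominus> ?s = \<zero>"
    using v s by (intro pure_tensor_eq_zero) auto
  then have "a \<odot> v = ?s"
    using v s by simp
  then show "\<exists>a b. a \<noteq> 0 \<and> a \<odot> v = finsum M (\<lambda>i. b i \<odot> w i) I"
    using ab by blast
qed

end

end

section \<open>The module \<open>R / R(x\<^sup>m - g)\<close> in coordinates\<close>

text \<open>
  In \<open>R / R(x\<^sup>m - g)\<close> one has \<open>x\<^sup>i\<^sup>+\<^sup>m = \<sigma>\<^sup>i(g) x\<^sup>i\<close>. An element is encoded by the function \<open>v\<close> on all of
  \<open>\<int>\<close> whose value \<open>v i\<close> is the coefficient with respect to \<open>x\<^sup>i\<close> of its component in the lines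
  \<open>K x\<^sup>i = K x\<^sup>i\<^sup>+\<^sup>m = \<dots>\<close>.
\<close>

typedef coord = "UNIV :: (int \<Rightarrow> ratfun) set"
  morphisms coord_at Abs_coord ..

notation coord_at (infixl "\<bullet>" 90)

setup_lifting type_definition_coord

lemma coord_eqI: "(\<And>i. v \<bullet> i = w \<bullet> i) \<Longrightarrow> v = w"
  by (simp add: coord_at_inject [symmetric] fun_eq_iff)

instantiation coord :: ab_group_add
begin

lift_definition zero_coord :: coord is "\<lambda>i. 0" .
lift_definition plus_coord :: "coord \<Rightarrow> coord \<Rightarrow> coord" is "\<lambda>v w i. v i + w i" .
lift_definition minus_coord :: "coord \<Rightarrow> coord \<Rightarrow> coord" is "\<lambda>v w i. v i - w i" .
lift_definition uminus_coord :: "coord \<Rightarrow> coord" is "\<lambda>v i. - v i" .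

instance
  by standard (transfer; simp add: fun_eq_iff algebra_simps)+

end

lemma coord_at_simps [simp]:
  "0 \<bullet> i = 0" "(v + w) \<bullet> i = v \<bullet> i + w \<bullet> i" "(v - w) \<bullet> i = v \<bullet> i - w \<bullet> i" "(- v) \<bullet> i = - (v \<bullet> i)"
  by (transfer; simp)+

lemma coord_at_sum: "sum f I \<bullet> i = (\<Sum>l\<in>I. f l \<bullet> i)"
  by (induction I rule: infinite_finite_induct) auto

text \<open>The condition equates v i x^i with v (i + m) x^(i + m), two expressions of the same
  component. For nonzero g and m an element is determined by its coefficients at 0, ..., m - 1, yet
  x shifts indices without wrap-around.\<close>

definition coord_module :: "nat \<Rightarrow> ratfun \<Rightarrow> coord set" where
  "coord_module m g = {v. \<forall>i. v \<bullet> i = v \<bullet> (i + int m) * ratfun_shift (2 * of_int i) g}"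

definition scale :: "ratfun \<Rightarrow> coord \<Rightarrow> coord" where
  "scale a v = Abs_coord (\<lambda>i. a * v \<bullet> i)"

text \<open>x^k (v i x^i) = \<sigma>^k(v i) x^(i + k), so index i receives what was at i - k.
  Negative k is included.\<close>

definition x_power :: "int \<Rightarrow> coord \<Rightarrow> coord" where
  "x_power k v = Abs_coord (\<lambda>i. ratfun_shift (2 * of_int k) (v \<bullet> (i - k)))"

text \<open>The polynomial by which f e must act when the Casimir element (h + 1)^2 + 4 f e acts as
  \<theta>.\<close>

definition fe_poly :: "complex \<Rightarrow> complex poly" where
  "fe_poly \<theta> = smult (1/4) ([:\<theta>:] - [:1, 1:]^2)"

definition coord_e :: "coord \<Rightarrow> coord" where
  "coord_e v = x_power 1 v"

definition coord_f :: "complex \<Rightarrow> coord \<Rightarrow> coord" where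
  "coord_f \<theta> v = scale (ratfun_of_poly (fe_poly \<theta>)) (x_power (-1) v)"

definition coord_h :: "coord \<Rightarrow> coord" where
  "coord_h v = scale (ratfun_of_poly [:0, 1:]) v"

text \<open>The product g \<sigma>^m(g) ... \<sigma>^(m (n - 1))(g), by which x^(m n) differs from 1
  in the quotient.\<close>

fun cocycle :: "nat \<Rightarrow> ratfun \<Rightarrow> nat \<Rightarrow> ratfun" where
  "cocycle m g 0 = 1"
| "cocycle m g (Suc n) = cocycle m g n * ratfun_shift (2 * of_nat (m * n)) g"

text \<open>The class of 1; its coefficient at i is the scalar turning x^i into 1. For i = m n that
  is the inverse of the cocycle. For i = - m n, rewriting x^(-m n) x^(m n) = 1 gives the cocycle
  shifted by 2i.\<close>

definition coord_unit :: "nat \<Rightarrow> ratfun \<Rightarrow> coord" where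
  "coord_unit m g = Abs_coord (\<lambda>i.
     if int m dvd i then
       if i \<ge> 0 then inverse (cocycle m g (nat (i div int m)))
       else ratfun_shift (2 * of_int i) (cocycle m g (nat (- i div int m)))
     else 0)"

lemma coord_unit_apply: "coord_unit m g \<bullet> i =
    (if int m dvd i then
       if i \<ge> 0 then inverse (cocycle m g (nat (i div int m)))
       else ratfun_shift (2 * of_int i) (cocycle m g (nat (- i div int m)))
     else 0)"
  by (simp add: coord_unit_def Abs_coord_inverse)

lemma scale_apply [simp]: "scale a v \<bullet> i = a * v \<bullet> i"
  by (simp add: scale_def Abs_coord_inverse)

lemma x_power_apply: "x_power k v \<bullet> i = ratfun_shift (2 * of_int k) (v \<bullet> (i - k))"
  by (simp add: x_power_def Abs_coord_inverse)

lemma scale_scale: "scale a (scale b v) = scale (a * b) v"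
  by (rule coord_eqI) (simp add: scale_apply mult.assoc)

lemma scale_1 [simp]: "scale 1 v = v"
  by (rule coord_eqI) (simp add: scale_apply)

lemma scale_0 [simp]: "scale 0 v = 0"
  by (rule coord_eqI) (simp add: scale_apply)

lemma scale_0_right [simp]: "scale a 0 = 0"
  by (rule coord_eqI) (simp add: scale_apply)

lemma scale_add: "scale a (v + w) = scale a v + scale a w"
  by (rule coord_eqI) (simp add: scale_apply distrib_left)

lemma scale_add_left: "scale (a + b) v = scale a v + scale b v"
  by (rule coord_eqI) (simp add: scale_apply distrib_right)

lemma scale_diff: "scale a (v - w) = scale a v - scale a w"
  by (rule coord_eqI) (simp add: scale_apply right_diff_distrib)

lemma scale_diff_left: "scale (a - b) v = scale a v - scale b v"
  by (rule coord_eqI) (simp add: left_diff_distrib)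

lemma scale_sum: "scale a (sum w I) = (\<Sum>i\<in>I. scale a (w i))"
  by (induction I rule: infinite_finite_induct) (auto simp: scale_add)

lemma coord_nonzeroE:
  assumes "v \<noteq> (0 :: coord)"
  obtains i where "v \<bullet> i \<noteq> 0"
  using assms by (metis coord_at_simps(1) coord_eqI)

lemma scale_eq_0_iff: "scale a v = 0 \<longleftrightarrow> a = 0 \<or> v = 0"
  by (metis coord_at_simps(1) coord_nonzeroE mult_eq_0_iff scale_0 scale_0_right scale_apply)

lemma x_power_0 [simp]: "x_power 0 v = v"
  by (rule coord_eqI) (simp add: x_power_apply)

lemma x_power_zero [simp]: "x_power k 0 = 0"
  by (rule coord_eqI) (simp add: x_power_apply)

lemma x_power_add: "x_power k (v + w) = x_power k v + x_power k w"
  by (rule coord_eqI) (simp add: x_power_apply ratfun_shift_add)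

lemma x_power_scale: "x_power k (scale a v) = scale (ratfun_shift (2 * of_int k) a) (x_power k v)"
  by (rule coord_eqI) (simp add: x_power_apply ratfun_shift_mult)

lemma x_power_x_power: "x_power k (x_power l v) = x_power (k + l) v"
  by (rule coord_eqI) (simp add: x_power_apply ratfun_shift_shift algebra_simps)

lemma coord_moduleI:
  "(\<And>i. v \<bullet> i = v \<bullet> (i + int m) * ratfun_shift (2 * of_int i) g) \<Longrightarrow> v \<in> coord_module m g"
  unfolding coord_module_def by blast

lemma coord_moduleD:
  "v \<in> coord_module m g \<Longrightarrow> v \<bullet> i = v \<bullet> (i + int m) * ratfun_shift (2 * of_int i) g"
  unfolding coord_module_def by blast

lemma coord_module_0 [simp]: "0 \<in> coord_module m g"
  by (rule coord_moduleI) simp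

lemma coord_module_add:
  assumes "v \<in> coord_module m g" "w \<in> coord_module m g"
  shows "v + w \<in> coord_module m g"
proof (rule coord_moduleI)
  fix i
  show "(v + w) \<bullet> i = (v + w) \<bullet> (i + int m) * ratfun_shift (2 * of_int i) g"
    using coord_moduleD [OF assms(1), of i] coord_moduleD [OF assms(2), of i]
    by (simp add: distrib_right)
qed

lemma coord_module_diff:
  assumes "v \<in> coord_module m g" "w \<in> coord_module m g"
  shows "v - w \<in> coord_module m g"
proof (rule coord_moduleI)
  fix i
  show "(v - w) \<bullet> i = (v - w) \<bullet> (i + int m) * ratfun_shift (2 * of_int i) g"
    using coord_moduleD [OF assms(1), of i] coord_moduleD [OF assms(2), of i]
    by (simp add: left_diff_distrib)
qed

lemma coord_module_scale: "v \<in> coord_module m g \<Longrightarrow> scale a v \<in> coord_module m g"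
  by (rule coord_moduleI) (metis scale_apply coord_moduleD mult.assoc)

lemma coord_module_sum:
  "(\<And>i. i \<in> I \<Longrightarrow> w i \<in> coord_module m g) \<Longrightarrow> sum w I \<in> coord_module m g"
  by (induction I rule: infinite_finite_induct) (auto simp: coord_module_add)

lemma coord_module_x_power:
  assumes "v \<in> coord_module m g"
  shows "x_power k v \<in> coord_module m g"
proof (rule coord_moduleI)
  fix i
  have "x_power k v \<bullet> i = ratfun_shift (2 * of_int k)
      (v \<bullet> (i - k + int m) * ratfun_shift (2 * of_int (i - k)) g)"
    using coord_moduleD [OF assms, of "i - k"] by (simp add: x_power_apply)
  then show "x_power k v \<bullet> i = x_power k v \<bullet> (i + int m) * ratfun_shift (2 * of_int i) g"
    by (simp add: x_power_apply ratfun_shift_mult ratfun_shift_shift algebra_simps)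
qed

section \<open>The cocycle, the element 1 and the expansion in powers of x\<close>

lemma cocycle_nonzero: "g \<noteq> 0 \<Longrightarrow> cocycle m g n \<noteq> 0"
  by (induction n) auto

text \<open>Splits off the first factor, where the recursion splits off the last; the negative
  indices of \<open>coord_unit\<close> need this form.\<close>

lemma cocycle_Suc_left:
  "cocycle m g (Suc n) = g * ratfun_shift (2 * of_nat m) (cocycle m g n)"
proof (induction n)
  case (Suc n)
  have "ratfun_shift (2 * of_nat m) (ratfun_shift (2 * of_nat (m * n)) g) =
      ratfun_shift (2 * of_nat (m * Suc n)) g"
    by (simp add: ratfun_shift_shift algebra_simps)
  then have "g * ratfun_shift (2 * of_nat m) (cocycle m g (Suc n)) =
      (g * ratfun_shift (2 * of_nat m) (cocycle m g n)) * ratfun_shift (2 * of_nat (m * Suc n)) g"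
    by (simp only: cocycle.simps ratfun_shift_mult mult.assoc)
  then show ?case
    using Suc by (simp only: cocycle.simps)
qed simp

context
  fixes m :: nat and g :: ratfun
  assumes m: "m > 0" and g: "g \<noteq> 0"
begin

lemma coord_module_multiple:
  assumes "v \<in> coord_module m g"
  shows "v \<bullet> i = 0 \<longleftrightarrow> v \<bullet> (i + int m * k) = 0"
proof (induction k rule: int_induct [where k = 0])
  case base
  then show ?case by simp
next
  case (step1 k)
  have "v \<bullet> (i + int m * k) = 0 \<longleftrightarrow> v \<bullet> (i + int m * k + int m) = 0"
    using coord_moduleD [OF assms, of "i + int m * k"] g by simp
  then show ?case
    using step1 by (simp add: algebra_simps)
next
  case (step2 k)
  have "v \<bullet> (i + int m * (k - 1)) = 0 \<longleftrightarrow> v \<bullet> (i + int m * (k - 1) + int m) = 0"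
    using coord_moduleD [OF assms, of "i + int m * (k - 1)"] g by simp
  then show ?case
    using step2 by (simp add: algebra_simps)
qed

lemma coord_module_mod:
  assumes "v \<in> coord_module m g"
  shows "v \<bullet> i = 0 \<longleftrightarrow> v \<bullet> (i mod int m) = 0"
  using coord_module_multiple [OF assms, of "i mod int m" "i div int m"] by simp

lemma coord_module_eqI:
  assumes "v \<in> coord_module m g" "w \<in> coord_module m g" "\<And>i. i \<in> {0..<int m} \<Longrightarrow> v \<bullet> i = w \<bullet> i"
  shows "v = w"
proof -
  have "(v - w) \<bullet> i = 0" for i
    using coord_module_mod [OF coord_module_diff [OF assms(1,2)], of i] assms(3) m by simp
  then show ?thesis
    by (intro coord_eqI) simp
qed

lemma coord_module_nonzeroE:
  assumes "v \<in> coord_module m g" "v \<noteq> 0"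
  obtains i where "i \<in> {0..<int m}" "v \<bullet> i \<noteq> 0"
  using coord_module_eqI [OF assms(1), of 0] assms(2) by auto

text \<open>On each line x^m acts by a -> \<sigma>^m(a) \<sigma>^i(g). A vector on which x^m acts as
  a scalar thus produces coboundary relations.\<close>

lemma x_power_period:
  assumes "v \<in> coord_module m g"
  shows "x_power (int m) v \<bullet> i = ratfun_shift (2 * of_nat m) (v \<bullet> i) * ratfun_shift (2 * of_int i) g"
  using coord_moduleD [OF assms, of "i - int m"]
  by (simp add: x_power_apply ratfun_shift_mult ratfun_shift_shift algebra_simps)

lemma coord_unit_0 [simp]: "coord_unit m g \<bullet> 0 = 1"
  by (simp add: coord_unit_apply)

lemma coord_unit_eq_0: "\<not> int m dvd i \<Longrightarrow> coord_unit m g \<bullet> i = 0"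
  by (simp add: coord_unit_apply)

lemma coord_unit_module: "coord_unit m g \<in> coord_module m g"
proof -
  have "coord_unit m g \<bullet> i = coord_unit m g \<bullet> (i + int m) * ratfun_shift (2 * of_int i) g" for i
  proof (cases "int m dvd i")
    case True
    then obtain k where k: "i = int m * k"
      by auto
    show ?thesis
    proof (cases "k \<ge> 0")
      case True
      then obtain n where n: "k = int n"
        using nonneg_int_cases by blast
      have "coord_unit m g \<bullet> i = inverse (cocycle m g n)"
        using m by (simp add: coord_unit_apply k n)
      moreover have "i + int m = int m * int (Suc n)"
        by (simp add: k n algebra_simps)
      then have "coord_unit m g \<bullet> (i + int m) = inverse (cocycle m g (Suc n))"
        using m by (simp only: coord_unit_apply) (simp del: of_nat_Suc cocycle.simps)
      moreover have "2 * of_int i = (2 * of_nat (m * n) :: complex)"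
        by (simp add: k n)
      ultimately show ?thesis
        using g cocycle_nonzero [OF g, of m n] by (simp only: cocycle.simps) (simp add: field_simps)
    next
      case False
      then have "k = - int (Suc (nat (- k - 1)))"
        by simp
      then obtain n where n: "k = - int (Suc n)" ..
      have i: "i = - (int m * int (Suc n))"
        by (simp only: k n mult_minus_right)
      have "i < 0"
        unfolding i using m by simp
      have "coord_unit m g \<bullet> i = ratfun_shift (2 * of_int i) (cocycle m g (Suc n))"
      proof -
        have "nat (- i div int m) = Suc n" "int m dvd i"
          using m by (simp_all add: i del: of_nat_Suc)
        moreover have "\<not> i \<ge> 0"
          using \<open>i < 0\<close> by simp
        ultimately show ?thesis
          by (simp only: coord_unit_apply if_True if_False)
      qed
      moreover have i': "i + int m = - (int m * int n)"
        by (simp add: i algebra_simps)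
      \<comment> \<open>The index m places after -m is 0, which falls under the nonnegative branch;
        hence the separate case n = 0.\<close>
      have "coord_unit m g \<bullet> (i + int m) = ratfun_shift (2 * of_int (i + int m)) (cocycle m g n)"
      proof (cases "n = 0")
        case True
        then show ?thesis using i' by simp
      next
        case False
        then have "i + int m < 0"
          unfolding i' using m by simp
        then have "nat (- (i + int m) div int m) = n" "int m dvd i + int m" "\<not> i + int m \<ge> 0"
          using m by (simp_all add: i')
        then show ?thesis
          by (simp only: coord_unit_apply if_True if_False)
      qed
      moreover have "ratfun_shift (2 * of_int i) (cocycle m g (Suc n)) =
          ratfun_shift (2 * of_int (i + int m)) (cocycle m g n) * ratfun_shift (2 * of_int i) g"
        unfolding cocycle_Suc_left by (simp add: ratfun_shift_mult ratfun_shift_shift algebra_simps)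
      ultimately show ?thesis
        by simp
    qed
  next
    case False
    then have "\<not> int m dvd i + int m"
      by simp
    with False show ?thesis
      by (simp add: coord_unit_apply)
  qed
  then show ?thesis
    by (rule coord_moduleI)
qed

lemma x_power_unit_module: "x_power k (coord_unit m g) \<in> coord_module m g"
  by (intro coord_module_x_power coord_unit_module)

lemma x_power_unit_diag [simp]: "x_power i (coord_unit m g) \<bullet> i = 1"
  by (simp add: x_power_apply)

lemma x_power_unit_eq_0: "\<not> int m dvd j - i \<Longrightarrow> x_power i (coord_unit m g) \<bullet> j = 0"
  by (simp add: x_power_apply coord_unit_eq_0)

lemma x_power_unit_off_diag:
  "i \<in> {0..<int m} \<Longrightarrow> j \<in> {0..<int m} \<Longrightarrow> i \<noteq> j \<Longrightarrow> x_power i (coord_unit m g) \<bullet> j = 0"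
  by (rule x_power_unit_eq_0) (auto simp: mod_eq_dvd_iff [symmetric] mod_pos_pos_trivial)

lemma x_power_unit_sum_at:
  assumes j: "j \<in> {0..<int m}"
  shows "(\<Sum>i\<in>{0..<int m}. scale (c i) (x_power i (coord_unit m g))) \<bullet> j = c j"
proof -
  have "(\<Sum>i\<in>{0..<int m}. scale (c i) (x_power i (coord_unit m g))) \<bullet> j =
      (\<Sum>i\<in>{0..<int m}. c i * x_power i (coord_unit m g) \<bullet> j)"
    by (simp add: coord_at_sum)
  also have "\<dots> = (\<Sum>i\<in>{j}. c i * x_power i (coord_unit m g) \<bullet> j)"
    by (rule sum.mono_neutral_right) (use j x_power_unit_off_diag in auto)
  finally show ?thesis
    by simp
qed

lemma coord_expansion:
  assumes "v \<in> coord_module m g"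
  shows "v = (\<Sum>i\<in>{0..<int m}. scale (v \<bullet> i) (x_power i (coord_unit m g)))"
proof (rule coord_module_eqI [OF assms])
  show "(\<Sum>i\<in>{0..<int m}. scale (v \<bullet> i) (x_power i (coord_unit m g))) \<in> coord_module m g"
    by (intro coord_module_sum coord_module_scale x_power_unit_module)
qed (simp add: x_power_unit_sum_at)

text \<open>Each line K x^i is one-dimensional: the difference vanishes at i, hence on the whole
  residue class of i.\<close>

lemma unit_multiple:
  assumes "v \<in> coord_module m g" "\<And>j. \<not> int m dvd j - i \<Longrightarrow> v \<bullet> j = 0"
  shows "v = scale (v \<bullet> i) (x_power i (coord_unit m g))"
proof -
  have "(v - scale (v \<bullet> i) (x_power i (coord_unit m g))) \<bullet> j = 0" for j
  proof (cases "int m dvd j - i")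
    case True
    then obtain k where "j = i + int m * k"
      by (metis add.commute diff_add_cancel dvdE)
    moreover have "v - scale (v \<bullet> i) (x_power i (coord_unit m g)) \<in> coord_module m g"
      by (intro coord_module_diff coord_module_scale x_power_unit_module assms)
    ultimately show ?thesis
      using coord_module_multiple [of "v - scale (v \<bullet> i) (x_power i (coord_unit m g))" i k] by simp
  next
    case False
    then show ?thesis
      using assms(2) x_power_unit_eq_0 by simp
  qed
  then have "v - scale (v \<bullet> i) (x_power i (coord_unit m g)) = 0"
    by (intro coord_eqI) (simp only: coord_at_simps)
  then show ?thesis
    by simp
qed

lemma x_power_m_unit: "x_power (int m) (coord_unit m g) = scale g (coord_unit m g)"
proof -
  have "x_power (int m) (coord_unit m g) =
      scale (x_power (int m) (coord_unit m g) \<bullet> 0) (x_power 0 (coord_unit m g))"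
  proof (rule unit_multiple [OF x_power_unit_module])
    fix j assume "\<not> int m dvd j - 0"
    then have "\<not> int m dvd j - int m"
      by (metis diff_add_cancel diff_zero dvd_add_triv_right_iff)
    then show "x_power (int m) (coord_unit m g) \<bullet> j = 0"
      by (rule x_power_unit_eq_0)
  qed
  then show ?thesis
    using x_power_period [OF coord_unit_module, of 0] by simp
qed

lemma x_power_minus_m_unit:
  "x_power (- int m) (coord_unit m g) =
     scale (inverse (ratfun_shift (- 2 * of_nat m) g)) (coord_unit m g)"
proof -
  have "coord_unit m g = x_power (- int m) (scale g (coord_unit m g))"
    by (simp add: x_power_m_unit [symmetric] x_power_x_power)
  also have "\<dots> = scale (ratfun_shift (- 2 * of_nat m) g) (x_power (- int m) (coord_unit m g))"
    by (simp add: x_power_scale)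
  finally have "scale (inverse (ratfun_shift (- 2 * of_nat m) g)) (coord_unit m g) =
      scale (inverse (ratfun_shift (- 2 * of_nat m) g) * ratfun_shift (- 2 * of_nat m) g)
        (x_power (- int m) (coord_unit m g))"
    by (metis scale_scale)
  then show ?thesis
    using g by simp
qed

end

subsection \<open>Stable subspaces\<close>

text \<open>Scalars are only complex numbers, and x^-1 occurs only inside f. This is what images of
  sl2-submodules satisfy, and it is weaker than being a K-subspace or an R-submodule.\<close>

definition stable :: "complex \<Rightarrow> coord set \<Rightarrow> bool" where
  "stable \<theta> S \<longleftrightarrow> 0 \<in> S \<and> (\<forall>v\<in>S. \<forall>w\<in>S. v + w \<in> S) \<and>
     (\<forall>c. \<forall>v\<in>S. scale (ratfun_of_poly [:c:]) v \<in> S) \<and>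
     (\<forall>v\<in>S. coord_e v \<in> S \<and> coord_f \<theta> v \<in> S \<and> coord_h v \<in> S)"

lemma stable_poly:
  assumes "stable \<theta> S" "v \<in> S"
  shows "scale (ratfun_of_poly p) v \<in> S"
proof (induction p)
  case 0
  then show ?case using assms by (simp add: stable_def del: ratfun_of_poly_0) simp
next
  case (pCons a p)
  have eq: "pCons a p = [:a:] + [:0, 1:] * p"
    by simp
  have "scale (ratfun_of_poly (pCons a p)) v =
      scale (ratfun_of_poly [:a:]) v + coord_h (scale (ratfun_of_poly p) v)"
    unfolding eq ratfun_of_poly_add ratfun_of_poly_mult coord_h_def scale_scale scale_add_left ..
  then show ?case
    using assms pCons by (simp add: stable_def)
qed

lemma stable_diff:
  assumes "stable \<theta> S" "v \<in> S" "w \<in> S"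
  shows "v - w \<in> S"
proof -
  have "v - w = v + scale (ratfun_of_poly [:- 1:]) w"
    using ratfun_of_poly_uminus [of "[:1:]"] by (intro coord_eqI) simp
  then show ?thesis
    using assms unfolding stable_def by metis
qed

lemma stable_e_power:
  assumes "stable \<theta> S" "v \<in> S"
  shows "x_power (int n) v \<in> S"
proof (induction n)
  case 0
  then show ?case using assms by simp
next
  case (Suc n)
  have "x_power (int (Suc n)) v = coord_e (x_power (int n) v)"
    by (simp add: coord_e_def x_power_x_power)
  then show ?case
    using Suc assms by (simp add: stable_def)
qed

text \<open>\<open>f\<^sup>n\<close> acts as \<open>falling_poly n \<cdot> x\<^sup>-\<^sup>n\<close>.\<close>

fun falling_poly :: "complex \<Rightarrow> nat \<Rightarrow> complex poly" where
  "falling_poly \<theta> 0 = 1"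
| "falling_poly \<theta> (Suc n) = fe_poly \<theta> * pcompose (falling_poly \<theta> n) [:2, 1:]"

lemma stable_f_power:
  assumes "stable \<theta> S" "v \<in> S"
  shows "scale (ratfun_of_poly (falling_poly \<theta> n)) (x_power (- int n) v) \<in> S"
proof (induction n)
  case 0
  then show ?case using assms by simp
next
  case (Suc n)
  have "scale (ratfun_of_poly (falling_poly \<theta> (Suc n))) (x_power (- int (Suc n)) v) =
      coord_f \<theta> (scale (ratfun_of_poly (falling_poly \<theta> n)) (x_power (- int n) v))"
    unfolding falling_poly.simps ratfun_of_poly_mult coord_f_def x_power_scale x_power_x_power
      scale_scale
    by (simp add: ratfun_shift_of_poly)
  then show ?case
    using Suc assms(1) unfolding stable_def by metis
qed

lemma fe_poly_nonzero: "fe_poly \<theta> \<noteq> 0"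
proof
  assume "fe_poly \<theta> = 0"
  then have "poly.coeff (fe_poly \<theta>) 2 = 0"
    by simp
  then show False
    by (simp add: fe_poly_def power2_eq_square numeral_2_eq_2)
qed

lemma poly_fe_poly_eq_0_iff: "poly (fe_poly \<theta>) z = 0 \<longleftrightarrow> poly ([:\<theta>:] - [:1, 1:]^2) z = 0"
  by (simp add: fe_poly_def)

lemma falling_poly_nonzero: "falling_poly \<theta> n \<noteq> 0"
  using pcompose_shift_eq_0_iff [of _ "-2"] by (induction n) (auto simp: fe_poly_nonzero)

text \<open>Each recursion step evaluates the earlier factors at z + 2, which moves their roots to
  the left, away from \<omega>.\<close>

lemma falling_poly_roots:
  assumes "\<And>z. poly (fe_poly \<theta>) z = 0 \<Longrightarrow> Re z < \<omega>" "poly (falling_poly \<theta> n) z = 0"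
  shows "Re z < \<omega>"
  using assms(2)
proof (induction n arbitrary: z)
  case (Suc n)
  then have "poly (fe_poly \<theta>) z = 0 \<or> poly (falling_poly \<theta> n) (z + 2) = 0"
    by (simp add: poly_pcompose add.commute)
  then show ?case
    using assms(1) [of z] Suc.IH [of "z + 2"] by auto
qed simp

text \<open>
  Among the multiples of the generator in a stable subspace one finds, by applying \<open>e\<^sup>m\<^sup>k\<close> and
  \<open>f\<^sup>m\<^sup>k\<close>, two polynomial multiples whose roots lie on opposite sides of the line \<open>Re z = \<omega>\<close>.
\<close>

lemma stable_contains_unit:
  assumes m: "m > 0" and \<zeta>: "\<zeta> \<in> \<Psi> m \<omega>" and S: "stable \<theta> S"
    and \<omega>: "\<And>z. poly (fe_poly \<theta>) z = 0 \<Longrightarrow> Re z < \<omega>"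
    and p: "p \<noteq> 0" "scale (ratfun_of_poly p) (coord_unit m (g_ratfun \<zeta>)) \<in> S"
  shows "coord_unit m (g_ratfun \<zeta>) \<in> S"
proof -
  define g where "g = g_ratfun \<zeta>"
  have g: "g \<noteq> 0"
    using g_ratfun_nonzero [OF \<zeta>] by (simp add: g_def)
  define u where "u = coord_unit m g"
  define I where "I = {q. scale (ratfun_of_poly q) u \<in> S}"
  obtain P Q where PQ: "quot_of_fract g = (P, Q)"
    by force
  have "coprime P Q" "Q \<noteq> 0"
    using coprime_quot_of_fract [of g] snd_quot_of_fract_nonzero [of g] PQ by auto
  have gPQ: "g = Fract P Q"
    using quot_to_fract_quot_of_fract [of g] by (simp add: PQ quot_to_fract_def)
  have "P \<noteq> 0"
    using g gPQ by (auto simp: fract_collapse)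
  \<comment> \<open>In a reduced fraction no root of P cancels against one of Q, so each of them
    shows in the order of g.\<close>
  have strip: "\<omega> \<le> Re z \<and> Re z < \<omega> + 2 * real m" if "poly P z = 0 \<or> poly Q z = 0" for z
  proof -
    have "\<not> (poly P z = 0 \<and> poly Q z = 0)"
      using \<open>coprime P Q\<close> by (metis coprime_poly_0)
    then have "ratfun_order z g \<noteq> 0"
      using that \<open>P \<noteq> 0\<close> \<open>Q \<noteq> 0\<close> by (auto simp: gPQ ratfun_order_Fract order_root)
    then show ?thesis
      using ratfun_order_g_ratfun_strip [OF \<zeta>] by (simp add: g_def)
  qed
  \<comment> \<open>From x^m (q 1) = \<sigma>^m(q) g 1, cleared of its denominator. The roots of q
    move right by 2m, and those of P, which join them, lie in the strip.\<close>
  have up: "P * pcompose q [:- (2 * of_nat m), 1:] \<in> I" if "q \<in> I" for q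
  proof -
    have "x_power (int m) (scale (ratfun_of_poly q) u) \<in> S"
      using that stable_e_power [OF S] by (simp add: I_def)
    then have "scale (ratfun_of_poly (pcompose q [:- (2 * of_nat m), 1:]) * g) u \<in> S"
      by (simp add: x_power_scale u_def x_power_m_unit [OF m g] scale_scale ratfun_shift_of_poly)
    then have "scale (ratfun_of_poly Q) (scale (ratfun_of_poly (pcompose q [:- (2 * of_nat m), 1:]) * g) u) \<in> S"
      by (rule stable_poly [OF S])
    moreover have "ratfun_of_poly Q * (ratfun_of_poly (pcompose q [:- (2 * of_nat m), 1:]) * g) =
        ratfun_of_poly (P * pcompose q [:- (2 * of_nat m), 1:])"
      using \<open>Q \<noteq> 0\<close> by (simp add: gPQ eq_fract algebra_simps)
    ultimately show ?thesis
      by (simp add: I_def scale_scale)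
  qed
  \<comment> \<open>The same with f^m, which multiplies by the falling polynomial and by
    \<sigma>^-m(q) / \<sigma>^-m(g). The new roots lie left of \<omega>: those coming from Q because
    the strip has width 2m, the others by the assumption on \<open>fe_poly\<close>.\<close>
  have down: "falling_poly \<theta> m * (pcompose Q [:2 * of_nat m, 1:] * pcompose q [:2 * of_nat m, 1:]) \<in> I"
    if "q \<in> I" for q
  proof -
    define P' Q' where "P' = pcompose P [:2 * of_nat m, 1:]" and "Q' = pcompose Q [:2 * of_nat m, 1:]"
    define q' where "q' = pcompose q [:2 * of_nat m, 1:]"
    have nz: "P' \<noteq> 0" "Q' \<noteq> 0"
      using pcompose_shift_eq_0_iff [of _ "- (2 * of_nat m)"] \<open>P \<noteq> 0\<close> \<open>Q \<noteq> 0\<close>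
      by (auto simp: P'_def Q'_def)
    have g': "ratfun_shift (- 2 * of_nat m) g = Fract P' Q'"
      using \<open>Q \<noteq> 0\<close> by (simp add: gPQ ratfun_shift_Fract P'_def Q'_def)
    have q': "ratfun_shift (2 * of_int (- int m)) (ratfun_of_poly q) = ratfun_of_poly q'"
      by (simp add: ratfun_shift_of_poly q'_def)
    have "scale (ratfun_of_poly (falling_poly \<theta> m)) (x_power (- int m) (scale (ratfun_of_poly q) u)) \<in> S"
      using that stable_f_power [OF S] by (simp add: I_def)
    then have "scale (ratfun_of_poly (falling_poly \<theta> m) * (ratfun_of_poly q' * inverse (Fract P' Q'))) u \<in> S"
      unfolding x_power_scale q' u_def x_power_minus_m_unit [OF m g] scale_scale g' .
    then have "scale (ratfun_of_poly P') (scale (ratfun_of_poly (falling_poly \<theta> m) *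
        (ratfun_of_poly q' * inverse (Fract P' Q'))) u) \<in> S"
      by (rule stable_poly [OF S])
    moreover have "ratfun_of_poly P' * (ratfun_of_poly (falling_poly \<theta> m) *
        (ratfun_of_poly q' * inverse (Fract P' Q'))) =
        ratfun_of_poly (falling_poly \<theta> m * (Q' * q'))"
      using nz by (simp add: eq_fract algebra_simps)
    ultimately show ?thesis
      by (simp add: I_def scale_scale Q'_def q'_def)
  qed
  have pI: "p \<in> I"
    using p by (simp add: I_def u_def g_def)
  \<comment> \<open>B bounds the distance of the roots of p from the line Re z = \<omega>; the
    inserted 0 covers p without roots. Once B < m k, moving them by k steps of length 2m carries
    them across.\<close>
  define B where "B = Max (insert 0 ((\<lambda>z. \<bar>Re z - \<omega>\<bar>) ` {z. poly p z = 0}))"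
  have B: "\<bar>Re z - \<omega>\<bar> \<le> B" if "poly p z = 0" for z
    unfolding B_def using that poly_roots_finite [OF p(1)] by (intro Max_ge) auto
  obtain k :: nat where k: "B < real k"
    using reals_Archimedean2 by blast
  have km: "B < real m * real k"
  proof -
    have "1 * real k \<le> real m * real k"
      using m by (intro mult_right_mono) auto
    then show ?thesis
      using k by simp
  qed
  have "\<exists>q\<in>I. q \<noteq> 0 \<and> (\<forall>z. poly q z = 0 \<longrightarrow> Re z \<ge> \<omega> \<or> poly p (z - 2 * of_nat m * of_nat k) = 0)" for k
  proof (induction k)
    case 0
    then show ?case using pI p(1) by auto
  next
    case (Suc k)
    then obtain q where q: "q \<in> I" "q \<noteq> 0"
      "\<And>z. poly q z = 0 \<Longrightarrow> Re z \<ge> \<omega> \<or> poly p (z - 2 * of_nat m * of_nat k) = 0"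
      by blast
    show ?case
    proof (rule bexI [OF _ up [OF q(1)]], intro conjI allI impI)
      show "P * pcompose q [:- (2 * of_nat m), 1:] \<noteq> 0"
        using \<open>P \<noteq> 0\<close> q(2) by simp
      fix z assume "poly (P * pcompose q [:- (2 * of_nat m), 1:]) z = 0"
      then have "poly P z = 0 \<or> poly q (z - 2 * of_nat m) = 0"
        by (simp add: poly_pcompose)
      then show "Re z \<ge> \<omega> \<or> poly p (z - 2 * of_nat m * of_nat (Suc k)) = 0"
      proof
        assume "poly P z = 0"
        then show ?thesis using strip by blast
      next
        assume "poly q (z - 2 * of_nat m) = 0"
        then have "Re (z - 2 * of_nat m) \<ge> \<omega> \<or> poly p (z - 2 * of_nat m - 2 * of_nat m * of_nat k) = 0"
          by (rule q(3))
        then show ?thesis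
          by (auto simp: algebra_simps)
      qed
    qed
  qed
  then obtain p1 where p1: "p1 \<in> I" "p1 \<noteq> 0"
      "\<And>z. poly p1 z = 0 \<Longrightarrow> Re z \<ge> \<omega> \<or> poly p (z - 2 * of_nat m * of_nat k) = 0"
    by blast
  have p1': "Re z \<ge> \<omega>" if "poly p1 z = 0" for z
    using p1(3) [OF that] B [of "z - 2 * of_nat m * of_nat k"] km by (auto simp: abs_le_iff)
  have "\<exists>q\<in>I. q \<noteq> 0 \<and> (\<forall>z. poly q z = 0 \<longrightarrow> Re z < \<omega> \<or> poly p (z + 2 * of_nat m * of_nat k) = 0)" for k
  proof (induction k)
    case 0
    then show ?case using pI p(1) by auto
  next
    case (Suc k)
    then obtain q where q: "q \<in> I" "q \<noteq> 0"
      "\<And>z. poly q z = 0 \<Longrightarrow> Re z < \<omega> \<or> poly p (z + 2 * of_nat m * of_nat k) = 0"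
      by blast
    show ?case
    proof (rule bexI [OF _ down [OF q(1)]], intro conjI allI impI)
      show "falling_poly \<theta> m * (pcompose Q [:2 * of_nat m, 1:] * pcompose q [:2 * of_nat m, 1:]) \<noteq> 0"
        using \<open>Q \<noteq> 0\<close> q(2) falling_poly_nonzero pcompose_shift_eq_0_iff [of _ "- (2 * of_nat m)"] by auto
      fix z assume "poly (falling_poly \<theta> m *
        (pcompose Q [:2 * of_nat m, 1:] * pcompose q [:2 * of_nat m, 1:])) z = 0"
      then consider "poly (falling_poly \<theta> m) z = 0" | "poly Q (z + 2 * of_nat m) = 0"
        | "poly q (z + 2 * of_nat m) = 0"
        by (auto simp: poly_pcompose add.commute)
      then show "Re z < \<omega> \<or> poly p (z + 2 * of_nat m * of_nat (Suc k)) = 0"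
      proof cases
        case 1
        then show ?thesis using falling_poly_roots [of \<theta> \<omega> m z] \<omega> by blast
      next
        case 2
        then show ?thesis using strip [of "z + 2 * of_nat m"] by simp
      next
        case 3
        then have "Re (z + 2 * of_nat m) < \<omega> \<or> poly p (z + 2 * of_nat m + 2 * of_nat m * of_nat k) = 0"
          by (rule q(3))
        then show ?thesis
          by (auto simp: algebra_simps)
      qed
    qed
  qed
  then obtain p2 where p2: "p2 \<in> I" "p2 \<noteq> 0"
      "\<And>z. poly p2 z = 0 \<Longrightarrow> Re z < \<omega> \<or> poly p (z + 2 * of_nat m * of_nat k) = 0"
    by blast
  have p2': "Re z < \<omega>" if "poly p2 z = 0" for z
    using p2(3) [OF that] B [of "z + 2 * of_nat m * of_nat k"] km by (auto simp: abs_le_iff)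
  \<comment> \<open>I is an ideal of polynomials, and an element d of least degree generates
    it.\<close>
  obtain d where d: "d \<in> I" "d \<noteq> 0" "\<And>q. q \<in> I \<Longrightarrow> q \<noteq> 0 \<Longrightarrow> degree d \<le> degree q"
    using exists_least_iff [of "\<lambda>n. \<exists>q\<in>I. q \<noteq> 0 \<and> degree q = n"] pI p(1) by (metis not_less)
  have dvd: "d dvd q" if "q \<in> I" for q
  proof -
    have "q mod d = q - q div d * d"
      by (simp add: minus_div_mult_eq_mod)
    moreover have "scale (ratfun_of_poly (q - q div d * d)) u =
        scale (ratfun_of_poly q) u - scale (ratfun_of_poly (q div d)) (scale (ratfun_of_poly d) u)"
      unfolding ratfun_of_poly_diff ratfun_of_poly_mult scale_diff_left scale_scale ..
    ultimately have "q mod d \<in> I"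
      using that d(1) stable_poly [OF S] stable_diff [OF S] by (simp add: I_def)
    then have "q mod d = 0"
      using d(3) [of "q mod d"] d(2) degree_mod_less [of d q] by force
    then show ?thesis by auto
  qed
  \<comment> \<open>A root of d would be common to p1 and p2, whose roots lie on opposite sides of
    the line.\<close>
  have "degree d = 0"
  proof (rule ccontr)
    assume "degree d \<noteq> 0"
    then have "\<not> constant (poly d)"
      by (simp add: constant_degree)
    then obtain z where "poly d z = 0"
      using fundamental_theorem_of_algebra by blast
    then have "poly p1 z = 0" "poly p2 z = 0"
      using dvd [OF p1(1)] dvd [OF p2(1)] by auto
    then show False
      using p1' p2' by force
  qed
  then obtain c where c: "d = [:c:]" "c \<noteq> 0"
    using d(2) by (metis degree_eq_zeroE pCons_0_0)
  have "scale (ratfun_of_poly [:inverse c:]) (scale (ratfun_of_poly d) u) \<in> S"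
    using d(1) stable_poly [OF S] by (simp add: I_def)
  moreover have "ratfun_of_poly [:inverse c:] * ratfun_of_poly d = 1"
    using c by (simp flip: one_pCons)
  ultimately show ?thesis
    by (simp add: scale_scale u_def g_def)
qed

subsection \<open>Simplicity\<close>

definition aperiodic :: "nat \<Rightarrow> ratfun \<Rightarrow> bool" where
  "aperiodic m g \<longleftrightarrow> (\<forall>i\<in>{0..<int m}. \<forall>j\<in>{0..<int m}.
     cohomologous m (ratfun_shift (2 * of_int i) g) (ratfun_shift (2 * of_int j) g) \<longrightarrow> i = j)"

text \<open>
  Shortest vector argument: if \<open>v\<close> has minimal support and \<open>v i = 1\<close>, then \<open>x\<^sup>m v - \<sigma>\<^sup>i(g) v\<close> has smaller
  support, which forces a coboundary relation between \<open>\<sigma>\<^sup>i(g)\<close> and \<open>\<sigma>\<^sup>j(g)\<close> if \<open>v j\<close> is nonzero.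
\<close>

lemma coord_module_simple:
  assumes m: "m > 0" and g: "g \<noteq> 0" and ap: "aperiodic m g"
    and N: "N \<subseteq> coord_module m g" "\<And>v w. v \<in> N \<Longrightarrow> w \<in> N \<Longrightarrow> v - w \<in> N"
      "\<And>a v. v \<in> N \<Longrightarrow> scale a v \<in> N" "\<And>k v. v \<in> N \<Longrightarrow> x_power k v \<in> N"
    and v0: "v0 \<in> N" "v0 \<noteq> 0"
  shows "coord_unit m g \<in> N"
proof -
  define supp where "supp = (\<lambda>v :: coord. {i\<in>{0..<int m}. v \<bullet> i \<noteq> 0})"
  have fin: "finite (supp v)" for v
    unfolding supp_def by (rule finite_subset [of _ "{0..<int m}"]) auto
  obtain v1 where v1: "v1 \<in> N" "v1 \<noteq> 0" "\<And>w. w \<in> N \<Longrightarrow> w \<noteq> 0 \<Longrightarrow> card (supp v1) \<le> card (supp w)"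
    using exists_least_iff [of "\<lambda>n. \<exists>w\<in>N. w \<noteq> 0 \<and> card (supp w) = n"] v0 by (metis not_less)
  obtain i where i: "i \<in> {0..<int m}" "v1 \<bullet> i \<noteq> 0"
    using coord_module_nonzeroE [OF m g] v1 N(1) by blast
  define v where "v = scale (inverse (v1 \<bullet> i)) v1"
  have v: "v \<in> N" "v \<bullet> i = 1" "supp v = supp v1"
    using v1 N(3) i by (auto simp: v_def supp_def)
  note vM = subsetD [OF N(1) v(1)]
  define w where "w = x_power (int m) v - scale (ratfun_shift (2 * of_int i) g) v"
  have w: "w \<in> N"
    using N v by (simp add: w_def)
  have w_eq: "w \<bullet> j = ratfun_shift (2 * of_nat m) (v \<bullet> j) * ratfun_shift (2 * of_int j) g -
      ratfun_shift (2 * of_int i) g * v \<bullet> j" for j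
    by (simp add: w_def x_power_period [OF m g vM])
  \<comment> \<open>At index i itself the two terms cancel because v i = 1.\<close>
  have "supp w \<subseteq> supp v - {i}"
    using v(2) by (auto simp: supp_def w_eq)
  then have "card (supp w) < card (supp v)"
    using i v fin [of v] by (intro psubset_card_mono) (auto simp: supp_def)
  then have "w = 0"
    using v1(3) [OF w] v(3) by force
  have "v \<bullet> j = 0" if j: "j \<in> {0..<int m}" "j \<noteq> i" for j
  proof (rule ccontr)
    assume "v \<bullet> j \<noteq> 0"
    moreover have "ratfun_shift (2 * of_int i) g * v \<bullet> j =
        ratfun_shift (2 * of_int j) g * ratfun_shift (2 * of_nat m) (v \<bullet> j)"
      using w_eq [of j] \<open>w = 0\<close> by (simp add: mult.commute)
    ultimately have "cohomologous m (ratfun_shift (2 * of_int i) g) (ratfun_shift (2 * of_int j) g)"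
      unfolding cohomologous_def by blast
    then show False
      using ap i(1) j unfolding aperiodic_def by blast
  qed
  \<comment> \<open>Only the coefficient at i is left, so v is x^i, and x^-i leads back to
    1.\<close>
  then have "v = x_power i (coord_unit m g)"
    using i v(2) by (intro coord_module_eqI [OF m g vM x_power_unit_module [OF m g]])
      (metis x_power_unit_diag [OF m g] x_power_unit_off_diag [OF m g])
  then have "x_power (- i) v = coord_unit m g"
    by (simp add: x_power_x_power)
  then show ?thesis
    using N(4) [OF v(1), of "- i"] by simp
qed

text \<open>The vectors with a nonzero polynomial multiple in S form an R-submodule N. Aperiodicity
  puts 1 into N, and \<open>stable_contains_unit\<close> then removes the polynomial.\<close>

lemma stable_nonzero_contains_unit:
  assumes m: "m > 0" and \<zeta>: "\<zeta> \<in> \<Psi> m \<omega>" and ap: "aperiodic m (g_ratfun \<zeta>)"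
    and \<omega>: "\<And>z. poly (fe_poly \<theta>) z = 0 \<Longrightarrow> Re z < \<omega>"
    and S: "stable \<theta> S" "S \<subseteq> coord_module m (g_ratfun \<zeta>)" "v \<in> S" "v \<noteq> 0"
  shows "coord_unit m (g_ratfun \<zeta>) \<in> S"
proof -
  define g where "g = g_ratfun \<zeta>"
  have g: "g \<noteq> 0"
    using g_ratfun_nonzero [OF \<zeta>] by (simp add: g_def)
  define N where "N = {w \<in> coord_module m g. \<exists>p. p \<noteq> 0 \<and> scale (ratfun_of_poly p) w \<in> S}"
  have "coord_unit m g \<in> N"
  proof (rule coord_module_simple [OF m g])
    show "aperiodic m g"
      using ap by (simp add: g_def)
    show "N \<subseteq> coord_module m g"
      by (auto simp: N_def)
    show "v \<in> N" "v \<noteq> 0"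
      using S by (auto simp: N_def g_def intro: exI [of _ 1])
    fix w assume "w \<in> N"
    then obtain p where p: "p \<noteq> 0" "scale (ratfun_of_poly p) w \<in> S" "w \<in> coord_module m g"
      by (auto simp: N_def)
    show "scale a w \<in> N" for a
    proof -
      obtain P Q where "a = Fract P Q" "Q \<noteq> 0"
        by (rule Fract_cases)
      then have "ratfun_of_poly (p * Q) * a = ratfun_of_poly P * ratfun_of_poly p"
        by (simp add: eq_fract)
      then have "scale (ratfun_of_poly (p * Q)) (scale a w) \<in> S"
        using stable_poly [OF S(1) p(2), of P] by (simp add: scale_scale del: mult_fract)
      then show ?thesis
        using p \<open>Q \<noteq> 0\<close> coord_module_scale unfolding N_def by (intro CollectI conjI exI [of _ "p * Q"]) auto
    qed
    show "x_power k w \<in> N" for k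
    proof (cases "k \<ge> 0")
      case True
      then have "x_power k (scale (ratfun_of_poly p) w) \<in> S"
        using stable_e_power [OF S(1) p(2), of "nat k"] by simp
      then have "scale (ratfun_of_poly (pcompose p [:- (2 * of_int k), 1:])) (x_power k w) \<in> S"
        by (simp add: x_power_scale ratfun_shift_of_poly)
      then show ?thesis
        using p coord_module_x_power pcompose_shift_eq_0_iff unfolding N_def by blast
    next
      case False
      define n where "n = nat (- k)"
      have k: "k = - int n"
        using False by (simp add: n_def)
      \<comment> \<open>f^n supplies x^-n up to a polynomial factor, which the definition of N
        tolerates.\<close>
      have "scale (ratfun_of_poly (falling_poly \<theta> n)) (x_power k (scale (ratfun_of_poly p) w)) \<in> S"
        unfolding k by (rule stable_f_power [OF S(1) p(2)])
      then have "scale (ratfun_of_poly (falling_poly \<theta> n * pcompose p [:- (2 * of_int k), 1:])) (x_power k w) \<in> S"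
        by (simp add: x_power_scale ratfun_shift_of_poly scale_scale)
      moreover have "falling_poly \<theta> n * pcompose p [:- (2 * of_int k), 1:] \<noteq> 0"
        using p(1) falling_poly_nonzero by simp
      ultimately show ?thesis
        using p coord_module_x_power unfolding N_def by blast
    qed
    fix w' assume "w' \<in> N"
    then obtain p' where p': "p' \<noteq> 0" "scale (ratfun_of_poly p') w' \<in> S" "w' \<in> coord_module m g"
      by (auto simp: N_def)
    have "scale (ratfun_of_poly (p' * p)) (w - w') =
        scale (ratfun_of_poly p') (scale (ratfun_of_poly p) w) -
        scale (ratfun_of_poly p) (scale (ratfun_of_poly p') w')"
      unfolding scale_diff scale_scale ratfun_of_poly_mult by (simp only: mult.commute)
    also have "\<dots> \<in> S"
      using p p' S(1) stable_poly stable_diff by blast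
    finally show "w - w' \<in> N"
      using p p' coord_module_diff unfolding N_def by (intro CollectI conjI exI [of _ "p' * p"]) auto
  qed
  then show ?thesis
    using stable_contains_unit [OF m \<zeta> S(1) \<omega>] by (auto simp: N_def g_def)
qed

subsection \<open>Right multiplication\<close>

text \<open>\<open>right_mult a j\<close> sends \<open>\<Sum>\<^sub>i v\<^sub>i x\<^sup>i\<close> to \<open>\<Sum>\<^sub>i v\<^sub>i x\<^sup>i \<cdot> a x\<^sup>j\<close>.\<close>

definition right_mult :: "ratfun \<Rightarrow> int \<Rightarrow> coord \<Rightarrow> coord" where
  "right_mult a j v = Abs_coord (\<lambda>i. v \<bullet> (i - j) * ratfun_shift (2 * of_int (i - j)) a)"

lemma right_mult_apply:
  "right_mult a j v \<bullet> i = v \<bullet> (i - j) * ratfun_shift (2 * of_int (i - j)) a"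
  by (simp add: right_mult_def Abs_coord_inverse)

text \<open>The hypothesis on a amounts to (x^m - g') a x^j = \<sigma>^m(a) x^j (x^m - g), so right
  multiplication carries the left ideal of g' into that of g.\<close>

lemma right_mult_module:
  assumes "v \<in> coord_module m g'" "g' * a = ratfun_shift (2 * of_int j) g * ratfun_shift (2 * of_nat m) a"
  shows "right_mult a j v \<in> coord_module m g"
proof -
  have "right_mult a j v \<bullet> i = right_mult a j v \<bullet> (i + int m) * ratfun_shift (2 * of_int i) g" for i
  proof -
    have "right_mult a j v \<bullet> i = v \<bullet> (i - j + int m) * ratfun_shift (2 * of_int (i - j)) (g' * a)"
      using coord_moduleD [OF assms(1), of "i - j"]
      by (simp add: right_mult_apply ratfun_shift_mult mult.assoc)
    also have "\<dots> = v \<bullet> (i - j + int m) * (ratfun_shift (2 * of_int i) g *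
        ratfun_shift (2 * of_int (i + int m - j)) a)"
      unfolding assms(2) by (simp add: ratfun_shift_mult ratfun_shift_shift algebra_simps)
    also have "\<dots> = right_mult a j v \<bullet> (i + int m) * ratfun_shift (2 * of_int i) g"
      by (simp add: right_mult_apply algebra_simps)
    finally show ?thesis .
  qed
  then show ?thesis
    by (rule coord_moduleI)
qed

lemma right_mult_add: "right_mult a j (v + w) = right_mult a j v + right_mult a j w"
  by (rule coord_eqI) (simp add: right_mult_apply distrib_right)

lemma right_mult_scale: "right_mult a j (scale b v) = scale b (right_mult a j v)"
  by (rule coord_eqI) (simp add: right_mult_apply mult.assoc)

lemma right_mult_x_power: "right_mult a j (x_power k v) = x_power k (right_mult a j v)"
  by (rule coord_eqI) (simp add: right_mult_apply x_power_apply ratfun_shift_mult ratfun_shift_shift algebra_simps)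

lemma right_mult_0 [simp]: "right_mult a j 0 = 0"
  by (rule coord_eqI) (simp add: right_mult_apply)

lemma right_mult_eq_0_iff:
  assumes "a \<noteq> 0"
  shows "right_mult a j v = 0 \<longleftrightarrow> v = 0"
proof
  assume "right_mult a j v = 0"
  then have "right_mult a j v \<bullet> (i + j) = 0" for i
    by simp
  then show "v = 0"
    using assms by (intro coord_eqI) (simp add: right_mult_apply)
qed simp

text \<open>
  If \<open>g\<close> and \<open>\<sigma>\<^sup>j(g)\<close> are cohomologous, some power \<open>\<psi>\<^sup>k\<close> of a right multiplication \<open>\<psi>\<close> is a scalar \<open>\<rho>\<^sup>k\<close> on
  the generator \<open>1\<close>; then \<open>\<Sum>\<^sub>l \<rho>\<^sup>-\<^sup>l \<psi>\<^sup>l(1)\<close> is an eigenvector of \<open>\<psi>\<close>.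
\<close>

lemma right_mult_eigenvector:
  assumes m: "m > 0" and g: "g \<noteq> 0" and a: "a \<noteq> 0" "0 < j" "j < int m"
    "g * a = ratfun_shift (2 * of_int j) g * ratfun_shift (2 * of_nat m) a"
  obtains \<rho> w where "w \<in> coord_module m g" "w \<noteq> 0" "right_mult a j w = scale (ratfun_of_poly [:\<rho>:]) w"
    "right_mult a j (coord_unit m g) \<noteq> scale (ratfun_of_poly [:\<rho>:]) (coord_unit m g)"
proof -
  define u where "u = coord_unit m g"
  note uM = coord_unit_module [OF m g]
  define \<psi> where "\<psi> = right_mult a j"
  define y where "y = (\<lambda>l::nat. (\<psi> ^^ l) u)"
  have y_Suc: "y (Suc l) = \<psi> (y l)" for l
    by (simp add: y_def)
  have yM: "y l \<in> coord_module m g" for l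
    by (induction l) (use uM right_mult_module [OF _ a(4)] in \<open>auto simp: y_Suc \<psi>_def\<close>,
        simp add: y_def u_def uM)
  have y_supp: "y l \<bullet> i = 0" if "\<not> int m dvd i - int l * j" for l i
    using that
  proof (induction l arbitrary: i)
    case 0
    then show ?case by (simp add: y_def u_def coord_unit_eq_0 [OF m g])
  next
    case (Suc l)
    have "y l \<bullet> (i - j) = 0"
      using Suc by (simp add: algebra_simps)
    then show ?case
      by (simp add: y_Suc \<psi>_def right_mult_apply)
  qed
  have y_nz: "y l \<noteq> 0" for l
  proof (induction l)
    case 0
    have "u \<bullet> 0 = 1"
      by (simp add: u_def m g)
    then show ?case by (auto simp: y_def)
  next
    case (Suc l)
    then show ?case
      using a(1) by (simp add: y_Suc \<psi>_def right_mult_eq_0_iff)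
  qed
  \<comment> \<open>k becomes the order of j modulo m: the first power of \<psi> that returns to the
    line of 1.\<close>
  have "int m dvd int m * j"
    by simp
  then have "\<exists>k. 0 < k \<and> int m dvd int k * j"
    using m by blast
  then obtain k where k: "0 < k" "int m dvd int k * j" "\<And>l. 0 < l \<Longrightarrow> l < k \<Longrightarrow> \<not> int m dvd int l * j"
    using exists_least_iff [of "\<lambda>k. 0 < k \<and> int m dvd int k * j"] by blast
  have "y k \<bullet> i = 0" if "\<not> int m dvd i - 0" for i
    using y_supp [of i k] that k(2) by (simp add: dvd_diff_left_iff)
  then have yk: "y k = scale (y k \<bullet> 0) u"
    using unit_multiple [OF m g yM [of k], of 0] by (simp add: u_def)
  have x_psi: "x_power (int m) (y l) = scale g (y l)" for l
  proof (induction l)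
    case 0
    then show ?case by (simp add: y_def u_def x_power_m_unit [OF m g])
  next
    case (Suc l)
    then show ?case
      by (simp add: y_Suc \<psi>_def right_mult_x_power [symmetric] right_mult_scale)
  qed
  \<comment> \<open>Write y k = b 1. Then x^m acts on it both as g b and as \<sigma>^m(b) g, so b is
    invariant under a nontrivial shift and hence constant.\<close>
  have "scale (ratfun_shift (2 * of_nat m) (y k \<bullet> 0) * g) u = scale (g * y k \<bullet> 0) u"
    using x_psi [of k] unfolding yk [symmetric]
    by (subst (asm) (1 2) yk) (simp add: x_power_scale u_def x_power_m_unit [OF m g] scale_scale)
  then have "scale (ratfun_shift (2 * of_nat m) (y k \<bullet> 0) * g) u \<bullet> 0 = scale (g * y k \<bullet> 0) u \<bullet> 0"
    by simp
  then have "ratfun_shift (2 * of_nat m) (y k \<bullet> 0) = y k \<bullet> 0"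
    using g by (simp add: u_def m mult.commute)
  then obtain c where c: "y k \<bullet> 0 = ratfun_of_poly [:c:]"
    using invariant_ratfun_const m by (metis mult_eq_0_iff neq0_conv of_nat_eq_0_iff zero_neq_numeral)
  have "c \<noteq> 0"
    using y_nz [of k] yk c by (auto simp: Zero_fract_def [symmetric])
  obtain \<rho> where \<rho>: "\<rho> ^ k = c"
    using card_nth_roots [OF \<open>c \<noteq> 0\<close> k(1)] k(1) by (metis (mono_tags, lifting) Collect_empty_eq card.empty less_numeral_extra(3))
  have "\<rho> \<noteq> 0"
    using \<rho> \<open>c \<noteq> 0\<close> k(1) by auto
  define r where "r = ratfun_of_poly [:\<rho>:]"
  have r: "r \<noteq> 0"
    using \<open>\<rho> \<noteq> 0\<close> by (simp add: r_def)
  have rk: "r ^ n = ratfun_of_poly [:\<rho> ^ n:]" for n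
    by (induction n) (auto simp: r_def one_pCons [symmetric])
  define w where "w = (\<Sum>l<k. scale (inverse (r ^ l)) (y l))"
  \<comment> \<open>The sum telescopes; at n = k the two boundary terms cancel because \<psi>^k 1 =
    \<rho>^k 1.\<close>
  have "\<psi> (\<Sum>l<n. scale (inverse (r ^ l)) (y l)) =
      scale r (\<Sum>l<n. scale (inverse (r ^ l)) (y l)) + scale (r * inverse (r ^ n)) (y n) - scale r u" for n
  proof (induction n)
    case 0
    then show ?case by (simp add: y_def \<psi>_def)
  next
    case (Suc n)
    have "\<psi> (scale (inverse (r ^ n)) (y n)) = scale (r * inverse (r ^ Suc n)) (y (Suc n))"
    proof -
      have "r * inverse (r ^ Suc n) = inverse (r ^ n)"
        using r by (simp add: mult.assoc [symmetric])
      then show ?thesis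
        by (simp only: \<psi>_def y_Suc right_mult_scale)
    qed
    then show ?case
      using Suc by (simp add: \<psi>_def right_mult_add scale_add scale_scale)
  qed
  then have "\<psi> w = scale r w + scale (r * inverse (r ^ k)) (y k) - scale r u"
    by (simp add: w_def)
  also have "scale (r * inverse (r ^ k)) (y k) = scale (r * (inverse (r ^ k) * y k \<bullet> 0)) u"
    by (subst yk) (simp only: scale_scale mult.assoc)
  also have "inverse (r ^ k) * y k \<bullet> 0 = 1"
    using r unfolding c \<rho> [symmetric] rk [symmetric] by simp
  finally have eig: "\<psi> w = scale r w"
    by simp
  \<comment> \<open>Before the k-th step \<psi>^l 1 avoids the line of 1, so w has coefficient 1
    there and cannot vanish.\<close>
  have y0: "y l \<bullet> 0 = 0" if "0 < l" "l < k" for l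
    using y_supp [of 0 l] k(3) [OF that] by simp
  have "w \<bullet> 0 = (\<Sum>l<k. inverse (r ^ l) * y l \<bullet> 0)"
    by (simp add: w_def coord_at_sum)
  also have "\<dots> = (\<Sum>l\<in>{0}. inverse (r ^ l) * y l \<bullet> 0)"
    by (rule sum.mono_neutral_right) (use k(1) y0 in auto)
  finally have "w \<bullet> 0 = 1"
    by (simp add: y_def u_def m g)
  then have "w \<noteq> 0"
    by auto
  have "w \<in> coord_module m g"
    unfolding w_def by (intro coord_module_sum coord_module_scale yM)
  \<comment> \<open>\<psi> 1 lies on the line of x^j, which differs from that of 1; so 1 is not an
    eigenvector.\<close>
  have "\<psi> u \<bullet> 0 = 0"
  proof -
    have "\<not> int m dvd 0 - j"
      using a(2,3) zdvd_not_zless by (simp add: dvd_minus_iff)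
    then show ?thesis
      by (simp add: \<psi>_def right_mult_apply u_def coord_unit_eq_0 [OF m g])
  qed
  then have "\<psi> u \<noteq> scale r u"
    using r m g by (metis coord_unit_0 mult.right_neutral scale_apply u_def)
  then show ?thesis
    using that \<open>w \<noteq> 0\<close> \<open>w \<in> coord_module m g\<close> eig by (simp add: \<psi>_def u_def r_def)
qed

section \<open>Modules over \<open>sl\<^sub>2\<close> as modules over polynomials in \<open>h\<close>\<close>

context sl2_module
begin

lemma smult_add_left: "v \<in> carrier V \<Longrightarrow> (a + b) \<odot> v = a \<odot> v \<oplus> b \<odot> v"
  using smult_l_distr [of a b v] by simp

lemma smult_smult: "v \<in> carrier V \<Longrightarrow> a \<odot> (b \<odot> v) = (a * b) \<odot> v"
  using smult_assoc1 [of a b v] by simp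

lemma one_smult [simp]: "v \<in> carrier V \<Longrightarrow> 1 \<odot> v = v"
  using smult_one [of v] by simp

lemma zero_smult [simp]: "v \<in> carrier V \<Longrightarrow> 0 \<odot> v = \<zero>"
  using smult_l_null [of v] by simp

lemma smult_zero [simp]: "a \<odot> \<zero> = \<zero>"
  using smult_r_null [of a] by simp

lemma smult_carrier [simp]: "v \<in> carrier V \<Longrightarrow> a \<odot> v \<in> carrier V"
  using smult_closed [of a v] by simp

lemma smult_add_right: "v \<in> carrier V \<Longrightarrow> w \<in> carrier V \<Longrightarrow> a \<odot> (v \<oplus> w) = a \<odot> v \<oplus> a \<odot> w"
  using smult_r_distr [of a v w] by simp

lemma minus_eq_smult: "v \<in> carrier V \<Longrightarrow> \<ominus> v = (-1) \<odot> v"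
  using smult_l_minus [of 1 v] by simp

lemma linear_operator:
  assumes "T \<in> module_hom complex_ring V V"
  shows "v \<in> carrier V \<Longrightarrow> T v \<in> carrier V"
    and "v \<in> carrier V \<Longrightarrow> w \<in> carrier V \<Longrightarrow> T (v \<oplus> w) = T v \<oplus> T w"
    and "v \<in> carrier V \<Longrightarrow> T (a \<odot> v) = a \<odot> T v"
  using assms by (auto simp: module_hom_def)

lemmas e_simps [simp] = linear_operator [OF act_e_linear]
lemmas f_simps [simp] = linear_operator [OF act_f_linear]
lemmas h_simps [simp] = linear_operator [OF act_h_linear]

lemma operator_zero [simp]: "act_e V \<zero> = \<zero>" "act_f V \<zero> = \<zero>" "act_h V \<zero> = \<zero>"
  using e_simps(3) [of \<zero> 0] f_simps(3) [of \<zero> 0] h_simps(3) [of \<zero> 0] by simp_all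

lemma diff_eq_iff: "v \<in> carrier V \<Longrightarrow> w \<in> carrier V \<Longrightarrow> u \<in> carrier V \<Longrightarrow> v \<ominus> w = u \<longleftrightarrow> v = u \<oplus> w"
  by (metis M.add.inv_solve_right' a_minus_def)

lemma h_e: "v \<in> carrier V \<Longrightarrow> act_h V (act_e V v) = act_e V (act_h V v) \<oplus> 2 \<odot> act_e V v"
  using bracket_h_e [of v] by (simp add: diff_eq_iff M.a_comm)

lemma h_f: "v \<in> carrier V \<Longrightarrow> act_h V (act_f V v) = act_f V (act_h V v) \<oplus> (-2) \<odot> act_f V v"
  using bracket_h_f [of v] by (simp add: diff_eq_iff M.a_comm)

lemma e_f: "v \<in> carrier V \<Longrightarrow> act_e V (act_f V v) = act_f V (act_e V v) \<oplus> act_h V v"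
  using bracket_e_f [of v] by (simp add: diff_eq_iff M.a_comm)

abbreviation poly_act :: "complex poly \<Rightarrow> 'v \<Rightarrow> 'v" where
  "poly_act \<equiv> module.smult (poly_h_module V)"

lemma h_power_closed [simp]: "v \<in> carrier V \<Longrightarrow> (act_h V ^^ n) v \<in> carrier V"
  by (induction n) auto

lemma poly_act_eq:
  assumes "v \<in> carrier V" "degree p \<le> n"
  shows "poly_act p v = finsum V (\<lambda>i. poly.coeff p i \<odot> (act_h V ^^ i) v) {..n}"
  unfolding poly_h_module_def module.simps
  by (rule M.add.finprod_mono_neutral_cong_left) (use assms in \<open>auto simp: coeff_eq_0\<close>)

lemma poly_act_closed [simp]: "v \<in> carrier V \<Longrightarrow> poly_act p v \<in> carrier V"
  by (simp add: poly_act_eq [OF _ order_refl] Pi_def)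

lemma h_finsum:
  assumes "finite I" "\<And>i. i \<in> I \<Longrightarrow> w i \<in> carrier V"
  shows "act_h V (finsum V w I) = finsum V (\<lambda>i. act_h V (w i)) I"
  using assms by (induction I) (auto simp: Pi_def)

lemma poly_act_0 [simp]: "v \<in> carrier V \<Longrightarrow> poly_act 0 v = \<zero>"
  by (simp add: poly_act_eq [of v 0 0])

lemma poly_act_pCons:
  assumes v: "v \<in> carrier V"
  shows "poly_act (pCons a p) v = a \<odot> v \<oplus> act_h V (poly_act p v)"
proof -
  have "poly_act (pCons a p) v =
      finsum V (\<lambda>i. poly.coeff (pCons a p) i \<odot> (act_h V ^^ i) v) {..Suc (degree p)}"
    by (rule poly_act_eq [OF v]) (rule degree_pCons_le)
  also have "\<dots> = finsum V (\<lambda>i. poly.coeff p i \<odot> (act_h V ^^ Suc i) v) {..degree p} \<oplus> a \<odot> v"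
    using v by (subst M.finsum_Suc2) auto
  also have "finsum V (\<lambda>i. poly.coeff p i \<odot> (act_h V ^^ Suc i) v) {..degree p} =
      act_h V (poly_act p v)"
    using v by (simp add: poly_act_eq [OF v order_refl] h_finsum Pi_def)
  finally show ?thesis
    using v by (simp add: M.a_comm)
qed

lemma poly_act_const: "v \<in> carrier V \<Longrightarrow> poly_act [:a:] v = a \<odot> v"
  by (simp add: poly_act_pCons)

lemma poly_act_1: "v \<in> carrier V \<Longrightarrow> poly_act 1 v = v"
  by (simp add: one_pCons poly_act_const)

lemma poly_act_h: "v \<in> carrier V \<Longrightarrow> poly_act [:a, 1:] v = a \<odot> v \<oplus> act_h V v"
  by (simp add: poly_act_pCons)

lemma poly_act_add:
  "v \<in> carrier V \<Longrightarrow> poly_act (p + q) v = poly_act p v \<oplus> poly_act q v"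
proof (induction p q rule: poly_induct2)
  case (pCons a p b q)
  then show ?case
    by (simp add: poly_act_pCons smult_add_left M.a_ac)
qed simp

lemma poly_act_add_right:
  "v \<in> carrier V \<Longrightarrow> w \<in> carrier V \<Longrightarrow> poly_act p (v \<oplus> w) = poly_act p v \<oplus> poly_act p w"
  by (induction p) (auto simp: poly_act_pCons smult_add_right M.a_ac)

lemma poly_act_smult:
  "v \<in> carrier V \<Longrightarrow> poly_act (smult a p) v = a \<odot> poly_act p v"
  by (induction p) (auto simp: poly_act_pCons smult_add_right smult_smult)

lemma poly_act_mult:
  "v \<in> carrier V \<Longrightarrow> poly_act (p * q) v = poly_act p (poly_act q v)"
  by (induction p) (auto simp: poly_act_pCons poly_act_add poly_act_smult)

lemma poly_act_zero [simp]: "poly_act p \<zero> = \<zero>"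
  by (induction p) (auto simp: poly_act_pCons)

lemma poly_h_module_simps [simp]:
  "carrier (poly_h_module V) = carrier V"
  "\<zero>\<^bsub>poly_h_module V\<^esub> = \<zero>"
  "v \<oplus>\<^bsub>poly_h_module V\<^esub> w = v \<oplus> w"
  by (simp_all add: poly_h_module_def)

lemma finsum_poly_h_module [simp]: "finsum (poly_h_module V) = finsum V"
  by (intro ext) (simp add: finsum_def finprod_def poly_h_module_def)

lemma idom_module_poly_h_module: "idom_module (poly_h_module V)"
proof -
  have "abelian_group (poly_h_module V)"
    by (rule abelian_groupI) (auto simp: M.a_ac intro: M.l_neg bexI [of _ "\<ominus> x" for x])
  then have "module (ring_of_type_algebra :: complex poly ring) (poly_h_module V)"
    by (intro moduleI) (auto simp: poly_act_add poly_act_add_right poly_act_mult poly_act_1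
        intro: cring_from_type_algebra)
  then show ?thesis
    by (simp add: idom_module_def)
qed

text \<open>The relation e h = (h - 2) e, extended to polynomials; f shifts the other way.\<close>

lemma e_poly_act:
  assumes v: "v \<in> carrier V"
  shows "act_e V (poly_act p v) = poly_act (pcompose p [:-2, 1:]) (act_e V v)"
proof (induction p)
  case 0
  then show ?case using v by simp
next
  case (pCons a p)
  have "act_e V (act_h V w) = poly_act [:-2, 1:] (act_e V w)" if w: "w \<in> carrier V" for w
  proof -
    have "poly_act [:-2, 1:] (act_e V w) = (-2) \<odot> act_e V w \<oplus> 2 \<odot> act_e V w \<oplus> act_e V (act_h V w)"
      using w by (simp add: poly_act_h h_e M.a_ac)
    also have "(-2) \<odot> act_e V w \<oplus> 2 \<odot> act_e V w = \<zero>"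
      using w smult_add_left [of "act_e V w" "-2" 2] by simp
    finally show ?thesis using w by simp
  qed
  then show ?case
    using v pCons by (simp add: poly_act_pCons pcompose_pCons poly_act_add poly_act_const
        poly_act_mult [symmetric] del: mult_pCons_left)
      (simp add: poly_act_mult poly_act_h del: mult_pCons_left)
qed

lemma f_poly_act:
  assumes v: "v \<in> carrier V"
  shows "act_f V (poly_act p v) = poly_act (pcompose p [:2, 1:]) (act_f V v)"
proof (induction p)
  case 0
  then show ?case using v by simp
next
  case (pCons a p)
  have "act_f V (act_h V w) = poly_act [:2, 1:] (act_f V w)" if w: "w \<in> carrier V" for w
  proof -
    have "poly_act [:2, 1:] (act_f V w) = 2 \<odot> act_f V w \<oplus> (-2) \<odot> act_f V w \<oplus> act_f V (act_h V w)"
      using w by (simp add: poly_act_h h_f M.a_ac)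
    also have "2 \<odot> act_f V w \<oplus> (-2) \<odot> act_f V w = \<zero>"
      using w smult_add_left [of "act_f V w" 2 "-2"] by simp
    finally show ?thesis using w by simp
  qed
  then show ?case
    using v pCons by (simp add: poly_act_pCons pcompose_pCons poly_act_add poly_act_const
        poly_act_mult [symmetric] del: mult_pCons_left)
      (simp add: poly_act_mult poly_act_h del: mult_pCons_left)
qed

lemma casimir_eq:
  assumes v: "v \<in> carrier V"
  shows "casimir V v = poly_act ([:1, 1:]^2) v \<oplus> 4 \<odot> act_f V (act_e V v)"
proof -
  have "act_h V w \<oplus> w = poly_act [:1, 1:] w" if "w \<in> carrier V" for w
    using that by (simp add: poly_act_h M.a_comm)
  then show ?thesis
    using v by (simp only: casimir_def Let_def poly_act_closed power2_eq_square poly_act_mult)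
qed

text \<open>The Casimir equation solved for f e. On a torsion-free module it also makes e
  injective.\<close>

lemma f_e:
  assumes v: "v \<in> carrier V" and cas: "casimir V v = \<theta> \<odot> v"
  shows "act_f V (act_e V v) = poly_act (fe_poly \<theta>) v"
proof -
  have "poly_act ([:1, 1:]^2) v \<oplus> 4 \<odot> act_f V (act_e V v) = poly_act [:\<theta>:] v"
    using v cas by (simp add: poly_act_const casimir_eq)
  moreover have "poly_act ([:1, 1:]^2) v \<oplus> poly_act ([:\<theta>:] - [:1, 1:]^2) v = poly_act [:\<theta>:] v"
    using v by (subst poly_act_add [symmetric]) auto
  ultimately have "4 \<odot> act_f V (act_e V v) = poly_act ([:\<theta>:] - [:1, 1:]^2) v"
    using v by (metis M.add.l_cancel e_simps(1) f_simps(1) poly_act_closed smult_carrier)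
  then have "(1/4) \<odot> (4 \<odot> act_f V (act_e V v)) = (1/4) \<odot> poly_act ([:\<theta>:] - [:1, 1:]^2) v"
    by simp
  then show ?thesis
    using v by (simp add: smult_smult fe_poly_def poly_act_smult)
qed

lemma submodule_iff:
  "Module.submodule S complex_ring V \<longleftrightarrow> S \<subseteq> carrier V \<and> \<zero> \<in> S \<and>
     (\<forall>v\<in>S. \<forall>w\<in>S. v \<oplus> w \<in> S) \<and> (\<forall>a. \<forall>v\<in>S. a \<odot> v \<in> S)"
proof
  assume S: "Module.submodule S complex_ring V"
  then have "\<zero> \<in> S"
    using subgroup.one_closed [OF submodule.axioms(1)] by fastforce
  then show "S \<subseteq> carrier V \<and> \<zero> \<in> S \<and> (\<forall>v\<in>S. \<forall>w\<in>S. v \<oplus> w \<in> S) \<and> (\<forall>a. \<forall>v\<in>S. a \<odot> v \<in> S)"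
    using submoduleE [OF S] by auto
next
  assume *: "S \<subseteq> carrier V \<and> \<zero> \<in> S \<and> (\<forall>v\<in>S. \<forall>w\<in>S. v \<oplus> w \<in> S) \<and> (\<forall>a. \<forall>v\<in>S. a \<odot> v \<in> S)"
  then show "Module.submodule S complex_ring V"
    by (intro submoduleI) (auto simp: minus_eq_smult subset_iff)
qed

lemma sl2_submodule_iff:
  "sl2_submodule S V \<longleftrightarrow> S \<subseteq> carrier V \<and> \<zero> \<in> S \<and>
     (\<forall>v\<in>S. \<forall>w\<in>S. v \<oplus> w \<in> S) \<and> (\<forall>a. \<forall>v\<in>S. a \<odot> v \<in> S) \<and>
     (\<forall>v \<in> S. act_e V v \<in> S \<and> act_f V v \<in> S \<and> act_h V v \<in> S)"
  by (auto simp: sl2_submodule_def submodule_iff)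

lemma sl2_submodule_carrier: "sl2_submodule (carrier V) V"
  by (auto simp: sl2_submodule_iff)

lemma restrict_sl2_module:
  assumes S: "sl2_submodule S V"
  shows "sl2_module (V\<lparr>carrier := S\<rparr>)"
proof -
  let ?W = "V\<lparr>carrier := S\<rparr>"
  have sub: "Module.submodule S complex_ring V"
    using S by (simp add: sl2_submodule_def)
  interpret W: module complex_ring ?W
    by (rule submodule.submodule_is_module [OF sub]) (rule module_axioms)
  have W: "v \<ominus>\<^bsub>?W\<^esub> w = u \<longleftrightarrow> v = u \<oplus> w" if "v \<in> S" "w \<in> S" "u \<in> S" for v w u
    using that W.M.add.inv_solve_right' [of u v w] by (simp add: a_minus_def)
  have hom: "T \<in> module_hom complex_ring ?W ?W"
    if "T \<in> module_hom complex_ring V V" "\<And>v. v \<in> S \<Longrightarrow> T v \<in> S" for T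
    using that S by (auto simp: module_hom_def sl2_submodule_iff subset_iff)
  show ?thesis
    by unfold_locales
      (use S act_e_linear act_f_linear act_h_linear in
        \<open>auto intro!: hom simp: W sl2_submodule_iff subset_iff h_e h_f e_f M.a_comm\<close>)
qed

end

section \<open>Submodules, homomorphisms and isomorphism classes\<close>

lemma sl2_submodule_restrict_iff:
  assumes "sl2_module V" "sl2_submodule S V"
  shows "sl2_submodule T (V\<lparr>carrier := S\<rparr>) \<longleftrightarrow> sl2_submodule T V \<and> T \<subseteq> S"
  using assms(2)
  unfolding sl2_module.sl2_submodule_iff [OF assms(1)]
    sl2_module.sl2_submodule_iff [OF sl2_module.restrict_sl2_module [OF assms]]
  by auto

definition sl2_hom :: "('v, 'y) sl2_struct_scheme \<Rightarrow> ('w, 'z) sl2_struct_scheme \<Rightarrow> ('v \<Rightarrow> 'w) \<Rightarrow> bool" where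
  "sl2_hom V W \<phi> \<longleftrightarrow> \<phi> \<in> module_hom complex_ring V W \<and>
     (\<forall>v \<in> carrier V. \<phi> (act_e V v) = act_e W (\<phi> v) \<and>
        \<phi> (act_f V v) = act_f W (\<phi> v) \<and> \<phi> (act_h V v) = act_h W (\<phi> v))"

lemma sl2_iso_iff: "sl2_iso V W \<longleftrightarrow> (\<exists>\<phi>. sl2_hom V W \<phi> \<and> bij_betw \<phi> (carrier V) (carrier W))"
  by (auto simp: sl2_iso_def sl2_hom_def)

lemma sl2_hom_simps:
  assumes "sl2_hom V W \<phi>" "v \<in> carrier V"
  shows "\<phi> v \<in> carrier W" "w \<in> carrier V \<Longrightarrow> \<phi> (v \<oplus>\<^bsub>V\<^esub> w) = \<phi> v \<oplus>\<^bsub>W\<^esub> \<phi> w"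
    "\<phi> (a \<odot>\<^bsub>V\<^esub> v) = a \<odot>\<^bsub>W\<^esub> \<phi> v"
    "\<phi> (act_e V v) = act_e W (\<phi> v)" "\<phi> (act_f V v) = act_f W (\<phi> v)" "\<phi> (act_h V v) = act_h W (\<phi> v)"
  using assms by (auto simp: sl2_hom_def module_hom_def)

lemma sl2_hom_poly_act:
  assumes "sl2_module V" "sl2_module W" "sl2_hom V W \<phi>" "v \<in> carrier V"
  shows "\<phi> (p \<odot>\<^bsub>poly_h_module V\<^esub> v) = p \<odot>\<^bsub>poly_h_module W\<^esub> \<phi> v"
proof -
  interpret V: sl2_module V by fact
  interpret W: sl2_module W by fact
  note \<phi> = sl2_hom_simps [OF assms(3)]
  have "\<phi> \<zero>\<^bsub>V\<^esub> = \<zero>\<^bsub>W\<^esub>"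
    using \<phi>(3) [of "\<zero>\<^bsub>V\<^esub>" 0] \<phi>(1) [of "\<zero>\<^bsub>V\<^esub>"] by simp
  then show ?thesis
    using assms(4) by (induction p) (auto simp: \<phi> V.poly_act_pCons W.poly_act_pCons)
qed

lemma sl2_hom_comp:
  "sl2_hom U V \<phi> \<Longrightarrow> sl2_hom V W \<psi> \<Longrightarrow> sl2_hom U W (\<lambda>v. \<psi> (\<phi> v))"
  by (auto simp: sl2_hom_def module_hom_def Pi_def)

lemma sl2_hom_inverse:
  assumes \<phi>: "sl2_hom V W \<phi>" and bij: "bij_betw \<phi> (carrier V) (carrier W)" and V: "sl2_module V"
  shows "sl2_hom W V (inv_into (carrier V) \<phi>)"
proof -
  interpret V: sl2_module V by (rule V)
  let ?i = "inv_into (carrier V) \<phi>"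
  note inv = bij_betw_inv_into_right [OF bij]
  have cl: "?i w \<in> carrier V" if "w \<in> carrier W" for w
    using bij that by (metis bij_betw_def inv_into_into)
  have eq: "?i w = v" if "v \<in> carrier V" "w = \<phi> v" for v w
    using bij that by (simp add: bij_betw_inv_into_left)
  show ?thesis
    unfolding sl2_hom_def module_hom_def
    by (intro CollectI conjI allI impI ballI funcsetI cl eq)
      (auto simp: cl inv sl2_hom_simps [OF \<phi>])
qed

lemma sl2_iso_sym: "sl2_module V \<Longrightarrow> sl2_iso V W \<Longrightarrow> sl2_iso W V"
  unfolding sl2_iso_iff using sl2_hom_inverse bij_betw_inv_into by blast

lemma sl2_iso_trans: "sl2_iso U V \<Longrightarrow> sl2_iso V W \<Longrightarrow> sl2_iso U W"
  unfolding sl2_iso_iff using sl2_hom_comp bij_betw_trans [unfolded comp_def] by blast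

lemma sl2_iso_rel_Image_eq_iff:
  assumes "sl2_module V" "sl2_module W"
  shows "sl2_iso_rel `` {V} = sl2_iso_rel `` {W} \<longleftrightarrow> sl2_iso V W"
proof
  have "sl2_iso W W"
    unfolding sl2_iso_iff by (intro exI [of _ "\<lambda>v. v"]) (auto simp: sl2_hom_def module_hom_def bij_betw_def)
  then have "W \<in> sl2_iso_rel `` {W}"
    using assms by (simp add: sl2_iso_rel_def)
  moreover assume "sl2_iso_rel `` {V} = sl2_iso_rel `` {W}"
  ultimately show "sl2_iso V W"
    by (auto simp: sl2_iso_rel_def)
next
  assume "sl2_iso V W"
  then show "sl2_iso_rel `` {V} = sl2_iso_rel `` {W}"
    using assms sl2_iso_sym sl2_iso_trans by (auto simp: sl2_iso_rel_def) blast+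
qed

section \<open>Embeddings into coordinate modules\<close>

locale coord_embedding = sl2_module V for V :: "('v, 'z) sl2_struct_scheme" (structure) +
  fixes \<theta> :: complex and m :: nat and g :: ratfun and \<kappa> :: "'v \<Rightarrow> coord"
  assumes inj: "inj_on \<kappa> (carrier V)"
    and range: "v \<in> carrier V \<Longrightarrow> \<kappa> v \<in> coord_module m g"
    and add [simp]: "v \<in> carrier V \<Longrightarrow> w \<in> carrier V \<Longrightarrow> \<kappa> (v \<oplus> w) = \<kappa> v + \<kappa> w"
    and smult [simp]: "v \<in> carrier V \<Longrightarrow> \<kappa> (a \<odot> v) = scale (ratfun_of_poly [:a:]) (\<kappa> v)"
    and e [simp]: "v \<in> carrier V \<Longrightarrow> \<kappa> (act_e V v) = coord_e (\<kappa> v)"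
    and f [simp]: "v \<in> carrier V \<Longrightarrow> \<kappa> (act_f V v) = coord_f \<theta> (\<kappa> v)"
    and h [simp]: "v \<in> carrier V \<Longrightarrow> \<kappa> (act_h V v) = coord_h (\<kappa> v)"
begin

lemma zero [simp]: "\<kappa> \<zero> = 0"
  using add [of \<zero> \<zero>] by simp

lemma eq_iff: "v \<in> carrier V \<Longrightarrow> w \<in> carrier V \<Longrightarrow> \<kappa> v = \<kappa> w \<longleftrightarrow> v = w"
  using inj by (auto simp: inj_on_def)

lemma eq_zero_iff: "v \<in> carrier V \<Longrightarrow> \<kappa> v = 0 \<longleftrightarrow> v = \<zero>"
  using eq_iff [of v \<zero>] by simp

lemma poly_act_coord [simp]: "v \<in> carrier V \<Longrightarrow> \<kappa> (poly_act p v) = scale (ratfun_of_poly p) (\<kappa> v)"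
proof (induction p)
  case (pCons a p)
  have eq: "pCons a p = [:a:] + [:0, 1:] * p"
    by simp
  have "\<kappa> (poly_act (pCons a p) v) =
      scale (ratfun_of_poly [:a:]) (\<kappa> v) + coord_h (scale (ratfun_of_poly p) (\<kappa> v))"
    using pCons by (simp add: poly_act_pCons)
  also have "\<dots> = scale (ratfun_of_poly (pCons a p)) (\<kappa> v)"
    unfolding eq ratfun_of_poly_add ratfun_of_poly_mult coord_h_def scale_scale scale_add_left ..
  finally show ?case .
qed simp

lemma finsum_coord:
  "finite I \<Longrightarrow> (\<And>i. i \<in> I \<Longrightarrow> w i \<in> carrier V) \<Longrightarrow> \<kappa> (finsum V w I) = (\<Sum>i\<in>I. \<kappa> (w i))"
  by (induction I rule: finite_induct) (auto simp: Pi_def)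

lemma e_power_coord:
  assumes "v \<in> carrier V"
  shows "(act_e V ^^ n) v \<in> carrier V" "\<kappa> ((act_e V ^^ n) v) = x_power (int n) (\<kappa> v)"
  using assms by (induction n) (auto simp: coord_e_def x_power_x_power)

lemma stable_image:
  assumes "sl2_submodule S V"
  shows "stable \<theta> (\<kappa> ` S)"
proof -
  have S: "S \<subseteq> carrier V" "\<zero> \<in> S" "\<And>v w. v \<in> S \<Longrightarrow> w \<in> S \<Longrightarrow> v \<oplus> w \<in> S"
      "\<And>a v. v \<in> S \<Longrightarrow> a \<odot> v \<in> S"
      "\<And>v. v \<in> S \<Longrightarrow> act_e V v \<in> S \<and> act_f V v \<in> S \<and> act_h V v \<in> S"
    using assms by (auto simp: sl2_submodule_iff)
  note c = subsetD [OF S(1)]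
  have "0 \<in> \<kappa> ` S"
    using S(2) zero by (metis imageI)
  moreover have "\<kappa> v + \<kappa> w \<in> \<kappa> ` S" if "v \<in> S" "w \<in> S" for v w
    using S(3) [OF that] add c that by (metis imageI)
  moreover have "scale (ratfun_of_poly [:a:]) (\<kappa> v) \<in> \<kappa> ` S" if "v \<in> S" for v a
    using S(4) [OF that] smult c that by (metis imageI)
  moreover have "coord_e (\<kappa> v) \<in> \<kappa> ` S \<and> coord_f \<theta> (\<kappa> v) \<in> \<kappa> ` S \<and> coord_h (\<kappa> v) \<in> \<kappa> ` S"
    if "v \<in> S" for v
    using S(5) [OF that] e f h c that by (metis imageI)
  ultimately show ?thesis
    unfolding stable_def by blast
qed

lemma sl2_submodule_preimage:
  assumes "stable \<theta> S"
  shows "sl2_submodule {v \<in> carrier V. \<kappa> v \<in> S} V"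
  using assms unfolding sl2_submodule_iff stable_def by simp

text \<open>The scalar \<theta> is built into \<open>coord_f\<close>: in coordinates f e is
  \<open>fe_poly\<close>, and injectivity of \<kappa> transfers this to V.\<close>

lemma casimir_coord:
  assumes v: "v \<in> carrier V"
  shows "casimir V v = \<theta> \<odot> v"
proof -
  have "4 \<odot> act_f V (act_e V v) = poly_act (smult 4 (fe_poly \<theta>)) v"
  proof -
    have "act_f V (act_e V v) = poly_act (fe_poly \<theta>) v"
      using v by (subst eq_iff [symmetric]) (auto simp: coord_f_def coord_e_def x_power_x_power)
    then show ?thesis
      using v by (simp add: poly_act_smult)
  qed
  moreover have "[:1, 1:]^2 + smult 4 (fe_poly \<theta>) = [:\<theta>:]"
    by (simp add: fe_poly_def)
  ultimately show ?thesis
    using v by (metis casimir_eq poly_act_add poly_act_const)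
qed

lemma torsion_free_coord: "torsion_free (poly_h_module V)"
proof -
  have "v = \<zero>" if "v \<in> carrier V" "p \<noteq> 0" "poly_act p v = \<zero>" for p v
  proof -
    have "scale (ratfun_of_poly p) (\<kappa> v) = 0"
      using that by (metis poly_act_coord zero)
    then show ?thesis
      using that eq_zero_iff by (simp add: scale_eq_0_iff)
  qed
  then show ?thesis
    by (auto simp: torsion_free_def)
qed

lemma restrict_embedding:
  assumes "sl2_submodule S V"
  shows "coord_embedding (V\<lparr>carrier := S\<rparr>) \<theta> m g \<kappa>"
proof -
  interpret S: sl2_module "V\<lparr>carrier := S\<rparr>"
    by (rule restrict_sl2_module [OF assms])
  have "S \<subseteq> carrier V"
    using assms by (simp add: sl2_submodule_iff)
  then show ?thesis
    by unfold_locales (auto intro: inj_on_subset [OF inj] range simp: subset_iff)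
qed

end

section \<open>The bracket relations in coordinates\<close>

lemma coord_f_e: "coord_f \<theta> (coord_e v) = scale (ratfun_of_poly (fe_poly \<theta>)) v"
  by (simp add: coord_f_def coord_e_def x_power_x_power)

text \<open>Rests on \<sigma>(q) = q + h for q = (\<theta> - (h + 1)^2) / 4.\<close>

lemma coord_e_f: "coord_e (coord_f \<theta> v) = coord_f \<theta> (coord_e v) + coord_h v"
proof -
  have "pcompose (fe_poly \<theta>) [:-2, 1:] = fe_poly \<theta> + [:0, 1:]"
    by (simp add: fe_poly_def pcompose_smult pcompose_diff pcompose_pCons pcompose_1
        power2_eq_square pcompose_mult algebra_simps)
  then have "ratfun_shift 2 (ratfun_of_poly (fe_poly \<theta>)) =
      ratfun_of_poly (fe_poly \<theta>) + ratfun_of_poly [:0, 1:]"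
    by (simp only: ratfun_shift_of_poly ratfun_of_poly_add)
  moreover have "coord_e (coord_f \<theta> v) = scale (ratfun_shift 2 (ratfun_of_poly (fe_poly \<theta>))) v"
    by (simp add: coord_f_def coord_e_def x_power_x_power x_power_scale)
  ultimately show ?thesis
    by (simp only: coord_f_e coord_h_def scale_add_left)
qed

lemma coord_h_e: "coord_h (coord_e v) = coord_e (coord_h v) + scale (ratfun_of_poly [:2:]) (coord_e v)"
proof -
  have "ratfun_of_poly [:0, 1:] = ratfun_shift 2 (ratfun_of_poly [:0, 1:]) + ratfun_of_poly [:2:]"
    unfolding ratfun_shift_of_poly ratfun_of_poly_add [symmetric] by (simp add: pcompose_pCons)
  then show ?thesis
    by (simp add: coord_e_def coord_h_def x_power_scale scale_add_left [symmetric])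
qed

lemma coord_h_f: "coord_h (coord_f \<theta> v) = coord_f \<theta> (coord_h v) + scale (ratfun_of_poly [:-2:]) (coord_f \<theta> v)"
proof -
  have "ratfun_of_poly [:0, 1:] = ratfun_shift (-2) (ratfun_of_poly [:0, 1:]) + ratfun_of_poly [:-2:]"
    unfolding ratfun_shift_of_poly ratfun_of_poly_add [symmetric] by (simp add: pcompose_pCons)
  then have "ratfun_of_poly [:0, 1:] * ratfun_of_poly (fe_poly \<theta>) =
      (ratfun_shift (-2) (ratfun_of_poly [:0, 1:]) + ratfun_of_poly [:-2:]) * ratfun_of_poly (fe_poly \<theta>)"
    by (rule arg_cong)
  then show ?thesis
    unfolding coord_f_def coord_h_def x_power_scale scale_scale scale_add_left [symmetric]
    by (simp add: algebra_simps del: mult_fract add_fract)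
qed

text \<open>All module axioms are identities that can be checked after applying the injective
  \<kappa>, so V only has to be closed under the operations.\<close>

lemma coord_embeddingI:
  fixes V :: "('v, 'z) sl2_struct_scheme" (structure)
  assumes inj: "inj_on \<kappa> (carrier V)"
    and range: "\<And>v. v \<in> carrier V \<Longrightarrow> \<kappa> v \<in> coord_module m g"
    and zero: "\<zero> \<in> carrier V" "\<kappa> \<zero> = 0"
    and add: "\<And>v w. v \<in> carrier V \<Longrightarrow> w \<in> carrier V \<Longrightarrow> v \<oplus> w \<in> carrier V \<and> \<kappa> (v \<oplus> w) = \<kappa> v + \<kappa> w"
    and smult: "\<And>a v. v \<in> carrier V \<Longrightarrow>
      a \<odot> v \<in> carrier V \<and> \<kappa> (a \<odot> v) = scale (ratfun_of_poly [:a:]) (\<kappa> v)"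
    and e: "\<And>v. v \<in> carrier V \<Longrightarrow> act_e V v \<in> carrier V \<and> \<kappa> (act_e V v) = coord_e (\<kappa> v)"
    and f: "\<And>v. v \<in> carrier V \<Longrightarrow> act_f V v \<in> carrier V \<and> \<kappa> (act_f V v) = coord_f \<theta> (\<kappa> v)"
    and h: "\<And>v. v \<in> carrier V \<Longrightarrow> act_h V v \<in> carrier V \<and> \<kappa> (act_h V v) = coord_h (\<kappa> v)"
  shows "coord_embedding V \<theta> m g \<kappa>"
proof -
  have eqI: "v = w" if "\<kappa> v = \<kappa> w" "v \<in> carrier V" "w \<in> carrier V" for v w
    using that inj by (auto simp: inj_on_def)
  have m1: "\<kappa> ((-1) \<odot> v) = - \<kappa> v" if "v \<in> carrier V" for v
    using smult [OF that, of "-1"] ratfun_of_poly_uminus [of "[:1:]"]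
    by (auto intro: coord_eqI)
  have group: "abelian_group V"
  proof (rule abelian_groupI)
    fix v assume "v \<in> carrier V"
    then show "\<exists>w\<in>carrier V. w \<oplus> v = \<zero>"
      using smult zero add m1 by (intro bexI [of _ "(-1) \<odot> v"] eqI) auto
  qed (use zero add in \<open>auto intro!: eqI simp: algebra_simps\<close>)
  have const: "ratfun_of_poly [:a + b:] = ratfun_of_poly [:a:] + ratfun_of_poly [:b:]"
    "ratfun_of_poly [:a * b:] = ratfun_of_poly [:a:] * ratfun_of_poly [:b:]" for a b
    by simp_all
  have module: "module complex_ring V"
    by (rule moduleI [OF _ group])
      (use smult add in \<open>auto intro!: eqI cring_from_type_algebra
        simp: const scale_add scale_add_left scale_scale simp del: mult_fract add_fract\<close>)
  interpret module complex_ring V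
    by (rule module)
  have diff: "v \<ominus> w = u \<longleftrightarrow> \<kappa> v = \<kappa> u + \<kappa> w"
    if "v \<in> carrier V" "w \<in> carrier V" "u \<in> carrier V" for v w u
    using that add M.add.inv_solve_right' [of u v w] inj_on_eq_iff [OF inj, of v "u \<oplus> w"]
    by (simp add: a_minus_def)
  have hom: "act_e V \<in> module_hom complex_ring V V" "act_f V \<in> module_hom complex_ring V V"
      "act_h V \<in> module_hom complex_ring V V"
    using e f h add smult
    by (auto simp: module_hom_def x_power_add x_power_scale coord_e_def coord_f_def coord_h_def
        scale_add scale_scale ratfun_shift_const mult.commute intro!: eqI simp del: mult_fract)
  show ?thesis
    by unfold_locales
      (use inj range add smult e f h hom in
        \<open>auto simp: diff coord_h_e coord_h_f coord_e_f add.commute\<close>)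
qed

subsection \<open>The quotient \<open>R / R(x\<^sup>m - g)\<close>\<close>

lemma skew_laurent_induct [case_names zero monom add]:
  assumes "P 0" "\<And>a i. P (skew_monom a i)" "\<And>p q. P p \<Longrightarrow> P q \<Longrightarrow> P (p + q)"
  shows "P p"
proof -
  have "P (Abs_skew_laurent r)" for r
  proof (induction r rule: skew_induct)
    case zero
    then show ?case using assms(1) by (simp add: zero_skew_laurent_def)
  next
    case (single i a)
    then show ?case using assms(2) by (simp add: skew_monom_def)
  next
    case (add p q)
    then show ?case using assms(3) by (metis plus_skew_laurent.abs_eq)
  qed
  then show ?thesis
    by (metis skew_coeffs_inverse)
qed

definition skew_act :: "skew_laurent \<Rightarrow> coord \<Rightarrow> coord" where
  "skew_act r v = (\<Sum>k\<in>Poly_Mapping.keys (skew_coeffs r).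
     scale (Poly_Mapping.lookup (skew_coeffs r) k) (x_power k v))"

lemma skew_act_superset:
  assumes "finite A" "Poly_Mapping.keys (skew_coeffs r) \<subseteq> A"
  shows "skew_act r v = (\<Sum>k\<in>A. scale (Poly_Mapping.lookup (skew_coeffs r) k) (x_power k v))"
  unfolding skew_act_def by (rule sum.mono_neutral_left) (use assms in \<open>auto simp: in_keys_iff\<close>)

lemma skew_act_monom [simp]: "skew_act (skew_monom a i) v = scale a (x_power i v)"
  by (subst skew_act_superset [of "{i}"]) (auto simp: skew_monom_def Abs_skew_laurent_inverse)

lemma skew_act_0 [simp]: "skew_act 0 v = 0"
  by (simp add: skew_act_def zero_skew_laurent.rep_eq)

lemma skew_act_add: "skew_act (r + s) v = skew_act r v + skew_act s v"
proof -
  let ?A = "Poly_Mapping.keys (skew_coeffs r) \<union> Poly_Mapping.keys (skew_coeffs s)"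
  have "Poly_Mapping.keys (skew_coeffs (r + s)) \<subseteq> ?A"
    unfolding plus_skew_laurent.rep_eq by (rule Poly_Mapping.keys_add)
  then show ?thesis
    by (simp add: skew_act_superset [of ?A] plus_skew_laurent.rep_eq lookup_add scale_add_left sum.distrib)
qed

lemma skew_act_diff: "skew_act (r - s) v = skew_act r v - skew_act s v"
  using skew_act_add [of "r - s" s v] by (simp add: algebra_simps)

lemma skew_act_sum: "skew_act (sum r I) v = (\<Sum>i\<in>I. skew_act (r i) v)"
  by (induction I rule: infinite_finite_induct) (auto simp: skew_act_add)

lemma skew_act_zero_right [simp]: "skew_act r 0 = 0"
  by (simp add: skew_act_def)

lemma skew_act_mult: "skew_act (r * s) v = skew_act r (skew_act s v)"
proof (induction r rule: skew_laurent_induct)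
  case (monom a i)
  show ?case
    by (induction s rule: skew_laurent_induct)
      (auto simp: distrib_left skew_act_add skew_monom_mult x_power_scale x_power_x_power scale_scale
        x_power_add scale_add)
qed (auto simp: distrib_right skew_act_add)

lemma skew_act_module: "v \<in> coord_module m g \<Longrightarrow> skew_act r v \<in> coord_module m g"
  unfolding skew_act_def by (intro coord_module_sum coord_module_scale coord_module_x_power)

lemma skew_one: "1 = skew_monom 1 0"
  by (simp add: one_skew_laurent_def skew_monom_def del: single_one)

lemma skew_x_power: "skew_x ^ n = skew_monom 1 (int n)"
  by (induction n) (auto simp: skew_monom_mult skew_one)

lemma skew_monom_add: "skew_monom (a + b) i = skew_monom a i + skew_monom b i"
  by (simp add: skew_monom_def plus_skew_laurent.abs_eq single_add)

lemma skew_monom_0 [simp]: "skew_monom 0 i = 0"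
  by (simp add: skew_monom_def zero_skew_laurent_def)

context
  fixes m :: nat and g :: ratfun
  assumes m: "m > 0" and g: "g \<noteq> 0"
begin

abbreviation generator :: skew_laurent where
  "generator \<equiv> skew_x ^ m - skew_const g"

lemma skew_act_generator: "skew_act (q * generator) (coord_unit m g) = 0"
  by (simp add: skew_act_mult skew_act_diff skew_x_power x_power_m_unit [OF m g])

text \<open>Right division by x^m - g, in steps of m in either direction. Lowering an exponent
  multiplies by a shift of g, raising it divides by one.\<close>

lemma skew_monom_reduce:
  "\<exists>q b'. skew_monom b (i + int m * n) = q * generator + skew_monom b' i"
proof (induction n arbitrary: b rule: int_induct [where k = 0])
  case base
  show ?case
    by (rule exI [of _ 0], rule exI [of _ b]) simp
next
  case (step1 n)
  let ?k = "i + int m * n"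
  have "skew_monom b (i + int m * (n + 1)) = skew_monom b ?k * generator +
      skew_monom (b * ratfun_shift (2 * of_int ?k) g) ?k"
    by (simp add: right_diff_distrib skew_x_power skew_monom_mult algebra_simps)
  moreover obtain q b' where
    "skew_monom (b * ratfun_shift (2 * of_int ?k) g) ?k = q * generator + skew_monom b' i"
    using step1 by blast
  ultimately have "skew_monom b (i + int m * (n + 1)) =
      (skew_monom b ?k + q) * generator + skew_monom b' i"
    by (simp add: distrib_right)
  then show ?case by blast
next
  case (step2 n)
  let ?k = "i + int m * (n - 1)"
  define c where "c = b / ratfun_shift (2 * of_int ?k) g"
  have "c * ratfun_shift (2 * of_int ?k) g = b"
    using g by (simp add: c_def)
  moreover have "?k + int m = i + int m * n"
    by (simp add: algebra_simps)
  ultimately have "skew_monom b ?k = skew_monom c (i + int m * n) - skew_monom c ?k * generator"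
    by (simp add: right_diff_distrib skew_x_power skew_monom_mult)
  moreover obtain q b' where "skew_monom c (i + int m * n) = q * generator + skew_monom b' i"
    using step2 by blast
  ultimately have "skew_monom b ?k = (q - skew_monom c ?k) * generator + skew_monom b' i"
    by (simp add: left_diff_distrib)
  then show ?case by blast
qed

lemma skew_reduce:
  "\<exists>q a. r = q * generator + (\<Sum>i\<in>{0..<int m}. skew_monom (a i) i)"
proof (induction r rule: skew_laurent_induct)
  case zero
  show ?case
    by (rule exI [of _ 0], rule exI [of _ "\<lambda>i. 0"]) simp
next
  case (monom b k)
  obtain q b' where q: "skew_monom b k = q * generator + skew_monom b' (k mod int m)"
    using skew_monom_reduce [of b "k mod int m" "k div int m"] by auto
  have "(\<Sum>i\<in>{0..<int m}. skew_monom (if i = k mod int m then b' else 0) i) =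
      (\<Sum>i\<in>{k mod int m}. skew_monom (if i = k mod int m then b' else 0) i)"
    by (rule sum.mono_neutral_right) (use m in auto)
  then have "skew_monom b k = q * generator +
      (\<Sum>i\<in>{0..<int m}. skew_monom (if i = k mod int m then b' else 0) i)"
    by (simp add: q)
  then show ?case
    by (intro exI [of _ q] exI [of _ "\<lambda>i. if i = k mod int m then b' else 0"]) 
next
  case (add r s)
  then obtain q a q' a' where rs:
    "r = q * generator + (\<Sum>i\<in>{0..<int m}. skew_monom (a i) i)"
    "s = q' * generator + (\<Sum>i\<in>{0..<int m}. skew_monom (a' i) i)"
    by blast
  have "r + s = (q + q') * generator + (\<Sum>i\<in>{0..<int m}. skew_monom (a i + a' i) i)"
    unfolding rs(1) rs(2) distrib_right skew_monom_add sum.distrib by (simp only: add_ac)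
  then show ?case
    by (intro exI [of _ "q + q'"] exI [of _ "\<lambda>i. a i + a' i"])
qed

text \<open>A remainder with exponents 0, ..., m - 1 is determined by its coordinates, so what
  annihilates 1 leaves remainder 0.\<close>

lemma skew_act_unit_eq_0_iff:
  "skew_act r (coord_unit m g) = 0 \<longleftrightarrow> (\<exists>q. r = q * generator)"
proof
  assume 0: "skew_act r (coord_unit m g) = 0"
  obtain q a where r: "r = q * generator + (\<Sum>i\<in>{0..<int m}. skew_monom (a i) i)"
    using skew_reduce by blast
  have *: "(\<Sum>i\<in>{0..<int m}. scale (a i) (x_power i (coord_unit m g))) = 0"
    using 0 by (simp add: r skew_act_add skew_act_generator skew_act_sum)
  have "a j = 0" if "j \<in> {0..<int m}" for j
    using x_power_unit_sum_at [OF m g that, of a] * by simp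
  then show "\<exists>q. r = q * generator"
    by (intro exI [of _ q]) (simp add: r)
next
  assume "\<exists>q. r = q * generator"
  then show "skew_act r (coord_unit m g) = 0"
    using skew_act_generator by auto
qed

definition quotient_class :: "skew_laurent \<Rightarrow> skew_laurent set" where
  "quotient_class r = {q * generator + r | q. True}"

lemma quotient_class_eq_iff:
  "quotient_class r = quotient_class s \<longleftrightarrow> skew_act r (coord_unit m g) = skew_act s (coord_unit m g)"
proof
  assume "quotient_class r = quotient_class s"
  moreover have "r \<in> quotient_class r"
    unfolding quotient_class_def by (intro CollectI exI [of _ 0]) simp
  ultimately obtain q where "r = q * generator + s"
    by (auto simp: quotient_class_def)
  then show "skew_act r (coord_unit m g) = skew_act s (coord_unit m g)"
    by (simp add: skew_act_add skew_act_generator)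
next
  assume "skew_act r (coord_unit m g) = skew_act s (coord_unit m g)"
  then have "skew_act (r - s) (coord_unit m g) = 0"
    by (simp add: skew_act_diff)
  then obtain q where q: "r - s = q * generator"
    by (auto simp: skew_act_unit_eq_0_iff)
  have "p * generator + r = (p + q) * generator + s" "p * generator + s = (p - q) * generator + r" for p
    using q by (simp_all only: distrib_right left_diff_distrib) (simp_all add: algebra_simps)
  then show "quotient_class r = quotient_class s"
    unfolding quotient_class_def by blast
qed

lemma left_quotient_carrier: "carrier (left_quotient generator) = range quotient_class"
  by (auto simp: left_quotient_def Let_def A_RCOSETS_def' a_r_coset_def r_coset_def cgenideal_def
      quotient_class_def)

lemma left_quotient_zero: "\<zero>\<^bsub>left_quotient generator\<^esub> = quotient_class 0"
  by (auto simp: left_quotient_def Let_def cgenideal_def quotient_class_def)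

lemma left_quotient_add:
  "quotient_class r \<oplus>\<^bsub>left_quotient generator\<^esub> quotient_class s = quotient_class (r + s)"
proof -
  have "x + y \<in> quotient_class (r + s)" if xy: "x \<in> quotient_class r" "y \<in> quotient_class s" for x y
  proof -
    obtain p q where "x = p * generator + r" "y = q * generator + s"
      using xy by (auto simp: quotient_class_def)
    then have "x + y = (p + q) * generator + (r + s)"
      by (simp add: distrib_right)
    then show ?thesis by (auto simp: quotient_class_def)
  qed
  moreover have "\<exists>x\<in>quotient_class r. \<exists>y\<in>quotient_class s. z = x + y" if z: "z \<in> quotient_class (r + s)" for z
  proof -
    obtain q where "z = q * generator + (r + s)"
      using z by (auto simp: quotient_class_def)
    then have "z = (q * generator + r) + (0 * generator + s)"
      by simp
    then show ?thesis
      unfolding quotient_class_def by blast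
  qed
  ultimately show ?thesis
    by (auto simp: left_quotient_def Let_def set_add_def set_mult_def)
qed

lemma left_quotient_smult: "r \<odot>\<^bsub>left_quotient generator\<^esub> quotient_class s = quotient_class (r * s)"
proof -
  have "quotient_class (r * y) = quotient_class (r * s)" if y: "y \<in> quotient_class s" for y
  proof -
    obtain q where "y = q * generator + s"
      using y by (auto simp: quotient_class_def)
    then have "r * y = (r * q) * generator + r * s"
      by (simp only: distrib_left mult.assoc)
    then show ?thesis
      by (simp only: quotient_class_eq_iff skew_act_add skew_act_generator) simp
  qed
  then have "(\<Union>y\<in>quotient_class s. quotient_class (r * y)) =
      (\<Union>y\<in>quotient_class s. quotient_class (r * s))"
    by (intro SUP_cong refl)
  moreover have "quotient_class s \<noteq> {}"
    by (auto simp: quotient_class_def)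
  ultimately have "(\<Union>y\<in>quotient_class s. quotient_class (r * y)) = quotient_class (r * s)"
    by simp
  moreover have "PIdl\<^bsub>ring_of_type_algebra\<^esub> generator +>\<^bsub>ring_of_type_algebra\<^esub> y = quotient_class y" for y
    by (auto simp: a_r_coset_def r_coset_def cgenideal_def quotient_class_def)
  ultimately show ?thesis
    by (simp add: left_quotient_def Let_def)
qed

text \<open>The choice of representative does not matter, by
  \<open>quotient_class_eq_iff\<close>.\<close>

definition quotient_coord :: "skew_laurent set \<Rightarrow> coord" where
  "quotient_coord T = skew_act (SOME r. T = quotient_class r) (coord_unit m g)"

lemma quotient_coord: "quotient_coord (quotient_class r) = skew_act r (coord_unit m g)"
proof -
  have "quotient_class r = quotient_class (SOME s. quotient_class r = quotient_class s)"
    by (rule someI) (rule refl)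
  then show ?thesis
    by (simp add: quotient_coord_def quotient_class_eq_iff)
qed

lemma quotient_coord_surj:
  assumes "v \<in> coord_module m g"
  obtains T where "T \<in> carrier (left_quotient generator)" "quotient_coord T = v"
proof
  let ?r = "\<Sum>i\<in>{0..<int m}. skew_monom (v \<bullet> i) i"
  show "quotient_class ?r \<in> carrier (left_quotient generator)"
    by (simp add: left_quotient_carrier)
  show "quotient_coord (quotient_class ?r) = v"
    using coord_expansion [OF m g assms] by (simp add: quotient_coord skew_act_sum)
qed

lemma quotient_embedding:
  "coord_embedding (restrict_sl2 \<theta> (left_quotient generator)) \<theta> m g quotient_coord"
proof (rule coord_embeddingI)
  show "inj_on quotient_coord (carrier (restrict_sl2 \<theta> (left_quotient generator)))"
    by (auto simp: inj_on_def restrict_sl2_def left_quotient_carrier quotient_coord quotient_class_eq_iff)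
  \<comment> \<open>In \<open>restrict_sl2\<close> the division by 4 takes place among rational
    functions, in \<open>fe_poly\<close> among polynomials.\<close>
  have fe: "ratfun_of_poly ([:\<theta>:] - [:1, 1:]^2) / 4 = ratfun_of_poly (fe_poly \<theta>)"
  proof -
    have 4: "(4 :: ratfun) = ratfun_of_poly [:4:]"
      using of_nat_fract [of 4, where ?'a = "complex poly"] by (simp add: numeral_poly)
    have "ratfun_of_poly (fe_poly \<theta>) * 4 = ratfun_of_poly (fe_poly \<theta> * [:4:])"
      unfolding 4 ratfun_of_poly_mult ..
    also have "fe_poly \<theta> * [:4:] = [:\<theta>:] - [:1, 1:]^2"
      by (simp add: fe_poly_def)
    finally have "ratfun_of_poly (fe_poly \<theta>) * 4 = ratfun_of_poly ([:\<theta>:] - [:1, 1:]^2)" .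
    moreover have "(4 :: ratfun) \<noteq> 0"
      unfolding 4 ratfun_of_poly_eq_0_iff by simp
    ultimately show ?thesis
      by (metis nonzero_mult_div_cancel_right)
  qed
  show "act_f (restrict_sl2 \<theta> (left_quotient generator)) v \<in> carrier (restrict_sl2 \<theta> (left_quotient generator)) \<and>
      quotient_coord (act_f (restrict_sl2 \<theta> (left_quotient generator)) v) = coord_f \<theta> (quotient_coord v)"
    if "v \<in> carrier (restrict_sl2 \<theta> (left_quotient generator))" for v
    using that unfolding restrict_sl2_def fe
    by (auto simp: left_quotient_carrier left_quotient_smult quotient_coord skew_act_mult coord_f_def)
qed (auto simp: restrict_sl2_def left_quotient_carrier left_quotient_zero left_quotient_add left_quotient_smult
    quotient_coord skew_act_add skew_act_mult skew_act_module coord_unit_module [OF m g] coord_e_def coord_h_def)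

end

section \<open>The socle\<close>

lemma image_subset_injD:
  assumes "inj_on f C" "A \<subseteq> C" "B \<subseteq> C" "f ` A \<subseteq> f ` B"
  shows "A \<subseteq> B"
proof
  fix x assume "x \<in> A"
  then obtain y where "y \<in> B" "f x = f y"
    using assms(4) by blast
  then show "x \<in> B"
    using \<open>x \<in> A\<close> assms(1-3) by (metis inj_onD subsetD)
qed

lemma coord_f_scale:
  "coord_f \<theta> (scale (ratfun_of_poly p) v) = scale (ratfun_of_poly (pcompose p [:2, 1:])) (coord_f \<theta> v)"
  by (simp add: coord_f_def x_power_scale ratfun_shift_of_poly scale_scale mult.commute)

lemma coord_e_scale:
  "coord_e (scale (ratfun_of_poly p) v) = scale (ratfun_of_poly (pcompose p [:-2, 1:])) (coord_e v)"
  by (simp add: coord_e_def x_power_scale ratfun_shift_of_poly)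

lemma stable_coord_module: "stable \<theta> (coord_module m g)"
  by (simp add: stable_def coord_module_add coord_module_scale coord_module_x_power coord_e_def
      coord_f_def coord_h_def)

text \<open>The isomorphism is \<kappa> followed by the inverse of \<kappa>'. The two carriers may
  have different types.\<close>

lemma sl2_iso_of_embeddings:
  assumes V: "coord_embedding V \<theta> m g \<kappa>" and W: "coord_embedding W \<theta> m g \<kappa>'"
    and eq: "\<kappa> ` carrier V = \<kappa>' ` carrier W"
  shows "sl2_iso V W"
proof -
  interpret V: coord_embedding V \<theta> m g \<kappa> by fact
  interpret W: coord_embedding W \<theta> m g \<kappa>' by fact
  let ?\<phi> = "\<lambda>v. inv_into (carrier W) \<kappa>' (\<kappa> v)"
  have \<phi>: "?\<phi> v \<in> carrier W" "\<kappa>' (?\<phi> v) = \<kappa> v" if "v \<in> carrier V" for v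
    using that eq by (metis image_eqI inv_into_into, metis image_eqI f_inv_into_f)
  have eqI: "?\<phi> v = w" if "v \<in> carrier V" "w \<in> carrier W" "\<kappa> v = \<kappa>' w" for v w
    using \<phi> [OF that(1)] that W.eq_iff by metis
  have "sl2_hom V W ?\<phi>"
    unfolding sl2_hom_def module_hom_def
    by (intro CollectI conjI allI impI ballI funcsetI eqI) (auto simp: \<phi>)
  moreover have "bij_betw ?\<phi> (carrier V) (carrier W)"
    using bij_betw_trans [of \<kappa> "carrier V" "\<kappa> ` carrier V" "inv_into (carrier W) \<kappa>'" "carrier W"]
      bij_betw_inv_into [of \<kappa>' "carrier W" "\<kappa>' ` carrier W"] V.inj W.inj eq
    by (simp add: bij_betw_def comp_def)
  ultimately show ?thesis
    unfolding sl2_iso_iff by blast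
qed

text \<open>Right multiplication commutes with the left action and is injective, so it embeds the
  module anew: j = 0 replaces g' by a cohomologous g, other j account for rotated
  parameters.\<close>

lemma embedding_right_mult:
  assumes V: "coord_embedding V \<theta> m g' \<kappa>" and a: "a \<noteq> 0"
    "g' * a = ratfun_shift (2 * of_int j) g * ratfun_shift (2 * of_nat m) a"
  shows "coord_embedding V \<theta> m g (\<lambda>v. right_mult a j (\<kappa> v))"
proof -
  interpret V: coord_embedding V \<theta> m g' \<kappa> by fact
  have "inj_on (\<lambda>v. right_mult a j (\<kappa> v)) (carrier V)"
  proof (rule inj_onI)
    fix v w assume vw: "v \<in> carrier V" "w \<in> carrier V" "right_mult a j (\<kappa> v) = right_mult a j (\<kappa> w)"
    have "right_mult a j (\<kappa> v) = right_mult a j (\<kappa> v - \<kappa> w) + right_mult a j (\<kappa> w)"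
      by (simp add: right_mult_add [symmetric])
    then have "\<kappa> v = \<kappa> w"
      using vw a(1) by (simp add: right_mult_eq_0_iff)
    then show "v = w"
      using vw V.eq_iff by blast
  qed
  then show ?thesis
    by unfold_locales
      (auto simp: right_mult_module [OF V.range a(2)] right_mult_add right_mult_scale right_mult_x_power
        coord_e_def coord_f_def coord_h_def)
qed

section \<open>The least stable subspace and the socle\<close>

locale normal_parameter =
  fixes m :: nat and \<theta> :: complex and \<omega> :: real and \<zeta> :: parameter
  assumes m: "m > 0" and roots: "\<And>z. poly (fe_poly \<theta>) z = 0 \<Longrightarrow> Re z < \<omega>"
    and \<zeta>: "\<zeta> \<in> \<Psi> m \<omega>" and aperiodic: "aperiodic m (g_ratfun \<zeta>)"
begin

abbreviation g :: ratfun where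
  "g \<equiv> g_ratfun \<zeta>"

lemma g: "g \<noteq> 0"
  using g_ratfun_nonzero [OF \<zeta>] .

text \<open>The submodule generated by 1. By aperiodicity and the choice of \<omega> it lies in
  every nonzero stable subspace of the coordinate module, so it is the socle in coordinates.\<close>

definition core :: "coord set" where
  "core = \<Inter>{S. stable \<theta> S \<and> coord_unit m g \<in> S}"

lemma core_stable: "stable \<theta> core"
  unfolding core_def stable_def by blast

lemma core_unit: "coord_unit m g \<in> core"
  by (simp add: core_def)

lemma core_least: "stable \<theta> S \<Longrightarrow> coord_unit m g \<in> S \<Longrightarrow> core \<subseteq> S"
  by (auto simp: core_def)

lemma core_subset: "core \<subseteq> coord_module m g"
  by (rule core_least [OF stable_coord_module coord_unit_module [OF m g]])

lemma unit_nonzero: "coord_unit m g \<noteq> 0"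
  using coord_unit_0 [OF m g] by auto

lemma core_subset_submodule:
  assumes "coord_embedding V \<theta> m g \<kappa>" "sl2_submodule T V" "T \<noteq> {\<zero>\<^bsub>V\<^esub>}"
  shows "core \<subseteq> \<kappa> ` T"
proof -
  interpret V: coord_embedding V \<theta> m g \<kappa> by fact
  have T: "T \<subseteq> carrier V" "\<zero>\<^bsub>V\<^esub> \<in> T"
    using assms(2) by (auto simp: V.sl2_submodule_iff)
  then obtain v where v: "v \<in> T" "v \<noteq> \<zero>\<^bsub>V\<^esub>"
    using assms(3) by blast
  have "coord_unit m g \<in> \<kappa> ` T"
  proof (rule stable_nonzero_contains_unit [OF m \<zeta> aperiodic roots V.stable_image [OF assms(2)]])
    show "\<kappa> ` T \<subseteq> coord_module m g"
      using T V.range by auto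
    show "\<kappa> v \<in> \<kappa> ` T" "\<kappa> v \<noteq> 0"
      using v T V.eq_zero_iff by auto
  qed
  then show ?thesis
    using V.stable_image [OF assms(2)] core_least by blast
qed

text \<open>The image is a nonzero stable subspace, so it contains \<open>core\<close>; the preimage
  of \<open>core\<close> is a nonzero submodule, hence everything. Thus the image depends neither on
  V nor on \<kappa>.\<close>

lemma simple_image:
  assumes V: "coord_embedding V \<theta> m g \<kappa>" and simple: "sl2_simple V"
  shows "\<kappa> ` carrier V = core"
proof
  interpret V: coord_embedding V \<theta> m g \<kappa> by fact
  show core: "core \<subseteq> \<kappa> ` carrier V"
    using core_subset_submodule [OF V V.sl2_submodule_carrier] simple by (simp add: sl2_simple_def)
  let ?S = "{v \<in> carrier V. \<kappa> v \<in> core}"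
  have "?S = {\<zero>\<^bsub>V\<^esub>} \<or> ?S = carrier V"
    using simple V.sl2_submodule_preimage [OF core_stable] by (simp add: sl2_simple_def)
  moreover obtain u where "u \<in> carrier V" "\<kappa> u = coord_unit m g"
    using core core_unit by auto
  then have "u \<in> ?S" "u \<noteq> \<zero>\<^bsub>V\<^esub>"
    using core_unit unit_nonzero by auto
  ultimately show "\<kappa> ` carrier V \<subseteq> core"
    by blast
qed

lemma simpleI:
  assumes V: "coord_embedding V \<theta> m g \<kappa>" and image: "\<kappa> ` carrier V = core"
  shows "sl2_simple V"
proof -
  interpret V: coord_embedding V \<theta> m g \<kappa> by fact
  have "T = carrier V" if "sl2_submodule T V" "T \<noteq> {\<zero>\<^bsub>V\<^esub>}" for T
  proof -
    have "T \<subseteq> carrier V"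
      using that by (simp add: V.sl2_submodule_iff)
    moreover have "\<kappa> ` carrier V \<subseteq> \<kappa> ` T"
      using core_subset_submodule [OF V that] image by simp
    ultimately show ?thesis
      using image_subset_injD [OF V.inj order_refl] by blast
  qed
  moreover have "carrier V \<noteq> {\<zero>\<^bsub>V\<^esub>}"
    using image core_unit unit_nonzero V.zero by auto
  ultimately show ?thesis
    using V.sl2_module_axioms by (auto simp: sl2_simple_def)
qed

text \<open>Every simple submodule contains the preimage S of \<open>core\<close>, hence equals it.
  So the sum defining the socle has the single term S.\<close>

lemma socle_embedding:
  "coord_embedding (socle_module m \<theta> \<zeta>) \<theta> m g (quotient_coord m g) \<and>
   sl2_simple (socle_module m \<theta> \<zeta>)"
proof -
  define V where "V = restrict_sl2 \<theta> (left_quotient (skew_x ^ m - skew_const g))"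
  define \<kappa> where "\<kappa> = quotient_coord m g"
  have V: "coord_embedding V \<theta> m g \<kappa>"
    unfolding V_def \<kappa>_def by (rule quotient_embedding [OF m g])
  interpret V: coord_embedding V \<theta> m g \<kappa> by (rule V)
  define S where "S = {v \<in> carrier V. \<kappa> v \<in> core}"
  have S: "sl2_submodule S V"
    unfolding S_def by (rule V.sl2_submodule_preimage [OF core_stable])
  have surj: "\<exists>v\<in>carrier V. \<kappa> v = n" if n: "n \<in> coord_module m g" for n
  proof -
    obtain T where "T \<in> carrier (left_quotient (skew_x ^ m - skew_const g))" "quotient_coord m g T = n"
      using quotient_coord_surj [OF m g n] .
    then show ?thesis
      by (auto simp: V_def \<kappa>_def restrict_sl2_def)
  qed
  have image: "\<kappa> ` S = core"
    using surj core_subset by (auto simp: S_def image_iff)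
  have emb: "coord_embedding (V\<lparr>carrier := S\<rparr>) \<theta> m g \<kappa>"
    by (rule V.restrict_embedding [OF S])
  have simple: "sl2_simple (V\<lparr>carrier := S\<rparr>)"
    by (rule simpleI [OF emb]) (simp add: image)
  have "T = S" if T: "sl2_submodule T V" "sl2_simple (V\<lparr>carrier := T\<rparr>)" for T
  proof -
    have "T \<noteq> {\<zero>\<^bsub>V\<^esub>}"
      using T(2) by (simp add: sl2_simple_def)
    then have "\<kappa> ` S \<subseteq> \<kappa> ` T"
      using core_subset_submodule [OF V T(1)] image by simp
    moreover have "T \<subseteq> carrier V" "S \<subseteq> carrier V"
      using T(1) by (auto simp: V.sl2_submodule_iff S_def)
    ultimately have "S \<subseteq> T"
      using image_subset_injD [OF V.inj] by blast
    then have "sl2_submodule S (V\<lparr>carrier := T\<rparr>)"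
      using S T(1) sl2_submodule_restrict_iff [OF V.sl2_module_axioms] by blast
    then have "S = {\<zero>\<^bsub>V\<^esub>} \<or> S = T"
      using T(2) by (auto simp: sl2_simple_def)
    moreover have "S \<noteq> {\<zero>\<^bsub>V\<^esub>}"
      using simple by (simp add: sl2_simple_def)
    ultimately show ?thesis by blast
  qed
  then have "\<Union>{T. sl2_submodule T V \<and> sl2_simple (V\<lparr>carrier := T\<rparr>)} = S"
    using S simple by blast
  moreover have "subgroup S (add_monoid V)"
    using S submodule.axioms(1) by (auto simp: sl2_submodule_def)
  then have "generate (add_monoid V) S = S"
    using group.generateI [of "add_monoid V" S S] V.M.a_comm_group by (auto simp: comm_group_def)
  ultimately have "socle_module m \<theta> \<zeta> = V\<lparr>carrier := S\<rparr>"
    by (simp add: socle_module_def socle_def V_def)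
  then show ?thesis
    using emb simple by (simp add: \<kappa>_def)
qed

text \<open>The vectors all of whose homogeneous components lie in \<open>core\<close> form a stable
  subspace, and it contains 1 because 1 is homogeneous.\<close>

lemma graded_component_core:
  assumes "v \<in> core"
  shows "Abs_coord (\<lambda>j. if int m dvd j - i then v \<bullet> j else 0) \<in> core"
proof -
  define comp where "comp = (\<lambda>i v. Abs_coord (\<lambda>j. if int m dvd j - i then v \<bullet> j else 0))"
  have comp: "comp i v \<bullet> j = (if int m dvd j - i then v \<bullet> j else 0)" for i v j
    by (simp add: comp_def Abs_coord_inverse)
  let ?S = "{v. \<forall>i. comp i v \<in> core}"
  have eqs: "comp i 0 = 0" "comp i (v + w) = comp i v + comp i w" "comp i (scale a v) = scale a (comp i v)"
    "comp i (x_power k v) = x_power k (comp (i - k) v)" for i k a v w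
    by (auto intro!: coord_eqI simp: comp x_power_apply algebra_simps)
  have "stable \<theta> ?S"
    using core_stable by (simp add: stable_def eqs coord_e_def coord_f_def coord_h_def)
  moreover have "comp i (coord_unit m g) = (if int m dvd i then coord_unit m g else 0)" for i
  proof (cases "int m dvd i")
    case True
    then show ?thesis
      by (auto intro!: coord_eqI simp: comp coord_unit_eq_0 [OF m g] dvd_diff_left_iff)
  next
    case False
    have "comp i (coord_unit m g) \<bullet> j = 0" for j
    proof (cases "int m dvd j - i")
      case True
      then have "\<not> int m dvd j"
        using False by (metis diff_diff_eq2 dvd_diff add_diff_cancel_left')
      then show ?thesis
        by (simp add: comp coord_unit_eq_0 [OF m g])
    qed (simp add: comp)
    then show ?thesis
      using False by (auto intro: coord_eqI)
  qed
  then have "coord_unit m g \<in> ?S"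
    using core_unit core_stable by (auto simp: stable_def)
  ultimately show ?thesis
    using core_least assms by (auto simp: comp_def)
qed

lemma core_x_power_unit: "i \<ge> 0 \<Longrightarrow> x_power i (coord_unit m g) \<in> core"
  using stable_e_power [OF core_stable core_unit, of "nat i"] by simp

text \<open>The vectors x^0, ..., x^(m - 1) lie in \<open>core\<close> and form the family that
  determines the rank; the grading is by the residue class of the index.\<close>

lemma graded_simpleI:
  assumes V: "coord_embedding V \<theta> m g \<kappa>" and simple: "sl2_simple V"
  shows "graded_simple_of_rank m \<theta> V"
proof -
  interpret V: coord_embedding V \<theta> m g \<kappa> by fact
  interpret P: idom_module "poly_h_module V" by (rule V.idom_module_poly_h_module)
  note image = simple_image [OF V simple]
  let ?I = "{0..<int m}"
  define lift where "lift = inv_into (carrier V) \<kappa>"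
  have lift: "lift n \<in> carrier V" "\<kappa> (lift n) = n" if "n \<in> core" for n
    using that image by (metis lift_def inv_into_into, metis lift_def f_inv_into_f)
  define w where "w = (\<lambda>i. lift (x_power i (coord_unit m g)))"
  have w: "w i \<in> carrier V" "\<kappa> (w i) = x_power i (coord_unit m g)" if "i \<in> ?I" for i
    using lift core_x_power_unit that by (auto simp: w_def)
  have sum: "\<kappa> (finsum V (\<lambda>i. V.poly_act (b i) (w i)) ?I) =
      (\<Sum>i\<in>?I. scale (ratfun_of_poly (b i)) (x_power i (coord_unit m g)))" for b
  proof -
    have "\<kappa> (finsum V (\<lambda>i. V.poly_act (b i) (w i)) ?I) = (\<Sum>i\<in>?I. \<kappa> (V.poly_act (b i) (w i)))"
      by (rule V.finsum_coord) (simp_all add: w)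
    also have "\<dots> = (\<Sum>i\<in>?I. scale (ratfun_of_poly (b i)) (x_power i (coord_unit m g)))"
      by (rule sum.cong) (simp_all add: w)
    finally show ?thesis .
  qed
  have "P.independent_family w ?I"
    unfolding P.independent_family_def
  proof (intro allI impI ballI)
    fix b j assume "finsum (poly_h_module V) (\<lambda>i. V.poly_act (b i) (w i)) ?I = \<zero>\<^bsub>poly_h_module V\<^esub>"
      and j: "j \<in> ?I"
    then have "(\<Sum>i\<in>?I. scale (ratfun_of_poly (b i)) (x_power i (coord_unit m g))) = 0"
      using sum [of b] by simp
    then show "b j = 0"
      using x_power_unit_sum_at [OF m g j, of "\<lambda>i. ratfun_of_poly (b i)"] by simp
  qed
  moreover have "P.generically_spanning w ?I"
    unfolding P.generically_spanning_def
  proof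
    fix v assume "v \<in> carrier (poly_h_module V)"
    then have v: "v \<in> carrier V" by simp
    obtain a b where ab: "a \<noteq> 0" "\<And>i. i \<in> ?I \<Longrightarrow> \<kappa> v \<bullet> i = Fract (b i) a"
      using P.common_denominator [of ?I "\<lambda>i. \<kappa> v \<bullet> i"] by auto
    have "\<kappa> (V.poly_act a v) = (\<Sum>i\<in>?I. scale (ratfun_of_poly a) (scale (\<kappa> v \<bullet> i) (x_power i (coord_unit m g))))"
      using v coord_expansion [OF m g V.range [OF v]] by (simp add: scale_sum [symmetric])
    also have "\<dots> = (\<Sum>i\<in>?I. scale (ratfun_of_poly (b i)) (x_power i (coord_unit m g)))"
    proof (rule sum.cong)
      fix i assume "i \<in> ?I"
      then have "ratfun_of_poly a * \<kappa> v \<bullet> i = ratfun_of_poly (b i)"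
        using ab by (simp add: eq_fract)
      then show "scale (ratfun_of_poly a) (scale (\<kappa> v \<bullet> i) (x_power i (coord_unit m g))) =
          scale (ratfun_of_poly (b i)) (x_power i (coord_unit m g))"
        by (simp only: scale_scale)
    qed simp
    also have "\<dots> = \<kappa> (finsum V (\<lambda>i. V.poly_act (b i) (w i)) ?I)"
      by (simp add: sum)
    finally have "V.poly_act a v = finsum V (\<lambda>i. V.poly_act (b i) (w i)) ?I"
      using v w by (subst (asm) V.eq_iff) (auto intro!: V.M.finsum_closed)
    then show "\<exists>a b. a \<noteq> 0 \<and> V.poly_act a v = finsum (poly_h_module V) (\<lambda>i. V.poly_act (b i) (w i)) ?I"
      using ab(1) by auto
  qed
  ultimately have "has_rank (poly_h_module V) (card ?I)"
    using w by (intro P.has_rankI V.torsion_free_coord) auto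
  then have rank: "has_rank (poly_h_module V) m"
    by simp
  define W where "W = (\<lambda>i. {v \<in> carrier V. \<forall>j. \<not> int m dvd j - i \<longrightarrow> \<kappa> v \<bullet> j = 0})"
  \<comment> \<open>Degrees are kept reduced modulo m, so changing the degree by k is a shift of
    indices up to multiples of m.\<close>
  have shift: "int m dvd j - (i + k) mod int m \<longleftrightarrow> int m dvd (j - k) - i" for i j k
    by (simp add: mod_eq_dvd_iff [symmetric] mod_diff_right_eq algebra_simps)
  have "is_cyclic_grading m V W"
    unfolding is_cyclic_grading_def
  proof (intro conjI ballI)
    fix i assume "i \<in> ?I"
    show "Module.submodule (W i) complex_ring V"
      by (auto simp: V.submodule_iff W_def)
    show "act_e V ` W i \<subseteq> W ((i + 1) mod int m)"
      by (auto simp: W_def shift coord_e_def x_power_apply)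
    show "act_h V ` W i \<subseteq> W i"
      by (auto simp: W_def coord_h_def)
    have "int m dvd j - (i - 1) mod int m \<longleftrightarrow> int m dvd (j + 1) - i" for j
      using shift [of j i "-1"] by simp
    then show "act_f V ` W i \<subseteq> W ((i - 1) mod int m)"
      by (auto simp: W_def coord_f_def x_power_apply)
  next
    fix v assume v: "v \<in> carrier V"
    define u where "u = (\<lambda>i\<in>?I. lift (Abs_coord (\<lambda>j. if int m dvd j - i then \<kappa> v \<bullet> j else 0)))"
    have "\<kappa> v \<in> core"
      using v image by blast
    then have u: "u i \<in> carrier V" "\<kappa> (u i) \<bullet> j = (if int m dvd j - i then \<kappa> v \<bullet> j else 0)" if "i \<in> ?I" for i j
      using that lift [OF graded_component_core] by (auto simp: u_def Abs_coord_inverse)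
    have residue: "int m dvd j - i \<longleftrightarrow> i = j mod int m" if "i \<in> ?I" for i j
      using that by (auto simp: mod_eq_dvd_iff [symmetric] mod_pos_pos_trivial)
    \<comment> \<open>At index j only the component of degree j mod m is nonzero, so the components
      can be read off from the sum.\<close>
    have sum': "\<kappa> (finsum V u' ?I) \<bullet> j = \<kappa> (u' (j mod int m)) \<bullet> j" if u': "u' \<in> PiE ?I W" for u' j
    proof -
      have u'W: "u' i \<in> W i" if "i \<in> ?I" for i
        using u' that by auto
      then have "\<kappa> (finsum V u' ?I) = (\<Sum>i\<in>?I. \<kappa> (u' i))"
        by (intro V.finsum_coord) (auto simp: W_def)
      then have "\<kappa> (finsum V u' ?I) \<bullet> j = (\<Sum>i\<in>?I. \<kappa> (u' i) \<bullet> j)"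
        by (simp add: coord_at_sum)
      also have "\<dots> = (\<Sum>i\<in>{j mod int m}. \<kappa> (u' i) \<bullet> j)"
        by (rule sum.mono_neutral_right) (use m u'W residue in \<open>auto simp: W_def\<close>)
      finally show ?thesis by simp
    qed
    show "\<exists>!u. u \<in> PiE ?I W \<and> v = finsum V u ?I"
    proof (rule ex1I [of _ u])
      have uW: "u \<in> PiE ?I W"
        using u by (auto simp: W_def PiE_def) (simp add: u_def)
      have "\<kappa> (finsum V u ?I) = \<kappa> v"
        by (rule coord_eqI) (use sum' [OF uW] u(2) residue m in auto)
      then have "v = finsum V u ?I"
        using v u by (subst (asm) V.eq_iff) (auto intro!: V.M.finsum_closed)
      with uW show "u \<in> PiE ?I W \<and> v = finsum V u ?I" by blast
      fix u' assume u': "u' \<in> PiE ?I W \<and> v = finsum V u' ?I"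
      show "u' = u"
      proof (rule PiE_ext)
        show "u' \<in> PiE ?I W" "u \<in> PiE ?I W"
          using u' uW by auto
        fix i assume i: "i \<in> ?I"
        then have "u' i \<in> W i"
          using u' by auto
        have "\<kappa> (u' i) \<bullet> j = \<kappa> (u i) \<bullet> j" for j
        proof (cases "int m dvd j - i")
          case True
          then have "i = j mod int m"
            using residue i by blast
          then have "\<kappa> (u' i) \<bullet> j = \<kappa> v \<bullet> j"
            using sum' [of u' j] u' by simp
          then show ?thesis
            using u(2) [OF i] True by simp
        next
          case False
          then show ?thesis
            using u(2) [OF i] \<open>u' i \<in> W i\<close> by (simp add: W_def)
        qed
        then have "\<kappa> (u' i) = \<kappa> (u i)"
          by (rule coord_eqI)
        then show "u' i = u i"
          using V.eq_iff \<open>u' i \<in> W i\<close> u(1) [OF i] by (auto simp: W_def)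
      qed
    qed
  qed
  then show ?thesis
    using simple rank V.torsion_free_coord V.casimir_coord
    by (auto simp: graded_simple_of_rank_def admits_cyclic_grading_def)
qed

end

section \<open>Isomorphisms and regular orbits\<close>

text \<open>The group is carried by 0, ..., m - 1; allowing rotations by any k spares reductions
  modulo m later.\<close>

lemma orbit_eq:
  assumes "m > 0" "\<zeta> \<in> \<Psi> m \<omega>"
  shows "\<Psi>_orbit m \<omega> \<zeta> = {(fst \<zeta>, rotate k (snd \<zeta>)) | k. True}"
proof -
  have len: "length (snd \<zeta>) = m"
    using assms by (auto simp: \<Psi>_def)
  have "\<exists>j\<in>{0..<int m}. rotate k (snd \<zeta>) = rotate (nat j) (snd \<zeta>)" for k
    using assms(1) rotate_conv_mod [of k "snd \<zeta>"] len
    by (intro bexI [of _ "int (k mod m)"]) auto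
  then show ?thesis
    using assms by (fastforce simp: Group_Action.orbit_def cyclic_action_def carrier_integer_mod_group)
qed

lemma orbit_member:
  assumes m: "m > 0" and \<zeta>: "\<zeta> \<in> \<Psi> m \<omega>" and \<zeta>': "\<zeta>' \<in> \<Psi>_orbit m \<omega> \<zeta>"
  shows "\<zeta>' \<in> \<Psi> m \<omega>" "\<Psi>_orbit m \<omega> \<zeta>' = \<Psi>_orbit m \<omega> \<zeta>"
proof -
  obtain k where k: "\<zeta>' = (fst \<zeta>, rotate k (snd \<zeta>))"
    using \<zeta>' by (auto simp: orbit_eq [OF m \<zeta>])
  show *: "\<zeta>' \<in> \<Psi> m \<omega>"
    using \<zeta> by (auto simp: \<Psi>_def k)
  have len: "length (snd \<zeta>) = m"
    using \<zeta> by (auto simp: \<Psi>_def)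
  \<comment> \<open>Rotating by m k - k undoes the rotation by k within the natural numbers.\<close>
  have "rotate j (snd \<zeta>) = rotate (j + (m * k - k)) (rotate k (snd \<zeta>))" for j
  proof -
    have "k \<le> m * k"
      using m by simp
    then have "j + (m * k - k) + k = j + m * k"
      by linarith
    then have "rotate (j + (m * k - k)) (rotate k (snd \<zeta>)) = rotate (j + m * k) (snd \<zeta>)"
      by (simp only: rotate_rotate)
    then show ?thesis
      using rotate_conv_mod [of "j + m * k" "snd \<zeta>"] rotate_conv_mod [of j "snd \<zeta>"] len by simp
  qed
  then show "\<Psi>_orbit m \<omega> \<zeta>' = \<Psi>_orbit m \<omega> \<zeta>"
    unfolding orbit_eq [OF m \<zeta>] orbit_eq [OF m *] by (auto simp: k rotate_rotate)
qed

lemma orbit_self: "m > 0 \<Longrightarrow> \<zeta> \<in> \<Psi> m \<omega> \<Longrightarrow> \<zeta> \<in> \<Psi>_orbit m \<omega> \<zeta>"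
  by (auto simp: orbit_eq intro!: exI [of _ 0])

text \<open>\<sigma> undoes a rotation by \<open>g_ratfun_rotate\<close>, so \<sigma>^i corresponds
  to rotating by m - i.\<close>

lemma shift_g_ratfun:
  assumes "\<zeta> \<in> \<Psi> m \<omega>" "i \<le> m"
  shows "cohomologous m (ratfun_shift (2 * of_nat i) (g_ratfun \<zeta>)) (g_ratfun (fst \<zeta>, rotate (m - i) (snd \<zeta>)))"
proof -
  have len: "length (snd \<zeta>) = m"
    using assms by (auto simp: \<Psi>_def)
  have "rotate i (rotate (m - i) (snd \<zeta>)) = snd \<zeta>"
    using assms(2) len rotate_conv_mod [of m "snd \<zeta>"] by (simp add: rotate_rotate)
  then show ?thesis
    using g_ratfun_rotate [of "rotate (m - i) (snd \<zeta>)" i "fst \<zeta>"] len by simp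
qed

lemma rotate_Psi: "\<zeta> \<in> \<Psi> m \<omega> \<Longrightarrow> (fst \<zeta>, rotate k (snd \<zeta>)) \<in> \<Psi> m \<omega>"
  by (auto simp: \<Psi>_def)

text \<open>The normal form of \<sigma>^i(g) is the parameter rotated by m - i, and normal forms are
  unique. Both sides therefore say that these rotations are distinct for i < m.\<close>

lemma is_regular_iff:
  assumes m: "m > 0"
  shows "is_regular m \<omega> \<zeta> \<longleftrightarrow> \<zeta> \<in> \<Psi> m \<omega> \<and> aperiodic m (g_ratfun \<zeta>)"
proof (cases "\<zeta> \<in> \<Psi> m \<omega>")
  case \<zeta>: True
  let ?f = "\<lambda>i. (fst \<zeta>, rotate (m - i) (snd \<zeta>))"
  have len: "length (snd \<zeta>) = m"
    using \<zeta> by (auto simp: \<Psi>_def)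
  have "\<exists>i\<in>{..<m}. rotate k (snd \<zeta>) = rotate (m - i) (snd \<zeta>)" for k
  proof (cases "k mod m = 0")
    case True
    then show ?thesis
      using m len rotate_conv_mod [of k "snd \<zeta>"] rotate_conv_mod [of m "snd \<zeta>"]
      by (intro bexI [of _ 0]) auto
  next
    case False
    then show ?thesis
      using m len rotate_conv_mod [of k "snd \<zeta>"]
      by (intro bexI [of _ "m - k mod m"]) (auto simp: less_imp_le)
  qed
  then have orbit: "\<Psi>_orbit m \<omega> \<zeta> = ?f ` {..<m}"
    unfolding orbit_eq [OF m \<zeta>] by fastforce
  have coh: "cohomologous m (ratfun_shift (2 * of_nat i) (g_ratfun \<zeta>)) (ratfun_shift (2 * of_nat j) (g_ratfun \<zeta>))
      \<longleftrightarrow> ?f i = ?f j" if "i < m" "j < m" for i j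
  proof
    assume *: "cohomologous m (ratfun_shift (2 * of_nat i) (g_ratfun \<zeta>)) (ratfun_shift (2 * of_nat j) (g_ratfun \<zeta>))"
    have "cohomologous m (g_ratfun (?f i)) (g_ratfun (?f j))"
      using cohomologous_trans [OF cohomologous_trans [OF cohomologous_sym [OF shift_g_ratfun [OF \<zeta>]] *]
          shift_g_ratfun [OF \<zeta>]] that by simp
    then show "?f i = ?f j"
      using normal_form_unique [OF m rotate_Psi [OF \<zeta>] rotate_Psi [OF \<zeta>]] by blast
  next
    assume "?f i = ?f j"
    then show "cohomologous m (ratfun_shift (2 * of_nat i) (g_ratfun \<zeta>)) (ratfun_shift (2 * of_nat j) (g_ratfun \<zeta>))"
      using cohomologous_trans [OF shift_g_ratfun [OF \<zeta>, of i]
        cohomologous_sym [OF shift_g_ratfun [OF \<zeta>, of j, folded \<open>?f i = ?f j\<close>]]] that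
      by simp
  qed
  have "is_regular m \<omega> \<zeta> \<longleftrightarrow> inj_on ?f {..<m}"
    using \<zeta> inj_on_iff_eq_card [of "{..<m}" ?f] by (simp add: is_regular_def orbit)
  also have "\<dots> \<longleftrightarrow> aperiodic m (g_ratfun \<zeta>)"
  proof
    assume inj: "inj_on ?f {..<m}"
    show "aperiodic m (g_ratfun \<zeta>)"
      unfolding aperiodic_def
    proof (intro ballI impI)
      fix i j :: int assume ij: "i \<in> {0..<int m}" "j \<in> {0..<int m}"
        "cohomologous m (ratfun_shift (2 * of_int i) (g_ratfun \<zeta>)) (ratfun_shift (2 * of_int j) (g_ratfun \<zeta>))"
      then have "nat i < m" "nat j < m" "of_int i = (of_nat (nat i) :: complex)" "of_int j = (of_nat (nat j) :: complex)"
        by auto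
      then have "?f (nat i) = ?f (nat j)"
        using coh [of "nat i" "nat j"] ij(3) by metis
      then have "nat i = nat j"
        using inj_onD [OF inj, of "nat i" "nat j"] \<open>nat i < m\<close> \<open>nat j < m\<close> by simp
      then show "i = j"
        using ij(1,2) by (auto simp: eq_nat_nat_iff)
    qed
  next
    assume ap: "aperiodic m (g_ratfun \<zeta>)"
    show "inj_on ?f {..<m}"
    proof (rule inj_onI)
      fix i j assume ij: "i \<in> {..<m}" "j \<in> {..<m}" "?f i = ?f j"
      then have "cohomologous m (ratfun_shift (2 * of_int (int i)) (g_ratfun \<zeta>))
          (ratfun_shift (2 * of_int (int j)) (g_ratfun \<zeta>))"
        using coh [of i j] by simp
      then have "int i = int j"
        using ap ij(1,2) unfolding aperiodic_def by (metis atLeastLessThan_iff lessThan_iff of_nat_0_le_iff of_nat_less_iff)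
      then show "i = j" by simp
    qed
  qed
  finally show ?thesis
    using \<zeta> by simp
qed (simp add: is_regular_def)

text \<open>An isomorphism sends 1 to a nonzero n with x^m n = g n. Any nonzero coefficient n i then
  shows g to be cohomologous to \<sigma>^i(g'), and uniqueness of normal forms gives a rotation.
  Conversely, a rotation is realized by a right multiplication.\<close>

lemma socle_iso_iff:
  assumes N: "normal_parameter m \<theta> \<omega> \<zeta>" and N': "normal_parameter m \<theta> \<omega> \<zeta>'"
  shows "sl2_iso (socle_module m \<theta> \<zeta>) (socle_module m \<theta> \<zeta>') \<longleftrightarrow> \<zeta> \<in> \<Psi>_orbit m \<omega> \<zeta>'"
proof
  interpret N: normal_parameter m \<theta> \<omega> \<zeta> by fact
  interpret N': normal_parameter m \<theta> \<omega> \<zeta>' by fact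
  note m = N.m
  let ?V = "socle_module m \<theta> \<zeta>" and ?W = "socle_module m \<theta> \<zeta>'"
  interpret V: coord_embedding ?V \<theta> m N.g "quotient_coord m N.g"
    using N.socle_embedding by blast
  interpret W: coord_embedding ?W \<theta> m N'.g "quotient_coord m N'.g"
    using N'.socle_embedding by blast
  {
    assume "sl2_iso ?V ?W"
    then obtain \<phi> where \<phi>: "sl2_hom ?V ?W \<phi>" and bij: "bij_betw \<phi> (carrier ?V) (carrier ?W)"
      unfolding sl2_iso_iff by blast
    have "coord_unit m N.g \<in> quotient_coord m N.g ` carrier ?V"
      using N.simple_image N.socle_embedding N.core_unit by blast
    then obtain u where u: "u \<in> carrier ?V" "quotient_coord m N.g u = coord_unit m N.g"
      by auto
    \<comment> \<open>The module admits no division, so x^m 1 = g 1 is carried over as the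
      polynomial identity Q e^m u = P u.\<close>
    obtain P Q where PQ: "Q \<noteq> 0" "N.g = Fract P Q"
      by (rule Fract_cases)
    have gQ: "ratfun_of_poly Q * N.g = ratfun_of_poly P"
      using PQ(1) unfolding PQ(2) by (simp add: eq_fract)
    define emu where "emu = (act_e ?V ^^ m) u"
    have "quotient_coord m N.g (V.poly_act Q emu) = quotient_coord m N.g (V.poly_act P u)"
      using u V.e_power_coord [OF u(1), of m]
      by (simp add: emu_def x_power_m_unit [OF m N.g] scale_scale gQ)
    then have eq: "V.poly_act Q emu = V.poly_act P u"
      using V.e_power_coord [OF u(1), of m] u(1) by (subst (asm) V.eq_iff) (simp_all add: emu_def)
    have \<phi>e: "\<phi> ((act_e ?V ^^ n) u) = (act_e ?W ^^ n) (\<phi> u)" for n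
      using V.e_power_coord(1) [OF u(1)] by (induction n) (auto simp: sl2_hom_simps [OF \<phi>])
    have \<phi>u: "\<phi> u \<in> carrier ?W"
      by (rule sl2_hom_simps(1) [OF \<phi> u(1)])
    have "W.poly_act Q ((act_e ?W ^^ m) (\<phi> u)) = W.poly_act P (\<phi> u)"
      using arg_cong [OF eq, of \<phi>] V.e_power_coord(1) [OF u(1), of m] u(1)
      by (simp add: sl2_hom_poly_act [OF V.sl2_module_axioms W.sl2_module_axioms \<phi>] \<phi>e emu_def)
    define n where "n = quotient_coord m N'.g (\<phi> u)"
    have n: "n \<in> coord_module m N'.g"
      unfolding n_def by (rule W.range [OF \<phi>u])
    have "quotient_coord m N'.g (W.poly_act Q ((act_e ?W ^^ m) (\<phi> u))) =
        quotient_coord m N'.g (W.poly_act P (\<phi> u))"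
      by (simp add: \<open>W.poly_act Q ((act_e ?W ^^ m) (\<phi> u)) = W.poly_act P (\<phi> u)\<close>)
    then have "scale (ratfun_of_poly Q) (x_power (int m) n) = scale (ratfun_of_poly P) n"
      using \<phi>u W.e_power_coord [OF \<phi>u, of m] by (simp add: n_def)
    then have "scale (Fract 1 Q) (scale (ratfun_of_poly Q) (x_power (int m) n)) =
        scale (Fract 1 Q) (scale (ratfun_of_poly P) n)"
      by simp
    moreover have "Fract 1 Q * ratfun_of_poly Q = 1" "Fract 1 Q * ratfun_of_poly P = N.g"
      using PQ by (simp_all add: eq_fract mult.commute flip: ratfun_of_poly_1)
    ultimately have x_n: "x_power (int m) n = scale N.g n"
      by (simp only: scale_scale scale_1)
    have "n \<noteq> 0"
    proof
      assume "n = 0"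
      then have "\<phi> u = \<zero>\<^bsub>?W\<^esub>"
        using W.eq_zero_iff [OF \<phi>u] by (simp add: n_def)
      moreover have "\<phi> \<zero>\<^bsub>?V\<^esub> = \<zero>\<^bsub>?W\<^esub>"
        using sl2_hom_poly_act [OF V.sl2_module_axioms W.sl2_module_axioms \<phi>, of "\<zero>\<^bsub>?V\<^esub>" 0]
          sl2_hom_simps(1) [OF \<phi>, of "\<zero>\<^bsub>?V\<^esub>"] by simp
      ultimately have "u = \<zero>\<^bsub>?V\<^esub>"
        using bij u(1) by (auto simp: bij_betw_def inj_on_def)
      then show False
        using u(2) N.unit_nonzero by simp
    qed
    then obtain i where i: "i \<in> {0..<int m}" "n \<bullet> i \<noteq> 0"
      using coord_module_nonzeroE [OF m N'.g n] by blast
    have "N.g * n \<bullet> i = ratfun_shift (2 * of_int i) N'.g * ratfun_shift (2 * of_nat m) (n \<bullet> i)"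
      using x_power_period [OF m N'.g n, of i] by (simp add: x_n mult.commute)
    then have "cohomologous m N.g (ratfun_shift (2 * of_nat (nat i)) N'.g)"
      using i unfolding cohomologous_def by auto
    then have "cohomologous m N.g (g_ratfun (fst \<zeta>', rotate (m - nat i) (snd \<zeta>')))"
      using cohomologous_trans shift_g_ratfun [OF N'.\<zeta>, of "nat i"] i by auto
    then have "\<zeta> = (fst \<zeta>', rotate (m - nat i) (snd \<zeta>'))"
      using normal_form_unique [OF m N.\<zeta> rotate_Psi [OF N'.\<zeta>]] by blast
    then show "\<zeta> \<in> \<Psi>_orbit m \<omega> \<zeta>'"
      unfolding orbit_eq [OF m N'.\<zeta>] by blast
  next
    assume "\<zeta> \<in> \<Psi>_orbit m \<omega> \<zeta>'"
    then obtain k where k: "\<zeta> = (fst \<zeta>', rotate k (snd \<zeta>'))"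
      by (auto simp: orbit_eq [OF m N'.\<zeta>])
    have "length (snd \<zeta>') = m"
      using N'.\<zeta> by (auto simp: \<Psi>_def)
    then have "cohomologous m (ratfun_shift (2 * of_nat k) N.g) N'.g"
      using g_ratfun_rotate [of "snd \<zeta>'" k "fst \<zeta>'"] by (simp add: k)
    then have "cohomologous m (ratfun_shift (- 2 * of_nat k) (ratfun_shift (2 * of_nat k) N.g))
        (ratfun_shift (- 2 * of_nat k) N'.g)"
      by (rule cohomologous_shift)
    then have "cohomologous m N.g (ratfun_shift (2 * of_int (- int k)) N'.g)"
      by (simp add: ratfun_shift_shift)
    then obtain a where "a \<noteq> 0"
        "N.g * a = ratfun_shift (2 * of_int (- int k)) N'.g * ratfun_shift (2 * of_nat m) a"
      by (auto simp: cohomologous_def)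
    \<comment> \<open>Right multiplication by a x^-k places both modules in the same coordinates,
      where simplicity forces both images to be \<open>core\<close>.\<close>
    then have V': "coord_embedding ?V \<theta> m N'.g (\<lambda>v. right_mult a (- int k) (quotient_coord m N.g v))"
      by (rule embedding_right_mult [OF V.coord_embedding_axioms])
    show "sl2_iso ?V ?W"
      using sl2_iso_of_embeddings [OF V' W.coord_embedding_axioms] N'.simple_image [OF V']
        N'.simple_image [OF W.coord_embedding_axioms] N.socle_embedding N'.socle_embedding by simp
  }
qed

section \<open>Graded modules embed into coordinate modules\<close>

text \<open>
  The correspondence between a module generated generically by a homogeneous vector \<open>u\<close> and a coordinate
  module, given by \<open>e\<^sup>i u \<mapsto> x\<^sup>i\<close> and closed under division by polynomials.
\<close>

inductive matching :: "('v, 'z) sl2_struct_scheme \<Rightarrow> (int \<Rightarrow> 'v) \<Rightarrow> (int \<Rightarrow> coord) \<Rightarrow> int set \<Rightarrow> 'v \<Rightarrow> coord \<Rightarrow> bool"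
  for V w x I where
  gen: "i \<in> I \<Longrightarrow> matching V w x I (w i) (x i)"
| add: "matching V w x I v n \<Longrightarrow> matching V w x I v' n' \<Longrightarrow> matching V w x I (v \<oplus>\<^bsub>V\<^esub> v') (n + n')"
| act: "matching V w x I v n \<Longrightarrow>
    matching V w x I (p \<odot>\<^bsub>poly_h_module V\<^esub> v) (scale (ratfun_of_poly p) n)"
| divide: "p \<noteq> 0 \<Longrightarrow> v \<in> carrier V \<Longrightarrow>
    matching V w x I (p \<odot>\<^bsub>poly_h_module V\<^esub> v) (scale (ratfun_of_poly p) n) \<Longrightarrow> matching V w x I v n"

text \<open>Two polynomials a and b stand for the relation e^m u = (b/a) u, which makes sense in V
  only after clearing denominators.\<close>

locale graded_generator = sl2_module V for V :: "('v, 'z) sl2_struct_scheme" (structure) +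
  fixes \<theta> :: complex and m :: nat and u :: 'v and a b :: "complex poly"
  assumes m: "m > 0"
    and casimir: "v \<in> carrier V \<Longrightarrow> casimir V v = \<theta> \<odot> v"
    and torsion_free: "torsion_free (poly_h_module V)"
    and u: "u \<in> carrier V"
    and independent: "idom_module.independent_family (poly_h_module V)
      (\<lambda>i. (act_e V ^^ nat i) u) {0..<int m}"
    and spanning: "idom_module.generically_spanning (poly_h_module V)
      (\<lambda>i. (act_e V ^^ nat i) u) {0..<int m}"
    and ab: "a \<noteq> 0" "b \<noteq> 0" "poly_act a ((act_e V ^^ m) u) = poly_act b u"
begin

sublocale P: idom_module "poly_h_module V"
  by (rule idom_module_poly_h_module)

definition g :: ratfun where
  "g = Fract b a"

definition w :: "int \<Rightarrow> 'v" where
  "w i = (act_e V ^^ nat i) u"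

definition x :: "int \<Rightarrow> coord" where
  "x i = x_power i (coord_unit m g)"

abbreviation I :: "int set" where
  "I \<equiv> {0..<int m}"

abbreviation matched :: "'v \<Rightarrow> coord \<Rightarrow> bool" where
  "matched \<equiv> matching V w x I"

lemma g: "g \<noteq> 0"
proof
  assume "g = 0"
  moreover have "ratfun_of_poly a * g = ratfun_of_poly b"
    using ab(1) by (simp add: g_def eq_fract)
  ultimately show False
    using ab(2) by simp
qed

lemma w_closed [simp]: "w i \<in> carrier V"
proof -
  have "(act_e V ^^ n) u \<in> carrier V" for n
    using u by (induction n) auto
  then show ?thesis by (simp add: w_def)
qed

lemma torsion_freeD: "v \<in> carrier V \<Longrightarrow> p \<noteq> 0 \<Longrightarrow> poly_act p v = \<zero> \<Longrightarrow> v = \<zero>"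
  using torsion_free by (auto simp: torsion_free_def)

lemma w_independent: "finsum V (\<lambda>i. poly_act (c i) (w i)) I = \<zero> \<Longrightarrow> i \<in> I \<Longrightarrow> c i = 0"
  using independent by (simp add: P.independent_family_def w_def)

lemma w_spanning:
  assumes "v \<in> carrier V"
  obtains p c where "p \<noteq> 0" "poly_act p v = finsum V (\<lambda>i. poly_act (c i) (w i)) I"
  using spanning assms by (auto simp: P.generically_spanning_def w_def)

lemma x_module: "x i \<in> coord_module m g"
  unfolding x_def by (rule x_power_unit_module [OF m g])

lemma matched_closed: "matched v n \<Longrightarrow> v \<in> carrier V"
  by (induction rule: matching.induct) auto

lemma poly_act_finsum:
  "poly_act p (finsum V (\<lambda>i. poly_act (c i) (w i)) I) = finsum V (\<lambda>i. poly_act (p * c i) (w i)) I"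
  using P.finsum_smult_ldistr [of I p "\<lambda>i. poly_act (c i) (w i)"]
  by (simp add: poly_act_mult Pi_def)

text \<open>A matched pair has, after multiplication by one p, the same coefficients in the w i and
  in the x i. As both families are independent, the relation turns out to be functional and
  injective.\<close>

lemma matched_explicit:
  "matched v n \<Longrightarrow> \<exists>p c. p \<noteq> 0 \<and> poly_act p v = finsum V (\<lambda>i. poly_act (c i) (w i)) I \<and>
     scale (ratfun_of_poly p) n = (\<Sum>i\<in>I. scale (ratfun_of_poly (c i)) (x i))"
proof (induction rule: matching.induct)
  case (gen j)
  let ?c = "\<lambda>i. if i = j then 1 else 0 :: complex poly"
  have "finsum V (\<lambda>i. poly_act (?c i) (w i)) I = finsum V (\<lambda>i. if j = i then w i else \<zero>) I"
    by (intro M.finsum_cong') (auto simp: poly_act_1)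
  also have "\<dots> = w j"
    using gen by (intro M.add.finprod_singleton) auto
  finally have 1: "poly_act 1 (w j) = finsum V (\<lambda>i. poly_act (?c i) (w i)) I"
    by (simp add: poly_act_1)
  have "(\<Sum>i\<in>I. scale (ratfun_of_poly (?c i)) (x i)) = (\<Sum>i\<in>{j}. scale (ratfun_of_poly (?c i)) (x i))"
    by (rule sum.mono_neutral_right) (use gen in auto)
  then have 2: "scale (ratfun_of_poly 1) (x j) = (\<Sum>i\<in>I. scale (ratfun_of_poly (?c i)) (x i))"
    by simp
  show ?case
    using 1 2 by (intro exI [of _ "1 :: complex poly"] exI [of _ ?c]) simp
next
  case (add v n v' n')
  obtain p c p' c' where *: "p \<noteq> 0" "poly_act p v = finsum V (\<lambda>i. poly_act (c i) (w i)) I"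
      "scale (ratfun_of_poly p) n = (\<Sum>i\<in>I. scale (ratfun_of_poly (c i)) (x i))"
      "p' \<noteq> 0" "poly_act p' v' = finsum V (\<lambda>i. poly_act (c' i) (w i)) I"
      "scale (ratfun_of_poly p') n' = (\<Sum>i\<in>I. scale (ratfun_of_poly (c' i)) (x i))"
    using add by blast
  note cl = matched_closed [OF add.hyps(1)] matched_closed [OF add.hyps(2)]
  let ?c = "\<lambda>i. p' * c i + p * c' i"
  have "poly_act (p * p') (v \<oplus> v') = poly_act p' (poly_act p v) \<oplus> poly_act p (poly_act p' v')"
    using cl by (simp add: poly_act_add_right poly_act_mult) (metis mult.commute poly_act_mult)
  also have "\<dots> = finsum V (\<lambda>i. poly_act (p' * c i) (w i)) I \<oplus> finsum V (\<lambda>i. poly_act (p * c' i) (w i)) I"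
    by (simp only: * poly_act_finsum)
  also have "\<dots> = finsum V (\<lambda>i. poly_act (?c i) (w i)) I"
    by (simp add: poly_act_add M.finsum_addf Pi_def)
  finally have 1: "poly_act (p * p') (v \<oplus> v') = finsum V (\<lambda>i. poly_act (?c i) (w i)) I" .
  have "scale (ratfun_of_poly (p * p')) (n + n') =
      scale (ratfun_of_poly p') (scale (ratfun_of_poly p) n) + scale (ratfun_of_poly p) (scale (ratfun_of_poly p') n')"
    unfolding ratfun_of_poly_mult scale_scale scale_add by (simp only: mult.commute)
  also have "\<dots> = (\<Sum>i\<in>I. scale (ratfun_of_poly (?c i)) (x i))"
    unfolding * scale_sum scale_scale ratfun_of_poly_add scale_add_left ratfun_of_poly_mult sum.distrib ..
  finally show ?case
    using 1 * by (intro exI [of _ "p * p'"] exI [of _ ?c]) simp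
next
  case (act v n q)
  then obtain p c where *: "p \<noteq> 0" "poly_act p v = finsum V (\<lambda>i. poly_act (c i) (w i)) I"
      "scale (ratfun_of_poly p) n = (\<Sum>i\<in>I. scale (ratfun_of_poly (c i)) (x i))"
    by blast
  have "poly_act p (poly_act q v) = poly_act q (poly_act p v)"
    using matched_closed [OF act.hyps] by (metis mult.commute poly_act_mult)
  then have 1: "poly_act p (poly_act q v) = finsum V (\<lambda>i. poly_act (q * c i) (w i)) I"
    by (simp only: * poly_act_finsum)
  have "scale (ratfun_of_poly p) (scale (ratfun_of_poly q) n) =
      scale (ratfun_of_poly q) (scale (ratfun_of_poly p) n)"
    unfolding scale_scale by (simp only: mult.commute)
  then have 2: "scale (ratfun_of_poly p) (scale (ratfun_of_poly q) n) =
      (\<Sum>i\<in>I. scale (ratfun_of_poly (q * c i)) (x i))"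
    unfolding * scale_sum scale_scale ratfun_of_poly_mult .
  show ?case
    using * 1 2 by (intro exI [of _ p] exI [of _ "\<lambda>i. q * c i"]) simp
next
  case (divide q v n)
  then obtain p c where *: "p \<noteq> 0" "poly_act p (poly_act q v) = finsum V (\<lambda>i. poly_act (c i) (w i)) I"
      "scale (ratfun_of_poly p) (scale (ratfun_of_poly q) n) = (\<Sum>i\<in>I. scale (ratfun_of_poly (c i)) (x i))"
    by blast
  have "poly_act (p * q) v = finsum V (\<lambda>i. poly_act (c i) (w i)) I"
    using divide * by (simp add: poly_act_mult)
  moreover have "scale (ratfun_of_poly (p * q)) n = (\<Sum>i\<in>I. scale (ratfun_of_poly (c i)) (x i))"
    using * unfolding scale_scale ratfun_of_poly_mult by simp
  ultimately show ?case
    using * divide by (intro exI [of _ "p * q"] exI [of _ c]) simp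
qed

lemma x_independent:
  assumes "(\<Sum>i\<in>I. scale (ratfun_of_poly (c i)) (x i)) = 0" "j \<in> I"
  shows "c j = 0"
  using x_power_unit_sum_at [OF m g assms(2), of "\<lambda>i. ratfun_of_poly (c i)"] assms(1)
  by (simp add: x_def)

lemma matched_zero: "matched \<zero> 0"
  using matching.act [OF matching.gen [of 0 I V w x], of 0] m by simp

lemma matched_sum:
  assumes "finite J" "J \<subseteq> I"
  shows "matched (finsum V (\<lambda>i. poly_act (c i) (w i)) J) (\<Sum>i\<in>J. scale (ratfun_of_poly (c i)) (x i))"
  using assms
proof (induction J)
  case empty
  then show ?case using matched_zero by simp
next
  case (insert i J)
  then have "matched (poly_act (c i) (w i) \<oplus> finsum V (\<lambda>i. poly_act (c i) (w i)) J)
      (scale (ratfun_of_poly (c i)) (x i) + (\<Sum>i\<in>J. scale (ratfun_of_poly (c i)) (x i)))"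
    by (intro matching.add matching.act matching.gen) auto
  then show ?case
    using insert by (simp add: Pi_def)
qed

text \<open>Generic spanning expresses a multiple p v in the w i; the same combination of the x i
  can be divided by p in coordinates.\<close>

lemma matched_total:
  assumes v: "v \<in> carrier V"
  obtains n where "matched v n"
proof -
  obtain p c where pc: "p \<noteq> 0" "poly_act p v = finsum V (\<lambda>i. poly_act (c i) (w i)) I"
    using w_spanning [OF v] .
  define n where "n = scale (Fract 1 p) (\<Sum>i\<in>I. scale (ratfun_of_poly (c i)) (x i))"
  have "ratfun_of_poly p * Fract 1 p = 1"
    using pc(1) ratfun_of_poly_eq_iff [of 1 1] by (simp add: eq_fract flip: ratfun_of_poly_1)
  then have "scale (ratfun_of_poly p) n = (\<Sum>i\<in>I. scale (ratfun_of_poly (c i)) (x i))"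
    by (simp only: n_def scale_scale scale_1)
  then have "matched (poly_act p v) (scale (ratfun_of_poly p) n)"
    using matched_sum [of I c] pc by simp
  then have "matched v n"
    by (rule matching.divide [OF pc(1) v])
  then show ?thesis by (rule that)
qed

lemma matched_zero_left: "matched \<zero> n \<Longrightarrow> n = 0"
proof -
  assume "matched \<zero> n"
  then obtain p c where *: "p \<noteq> 0" "poly_act p \<zero> = finsum V (\<lambda>i. poly_act (c i) (w i)) I"
     "scale (ratfun_of_poly p) n = (\<Sum>i\<in>I. scale (ratfun_of_poly (c i)) (x i))"
    using matched_explicit by blast
  have "c i = 0" if "i \<in> I" for i
    by (rule w_independent [OF _ that]) (simp add: *(2) [symmetric])
  then have "scale (ratfun_of_poly p) n = 0"
    unfolding *(3) by (intro sum.neutral ballI) simp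
  then show "n = 0"
    using *(1) by (simp add: scale_eq_0_iff)
qed

lemma matched_zero_right: "matched v 0 \<Longrightarrow> v = \<zero>"
proof -
  assume v: "matched v 0"
  then obtain p c where *: "p \<noteq> 0" "poly_act p v = finsum V (\<lambda>i. poly_act (c i) (w i)) I"
     "scale (ratfun_of_poly p) 0 = (\<Sum>i\<in>I. scale (ratfun_of_poly (c i)) (x i))"
    using matched_explicit by blast
  have "c i = 0" if "i \<in> I" for i
    by (rule x_independent [OF _ that]) (simp add: *(3) [symmetric])
  then have "poly_act p v = \<zero>"
    unfolding *(2) by (intro M.add.finprod_one_eqI) simp
  then show "v = \<zero>"
    using *(1) torsion_freeD matched_closed [OF v] by blast
qed

lemma matched_diff:
  assumes "matched v n" "matched v' n'"
  shows "matched (v \<ominus> v') (n - n')"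
proof -
  note cl = matched_closed [OF assms(1)] matched_closed [OF assms(2)]
  have "matched (v \<oplus> poly_act [:-1:] v') (n + scale (ratfun_of_poly [:-1:]) n')"
    by (intro matching.add matching.act assms)
  moreover have "v \<oplus> poly_act [:-1:] v' = v \<ominus> v'"
    using cl by (simp add: a_minus_def minus_eq_smult poly_act_const)
  moreover have "n + scale (ratfun_of_poly [:-1:]) n' = n - n'"
    using ratfun_of_poly_uminus [of "[:1:]"] by (intro coord_eqI) simp
  ultimately show ?thesis by simp
qed

lemma matched_unique: "matched v n \<Longrightarrow> matched v n' \<Longrightarrow> n = n'"
  using matched_diff [of v n v n'] matched_zero_left [of "n - n'"] matched_closed [of v n]
  by (simp add: M.r_neg a_minus_def)

lemma matched_inj: "matched v n \<Longrightarrow> matched v' n \<Longrightarrow> v = v'"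
  using matched_diff [of v n v' n] matched_zero_right [of "v \<ominus> v'"] matched_closed [of v n]
    matched_closed [of v' n] by simp

lemma matched_module:
  assumes "matched v n"
  shows "n \<in> coord_module m g"
proof -
  obtain p c where *: "p \<noteq> 0"
     "scale (ratfun_of_poly p) n = (\<Sum>i\<in>I. scale (ratfun_of_poly (c i)) (x i))"
    using matched_explicit [OF assms] by blast
  have "Fract 1 p * ratfun_of_poly p = 1"
    using *(1) by (simp add: eq_fract flip: ratfun_of_poly_1)
  then have "n = scale (Fract 1 p) (scale (ratfun_of_poly p) n)"
    by (simp only: scale_scale scale_1)
  also have "\<dots> \<in> coord_module m g"
    unfolding * by (intro coord_module_scale coord_module_sum x_module)
  finally show ?thesis .
qed

lemma x_m: "scale (ratfun_of_poly a) (x (int m)) = scale (ratfun_of_poly b) (x 0)"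
proof -
  have "ratfun_of_poly a * g = ratfun_of_poly b"
    using ab(1) by (simp add: g_def eq_fract)
  then show ?thesis
    by (simp add: x_def x_power_m_unit [OF m g] scale_scale)
qed

text \<open>The exponent m lies just outside the range of generators. Both sides satisfy the same
  relation with a and b to exponent 0, and the rule \<open>divide\<close> removes a.\<close>

lemma matched_m: "matched (w (int m)) (x (int m))"
proof (rule matching.divide [OF ab(1)])
  have "matched (poly_act b (w 0)) (scale (ratfun_of_poly b) (x 0))"
    using m by (intro matching.act matching.gen) simp
  moreover have "w 0 = u"
    by (simp add: w_def)
  moreover have "poly_act a (w (int m)) = poly_act b u"
    using ab(3) by (simp add: w_def)
  ultimately show "matched (poly_act a (w (int m))) (scale (ratfun_of_poly a) (x (int m)))"
    by (simp add: x_m)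
qed simp

lemma e_w: "i \<ge> 0 \<Longrightarrow> act_e V (w i) = w (i + 1)"
  by (simp add: w_def nat_add_distrib)

lemma coord_e_x: "coord_e (x i) = x (i + 1)"
  by (simp add: coord_e_def x_def x_power_x_power add.commute)

lemma matched_next: "i \<in> I \<Longrightarrow> matched (w (i + 1)) (x (i + 1))"
  using matched_m by (cases "i + 1 = int m") (auto intro: matching.gen)

lemma matched_e: "matched v n \<Longrightarrow> matched (act_e V v) (coord_e n)"
proof (induction rule: matching.induct)
  case (gen i)
  then show ?case
    using matched_next [OF gen] by (simp add: e_w coord_e_x)
next
  case (add v n v' n')
  then show ?case
    using matching.add [OF add.IH] matched_closed by (simp add: coord_e_def x_power_add)
next
  case (act v n p)
  then show ?case
    using matching.act [OF act.IH] matched_closed by (simp add: e_poly_act coord_e_scale)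
next
  case (divide p v n)
  then have *: "matched (poly_act (pcompose p [:-2, 1:]) (act_e V v))
      (scale (ratfun_of_poly (pcompose p [:-2, 1:])) (coord_e n))"
    by (simp add: e_poly_act coord_e_scale)
  have "pcompose p [:-2, 1:] \<noteq> 0"
    using divide(1) pcompose_shift_eq_0_iff [of p 2] by simp
  then show ?case
    by (rule matching.divide [OF _ e_simps(1) [OF divide(2)] *])
qed

text \<open>By the Casimir equation f undoes e up to \<open>fe_poly\<close>, in V as well as in
  coordinates.\<close>

lemma matched_f_next:
  assumes "i \<in> I"
  shows "matched (act_f V (w (i + 1))) (coord_f \<theta> (x (i + 1)))"
proof -
  have "act_f V (w (i + 1)) = poly_act (fe_poly \<theta>) (w i)"
    using assms f_e [OF w_closed casimir, of i] by (simp add: e_w)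
  moreover have "coord_f \<theta> (x (i + 1)) = scale (ratfun_of_poly (fe_poly \<theta>)) (x i)"
    by (simp add: coord_e_x [symmetric] coord_f_e)
  ultimately show ?thesis
    using assms by (simp add: matching.gen matching.act)
qed

lemma matched_f: "matched v n \<Longrightarrow> matched (act_f V v) (coord_f \<theta> n)"
proof (induction rule: matching.induct)
  case (gen i)
  show ?case
  proof (cases "i = 0")
    case True
    \<comment> \<open>u need not be of the form e v, so f u is reached from above: apply f to a e^m
      u = b u and divide by the shifted b.\<close>
    have "matched (act_f V (w (int m))) (coord_f \<theta> (x (int m)))"
      using matched_f_next [of "int m - 1"] m by simp
    then have "matched (poly_act (pcompose a [:2, 1:]) (act_f V (w (int m))))
        (scale (ratfun_of_poly (pcompose a [:2, 1:])) (coord_f \<theta> (x (int m))))"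
      by (rule matching.act)
    then have "matched (act_f V (poly_act a (w (int m)))) (coord_f \<theta> (scale (ratfun_of_poly a) (x (int m))))"
      by (simp add: f_poly_act coord_f_scale)
    moreover have "poly_act a (w (int m)) = poly_act b (w 0)"
      using ab(3) by (simp add: w_def)
    ultimately have *: "matched (poly_act (pcompose b [:2, 1:]) (act_f V (w 0)))
        (scale (ratfun_of_poly (pcompose b [:2, 1:])) (coord_f \<theta> (x 0)))"
      by (simp add: f_poly_act coord_f_scale x_m)
    have "pcompose b [:2, 1:] \<noteq> 0"
      using ab(2) pcompose_shift_eq_0_iff [of b "-2"] by simp
    then show ?thesis
      unfolding True by (rule matching.divide [OF _ f_simps(1) [OF w_closed] *])
  next
    case False
    then show ?thesis
      using matched_f_next [of "i - 1"] gen by simp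
  qed
next
  case (add v n v' n')
  then show ?case
    using matching.add [OF add.IH] matched_closed by (simp add: coord_f_def x_power_add scale_add)
next
  case (act v n p)
  then show ?case
    using matching.act [OF act.IH] matched_closed by (simp add: f_poly_act coord_f_scale)
next
  case (divide p v n)
  then have *: "matched (poly_act (pcompose p [:2, 1:]) (act_f V v))
      (scale (ratfun_of_poly (pcompose p [:2, 1:])) (coord_f \<theta> n))"
    by (simp add: f_poly_act coord_f_scale)
  have "pcompose p [:2, 1:] \<noteq> 0"
    using divide(1) pcompose_shift_eq_0_iff [of p "-2"] by simp
  then show ?case
    by (rule matching.divide [OF _ f_simps(1) [OF divide(2)] *])
qed

definition \<kappa> :: "'v \<Rightarrow> coord" where
  "\<kappa> v = (THE n. matched v n)"

lemma matched_\<kappa>: "v \<in> carrier V \<Longrightarrow> matched v (\<kappa> v)"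
  unfolding \<kappa>_def by (rule theI') (metis matched_total matched_unique)

lemma \<kappa>_eqI: "matched v n \<Longrightarrow> \<kappa> v = n"
  using matched_\<kappa> matched_closed matched_unique by blast

lemma \<kappa>_w: "i \<in> I \<Longrightarrow> \<kappa> (w i) = x i"
  by (intro \<kappa>_eqI matching.gen)

lemma embedding: "coord_embedding V \<theta> m g \<kappa>"
proof unfold_locales
  show "inj_on \<kappa> (carrier V)"
    by (rule inj_onI) (metis matched_\<kappa> matched_inj)
  fix v assume v: "v \<in> carrier V"
  show "\<kappa> v \<in> coord_module m g"
    using matched_module matched_\<kappa> [OF v] by blast
  show "\<kappa> (c \<odot> v) = scale (ratfun_of_poly [:c:]) (\<kappa> v)" for c
    using matching.act [OF matched_\<kappa> [OF v], of "[:c:]"] v by (intro \<kappa>_eqI) (simp add: poly_act_const)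
  show "\<kappa> (act_e V v) = coord_e (\<kappa> v)" "\<kappa> (act_f V v) = coord_f \<theta> (\<kappa> v)"
    using v by (simp_all add: \<kappa>_eqI matched_e matched_f matched_\<kappa>)
  show "\<kappa> (act_h V v) = coord_h (\<kappa> v)"
    using matching.act [OF matched_\<kappa> [OF v], of "[:0, 1:]"] v
    by (intro \<kappa>_eqI) (simp add: poly_act_h coord_h_def)
  fix v' assume v': "v' \<in> carrier V"
  show "\<kappa> (v \<oplus> v') = \<kappa> v + \<kappa> v'"
    using v v' by (intro \<kappa>_eqI matching.add matched_\<kappa>)
qed

text \<open>Carries an eigenvector found in the coordinates back to V, at the price of a polynomial
  factor clearing its denominators.\<close>

lemma image_generic:
  assumes "n \<in> coord_module m g"
  obtains p v where "p \<noteq> 0" "v \<in> carrier V" "\<kappa> v = scale (ratfun_of_poly p) n"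
proof -
  obtain p c where pc: "p \<noteq> 0" "\<And>i. i \<in> I \<Longrightarrow> n \<bullet> i = Fract (c i) p"
    using P.common_denominator [of I "\<lambda>i. n \<bullet> i"] by auto
  have "scale (ratfun_of_poly p) n = (\<Sum>i\<in>I. scale (ratfun_of_poly p) (scale (n \<bullet> i) (x i)))"
    unfolding scale_sum [symmetric] x_def using coord_expansion [OF m g assms] by simp
  also have "\<dots> = (\<Sum>i\<in>I. scale (ratfun_of_poly (c i)) (x i))"
  proof (rule sum.cong)
    fix i assume "i \<in> I"
    then have "ratfun_of_poly p * n \<bullet> i = ratfun_of_poly (c i)"
      using pc by (simp add: eq_fract)
    then show "scale (ratfun_of_poly p) (scale (n \<bullet> i) (x i)) = scale (ratfun_of_poly (c i)) (x i)"
      by (simp only: scale_scale)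
  qed simp
  finally have "matched (finsum V (\<lambda>i. poly_act (c i) (w i)) I) (scale (ratfun_of_poly p) n)"
    using matched_sum [of I c] by simp
  then show ?thesis
    using that pc(1) \<kappa>_eqI matched_closed by blast
qed

text \<open>An eigenspace of a nonscalar right multiplication would be a proper nonzero submodule.\<close>

lemma no_period:
  assumes simple: "sl2_simple V" and j: "0 < j" "j < int m"
  shows "\<not> cohomologous m g (ratfun_shift (2 * of_int j) g)"
proof
  assume "cohomologous m g (ratfun_shift (2 * of_int j) g)"
  then obtain c where c: "c \<noteq> 0" "g * c = ratfun_shift (2 * of_int j) g * ratfun_shift (2 * of_nat m) c"
    by (auto simp: cohomologous_def)
  obtain \<rho> n where n: "n \<in> coord_module m g" "n \<noteq> 0"
      "right_mult c j n = scale (ratfun_of_poly [:\<rho>:]) n"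
      "right_mult c j (coord_unit m g) \<noteq> scale (ratfun_of_poly [:\<rho>:]) (coord_unit m g)"
    using right_mult_eigenvector [OF m g c(1) j c(2)] .
  interpret E: coord_embedding V \<theta> m g \<kappa>
    by (rule embedding)
  let ?E = "{v. right_mult c j v = scale (ratfun_of_poly [:\<rho>:]) v}"
  have comm: "scale (ratfun_of_poly [:\<rho>:]) (scale r v) = scale r (scale (ratfun_of_poly [:\<rho>:]) v)" for r v
    unfolding scale_scale by (simp only: mult.commute)
  \<comment> \<open>Right multiplication commutes with the left action, and the constant \<rho> is
    fixed by \<sigma>.\<close>
  have "stable \<theta> ?E"
    unfolding stable_def coord_e_def coord_f_def coord_h_def
    by (auto simp: right_mult_add right_mult_scale right_mult_x_power scale_add comm x_power_scale
        ratfun_shift_const)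
  then have "sl2_submodule {v \<in> carrier V. \<kappa> v \<in> ?E} V"
    by (rule E.sl2_submodule_preimage)
  moreover obtain p v where v: "p \<noteq> 0" "v \<in> carrier V" "\<kappa> v = scale (ratfun_of_poly p) n"
    using image_generic [OF n(1)] .
  have "v \<in> {v \<in> carrier V. \<kappa> v \<in> ?E}"
    using v n(3) by (simp add: right_mult_scale comm)
  moreover have "\<kappa> v \<noteq> 0"
    using v n(2) by (simp add: scale_eq_0_iff)
  then have "v \<noteq> \<zero>"
    by auto
  ultimately have "{v \<in> carrier V. \<kappa> v \<in> ?E} = carrier V"
    using simple unfolding sl2_simple_def by blast
  then have "\<kappa> (w 0) \<in> ?E"
    using w_closed by blast
  then show False
    using n(4) m by (simp add: \<kappa>_w x_def)
qed

lemma aperiodic_g: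
  assumes simple: "sl2_simple V"
  shows "aperiodic m g"
proof -
  have "\<not> cohomologous m (ratfun_shift (2 * of_int i) g) (ratfun_shift (2 * of_int j) g)"
    if ij: "i \<in> I" "j \<in> I" "i < j" for i j
  proof
    assume "cohomologous m (ratfun_shift (2 * of_int i) g) (ratfun_shift (2 * of_int j) g)"
    then have "cohomologous m (ratfun_shift (- 2 * of_int i) (ratfun_shift (2 * of_int i) g))
        (ratfun_shift (- 2 * of_int i) (ratfun_shift (2 * of_int j) g))"
      by (rule cohomologous_shift)
    moreover have "- 2 * of_int i + 2 * of_int j = (2 * of_int (j - i) :: complex)"
      by simp
    ultimately have "cohomologous m g (ratfun_shift (2 * of_int (j - i)) g)"
      by (simp only: ratfun_shift_shift) simp
    then show False
      using no_period [OF simple, of "j - i"] ij by simp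
  qed
  then show ?thesis
    unfolding aperiodic_def by (metis cohomologous_sym linorder_neqE)
qed

end

section \<open>From a graded simple module to its parameter\<close>

lemma aperiodic_cohomologous:
  assumes "aperiodic m g" "cohomologous m g g'"
  shows "aperiodic m g'"
  unfolding aperiodic_def
proof (intro ballI impI)
  fix i j assume ij: "i \<in> {0..<int m}" "j \<in> {0..<int m}"
    "cohomologous m (ratfun_shift (2 * of_int i) g') (ratfun_shift (2 * of_int j) g')"
  have "cohomologous m (ratfun_shift (2 * of_int i) g) (ratfun_shift (2 * of_int j) g)"
    using cohomologous_trans [OF cohomologous_trans [OF cohomologous_shift [OF assms(2)] ij(3)]
        cohomologous_sym [OF cohomologous_shift [OF assms(2)]]] .
  then show "i = j"
    using assms(1) ij unfolding aperiodic_def by blast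
qed

text \<open>f e acts by a nonzero polynomial, so e is injective and moves a nonzero homogeneous
  vector into degree 0. Then the e^i u for i < m lie in distinct components, hence are independent
  and, the rank being m, span generically. As e^m u has degree 0 again, only u occurs in its
  expansion.\<close>

lemma graded_generator_exists:
  assumes m: "m > 0" and V: "graded_simple_of_rank m \<theta> V"
  obtains u a b where "graded_generator V \<theta> m u a b"
proof -
  let ?I = "{0..<int m}"
  have simple: "sl2_simple V" and cas: "\<And>v. v \<in> carrier V \<Longrightarrow> casimir V v = \<theta> \<odot>\<^bsub>V\<^esub> v"
    and tf: "torsion_free (poly_h_module V)" and rank: "has_rank (poly_h_module V) m"
    using V by (auto simp: graded_simple_of_rank_def)
  obtain W where W: "is_cyclic_grading m V W"
    using V by (auto simp: graded_simple_of_rank_def admits_cyclic_grading_def)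
  interpret V: sl2_module V
    using simple by (simp add: sl2_simple_def)
  interpret P: idom_module "poly_h_module V"
    by (rule V.idom_module_poly_h_module)
  have Wsub: "W i \<subseteq> carrier V" "\<zero>\<^bsub>V\<^esub> \<in> W i" "\<And>v w. v \<in> W i \<Longrightarrow> w \<in> W i \<Longrightarrow> v \<oplus>\<^bsub>V\<^esub> w \<in> W i"
      "\<And>c v. v \<in> W i \<Longrightarrow> c \<odot>\<^bsub>V\<^esub> v \<in> W i" "\<And>v. v \<in> W i \<Longrightarrow> act_h V v \<in> W i"
      "\<And>v. v \<in> W i \<Longrightarrow> act_e V v \<in> W ((i + 1) mod int m)" if "i \<in> ?I" for i
  proof -
    have sub: "Module.submodule (W i) complex_ring V"
      and act: "act_h V ` W i \<subseteq> W i" "act_e V ` W i \<subseteq> W ((i + 1) mod int m)"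
      using W that unfolding is_cyclic_grading_def by blast+
    note sub = sub [unfolded V.submodule_iff]
    show "W i \<subseteq> carrier V" "\<zero>\<^bsub>V\<^esub> \<in> W i" "\<And>v w. v \<in> W i \<Longrightarrow> w \<in> W i \<Longrightarrow> v \<oplus>\<^bsub>V\<^esub> w \<in> W i"
      "\<And>c v. v \<in> W i \<Longrightarrow> c \<odot>\<^bsub>V\<^esub> v \<in> W i"
      using sub by simp_all
    show "\<And>v. v \<in> W i \<Longrightarrow> act_h V v \<in> W i" "\<And>v. v \<in> W i \<Longrightarrow> act_e V v \<in> W ((i + 1) mod int m)"
      using act by auto
  qed
  have Wact: "V.poly_act p v \<in> W i" if "i \<in> ?I" "v \<in> W i" for p v i
    using that Wsub by (induction p) (auto simp: V.poly_act_pCons subset_iff)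
  have decomposition: "\<forall>v\<in>carrier V. \<exists>!t. t \<in> PiE ?I W \<and> v = finsum V t ?I"
    using W unfolding is_cyclic_grading_def by (rule conjunct2)
  have unique: "y i = z i"
    if "y \<in> PiE ?I W" "z \<in> PiE ?I W" "finsum V y ?I = finsum V z ?I" for y z i
  proof -
    have "finsum V y ?I \<in> carrier V"
      using that(1) Wsub(1) by (intro V.M.finsum_closed) (blast dest: PiE_mem)
    then have "\<exists>!t. t \<in> PiE ?I W \<and> finsum V y ?I = finsum V t ?I"
      by (rule bspec [OF decomposition])
    then have "y = z"
      using that by blast
    then show ?thesis by simp
  qed
  have tfD: "v = \<zero>\<^bsub>V\<^esub>" if "v \<in> carrier V" "p \<noteq> 0" "V.poly_act p v = \<zero>\<^bsub>V\<^esub>" for v p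
    using tf that by (auto simp: torsion_free_def)
  have e_inj: "act_e V v \<noteq> \<zero>\<^bsub>V\<^esub>" if "v \<in> carrier V" "v \<noteq> \<zero>\<^bsub>V\<^esub>" for v
  proof
    assume "act_e V v = \<zero>\<^bsub>V\<^esub>"
    then have "V.poly_act (fe_poly \<theta>) v = \<zero>\<^bsub>V\<^esub>"
      using V.f_e [OF that(1) cas [OF that(1)]] by simp
    then show False
      using tfD [OF that(1) fe_poly_nonzero] that(2) by blast
  qed
  have e_pow: "(act_e V ^^ n) v \<in> W ((i + int n) mod int m) \<and> (act_e V ^^ n) v \<noteq> \<zero>\<^bsub>V\<^esub>"
    if "i \<in> ?I" "v \<in> W i" "v \<noteq> \<zero>\<^bsub>V\<^esub>" for n v i
  proof (induction n)
    case 0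
    then show ?case using that by simp
  next
    case (Suc n)
    have r: "(i + int n) mod int m \<in> ?I"
      using m by simp
    then have "act_e V ((act_e V ^^ n) v) \<in> W (((i + int n) mod int m + 1) mod int m)"
      using Wsub(6) Suc by blast
    moreover have "((i + int n) mod int m + 1) mod int m = (i + int (Suc n)) mod int m"
      by (metis (no_types) add.assoc mod_add_left_eq of_nat_Suc add.commute)
    ultimately show ?case
      using e_inj Suc Wsub(1) [OF r] by auto
  qed
  obtain u where u: "u \<in> W 0" "u \<noteq> \<zero>\<^bsub>V\<^esub>"
  proof -
    have "\<zero>\<^bsub>V\<^esub> \<in> carrier V"
      by simp
    then obtain v where v: "v \<in> carrier V" "v \<noteq> \<zero>\<^bsub>V\<^esub>"
      using simple unfolding sl2_simple_def by blast
    then obtain y where y: "y \<in> PiE ?I W" "v = finsum V y ?I"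
      using bspec [OF decomposition v(1)] by blast
    have "\<exists>i\<in>?I. y i \<noteq> \<zero>\<^bsub>V\<^esub>"
    proof (rule ccontr)
      assume "\<not> ?thesis"
      then have "finsum V y ?I = \<zero>\<^bsub>V\<^esub>"
        by (intro V.M.add.finprod_one_eqI) auto
      then show False using v y by simp
    qed
    then obtain i where i: "i \<in> ?I" "y i \<noteq> \<zero>\<^bsub>V\<^esub>" by blast
    have "(act_e V ^^ nat (int m - i)) (y i) \<in> W 0 \<and> (act_e V ^^ nat (int m - i)) (y i) \<noteq> \<zero>\<^bsub>V\<^esub>"
      using e_pow [OF i(1) PiE_mem [OF y(1) i(1)] i(2), of "nat (int m - i)"] i(1) by simp
    then show ?thesis using that by blast
  qed
  have 0: "0 \<in> ?I"
    using m by simp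
  define w where "w = (\<lambda>i. (act_e V ^^ nat i) u)"
  have w: "w i \<in> W i" "w i \<noteq> \<zero>\<^bsub>V\<^esub>" if "i \<in> ?I" for i
    using e_pow [OF 0 u, of "nat i"] that by (auto simp: w_def)
  have wc: "w i \<in> carrier V" if "i \<in> ?I" for i
    using w(1) Wsub(1) that by blast
  have zeroes: "finsum V (\<lambda>i\<in>?I. \<zero>\<^bsub>V\<^esub>) ?I = \<zero>\<^bsub>V\<^esub>"
    by (intro V.M.add.finprod_one_eqI) auto
  have restr: "finsum V (\<lambda>i\<in>?I. t i) ?I = finsum V t ?I" if "\<And>i. i \<in> ?I \<Longrightarrow> t i \<in> carrier V" for t
    using that by (intro V.M.finsum_cong') auto
  have indep: "P.independent_family w ?I"
    unfolding P.independent_family_def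
  proof (intro allI impI ballI)
    fix c j assume "finsum (poly_h_module V) (\<lambda>i. V.poly_act (c i) (w i)) ?I = \<zero>\<^bsub>poly_h_module V\<^esub>"
      and j: "j \<in> ?I"
    then have "finsum V (\<lambda>i. V.poly_act (c i) (w i)) ?I = \<zero>\<^bsub>V\<^esub>"
      by simp
    moreover have "finsum V (\<lambda>i\<in>?I. V.poly_act (c i) (w i)) ?I = finsum V (\<lambda>i. V.poly_act (c i) (w i)) ?I"
      by (rule restr) (simp add: wc)
    ultimately have eq: "finsum V (\<lambda>i\<in>?I. V.poly_act (c i) (w i)) ?I = finsum V (\<lambda>i\<in>?I. \<zero>\<^bsub>V\<^esub>) ?I"
      by (simp only: zeroes)
    have "(\<lambda>i\<in>?I. V.poly_act (c i) (w i)) j = (\<lambda>i\<in>?I. \<zero>\<^bsub>V\<^esub>) j"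
      by (rule unique [OF _ _ eq]) (auto intro: Wact w(1) Wsub(2))
    then have "V.poly_act (c j) (w j) = \<zero>\<^bsub>V\<^esub>"
      using j by simp
    then show "c j = 0"
      using tfD [OF wc [OF j]] w(2) [OF j] by blast
  qed
  have span: "P.generically_spanning w ?I"
    using rank by (intro P.generically_spanningI tf indep) (auto simp: wc)
  have em: "(act_e V ^^ m) u \<in> W 0" "(act_e V ^^ m) u \<noteq> \<zero>\<^bsub>V\<^esub>"
    using e_pow [OF 0 u, of m] by auto
  then have emc: "(act_e V ^^ m) u \<in> carrier V"
    using Wsub(1) [OF 0] by blast
  obtain a c where ac: "a \<noteq> 0" "V.poly_act a ((act_e V ^^ m) u) = finsum V (\<lambda>i. V.poly_act (c i) (w i)) ?I"
    using span emc by (auto simp: P.generically_spanning_def)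
  \<comment> \<open>Both sides are written as families over all degrees, so that uniqueness of the
    decomposition compares their components at 0.\<close>
  let ?y = "\<lambda>i\<in>?I. if 0 = i then V.poly_act a ((act_e V ^^ m) u) else \<zero>\<^bsub>V\<^esub>"
  have "finsum V ?y ?I = finsum V (\<lambda>i. if 0 = i then V.poly_act a ((act_e V ^^ m) u) else \<zero>\<^bsub>V\<^esub>) ?I"
    using emc by (intro restr) auto
  also have "\<dots> = V.poly_act a ((act_e V ^^ m) u)"
    using 0 emc by (intro V.M.add.finprod_singleton) auto
  also have "\<dots> = finsum V (\<lambda>i\<in>?I. V.poly_act (c i) (w i)) ?I"
    unfolding ac(2) by (rule restr [symmetric]) (simp add: wc)
  finally have eq: "finsum V ?y ?I = finsum V (\<lambda>i\<in>?I. V.poly_act (c i) (w i)) ?I" .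
  have "?y 0 = (\<lambda>i\<in>?I. V.poly_act (c i) (w i)) 0"
    by (rule unique [OF _ _ eq]) (simp_all add: PiE_def Pi_def Wact em(1) w(1) Wsub(2))
  then have a: "V.poly_act a ((act_e V ^^ m) u) = V.poly_act (c 0) u"
    using 0 by (simp add: w_def)
  have uc: "u \<in> carrier V"
    using u(1) Wsub(1) [OF 0] by blast
  have "c 0 \<noteq> 0"
  proof
    assume "c 0 = 0"
    then have "V.poly_act a ((act_e V ^^ m) u) = \<zero>\<^bsub>V\<^esub>"
      using a uc by simp
    then show False
      using tfD [OF emc ac(1)] em(2) by blast
  qed
  have "graded_generator V \<theta> m u a (c 0)"
    by unfold_locales (use m cas tf uc indep span ac(1) \<open>c 0 \<noteq> 0\<close> a in \<open>auto simp: w_def\<close>)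
  then show ?thesis by (rule that)
qed

text \<open>The g found for V is only cohomologous to a normal form. Right multiplication by the
  witness c moves V into the coordinates of the normal form, where its image is \<open>core\<close>,
  like that of the socle.\<close>

lemma graded_simple_iso_socle:
  assumes m: "m > 0" and roots: "\<And>z. poly (fe_poly \<theta>) z = 0 \<Longrightarrow> Re z < \<omega>"
    and V: "graded_simple_of_rank m \<theta> V"
  obtains \<zeta> where "is_regular m \<omega> \<zeta>" "sl2_iso V (socle_module m \<theta> \<zeta>)"
proof -
  obtain u a b where "graded_generator V \<theta> m u a b"
    using graded_generator_exists [OF m V] .
  then interpret G: graded_generator V \<theta> m u a b .
  have simple: "sl2_simple V"
    using V by (simp add: graded_simple_of_rank_def)
  obtain \<zeta> where \<zeta>: "\<zeta> \<in> \<Psi> m \<omega>" "cohomologous m G.g (g_ratfun \<zeta>)"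
    using normal_form_exists [OF m G.g] .
  interpret N: normal_parameter m \<theta> \<omega> \<zeta>
    by unfold_locales
      (use m roots \<zeta> aperiodic_cohomologous [OF G.aperiodic_g [OF simple] \<zeta>(2)] in auto)
  obtain c where c: "c \<noteq> 0" "G.g * c = N.g * ratfun_shift (2 * of_nat m) c"
    using \<zeta>(2) by (auto simp: cohomologous_def)
  have V': "coord_embedding V \<theta> m N.g (\<lambda>v. right_mult c 0 (G.\<kappa> v))"
    by (rule embedding_right_mult [OF G.embedding c(1)]) (simp add: c(2))
  have "sl2_iso V (socle_module m \<theta> \<zeta>)"
    using sl2_iso_of_embeddings [OF V'] N.socle_embedding N.simple_image [OF V' simple] N.simple_image
    by metis
  moreover have "is_regular m \<omega> \<zeta>"
    using is_regular_iff [OF m] \<zeta>(1) N.aperiodic by blast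
  ultimately show ?thesis
    using that by blast
qed

theorem theoremA:
  fixes m :: nat and \<theta> :: complex and \<omega> :: real
  assumes "m > 0"
    and "\<And>z. poly ([:\<theta>:] - [:1, 1:]^2) z = 0 \<Longrightarrow> Re z < \<omega>"
  shows "(\<exists>\<Phi>. bij_betw \<Phi> (regular_orbits m \<omega>)
             ({V :: skew_laurent set sl2_struct. graded_simple_of_rank m \<theta> V} // sl2_iso_rel) \<and>
           (\<forall>\<zeta>. is_regular m \<omega> \<zeta> \<longrightarrow>
              \<Phi> (\<Psi>_orbit m \<omega> \<zeta>) = sl2_iso_rel `` {socle_module m \<theta> \<zeta>})) \<and>
         (\<forall>V :: 'v sl2_struct. graded_simple_of_rank m \<theta> V \<longrightarrow>
            (\<exists>\<zeta>. is_regular m \<omega> \<zeta> \<and> sl2_iso V (socle_module m \<theta> \<zeta>)))"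
proof -
  note m = assms(1)
  have roots: "Re z < \<omega>" if "poly (fe_poly \<theta>) z = 0" for z
    using assms(2) [of z] that unfolding poly_fe_poly_eq_0_iff by blast
  have N: "normal_parameter m \<theta> \<omega> \<zeta>" if "is_regular m \<omega> \<zeta>" for \<zeta>
    using that is_regular_iff [OF m] m roots by unfold_locales auto
  have socle: "graded_simple_of_rank m \<theta> (socle_module m \<theta> \<zeta>)" if "is_regular m \<omega> \<zeta>" for \<zeta>
    using normal_parameter.graded_simpleI [OF N [OF that]]
      normal_parameter.socle_embedding [OF N [OF that]] by blast
  then have socle_module: "sl2_module (socle_module m \<theta> \<zeta>)" if "is_regular m \<omega> \<zeta>" for \<zeta>
    using that by (simp add: graded_simple_of_rank_def sl2_simple_def)
  let ?C = "\<lambda>\<zeta>. sl2_iso_rel `` {socle_module m \<theta> \<zeta>}"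
  \<comment> \<open>Any member may represent its orbit, by \<open>class_eq\<close> below.\<close>
  let ?\<Phi> = "\<lambda>Y. ?C (SOME \<zeta>. \<zeta> \<in> Y)"
  have class_eq: "?C \<zeta> = ?C \<zeta>' \<longleftrightarrow> \<zeta> \<in> \<Psi>_orbit m \<omega> \<zeta>'"
    if "is_regular m \<omega> \<zeta>" "is_regular m \<omega> \<zeta>'" for \<zeta> \<zeta>'
    using that sl2_iso_rel_Image_eq_iff [OF socle_module socle_module] socle_iso_iff [OF N N] by simp
  have regular_member: "is_regular m \<omega> \<zeta>'" if "is_regular m \<omega> \<zeta>" "\<zeta>' \<in> \<Psi>_orbit m \<omega> \<zeta>" for \<zeta> \<zeta>'
    using that orbit_member [OF m _ that(2)] by (simp add: is_regular_def)
  have \<Phi>: "?\<Phi> (\<Psi>_orbit m \<omega> \<zeta>) = ?C \<zeta>" if reg: "is_regular m \<omega> \<zeta>" for \<zeta>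
  proof -
    have "\<zeta> \<in> \<Psi>_orbit m \<omega> \<zeta>"
      using orbit_self [OF m] reg by (simp add: is_regular_def)
    then have some: "(SOME \<zeta>'. \<zeta>' \<in> \<Psi>_orbit m \<omega> \<zeta>) \<in> \<Psi>_orbit m \<omega> \<zeta>"
      by (rule someI)
    then show ?thesis
      using class_eq [OF regular_member [OF reg some] reg] by simp
  qed
  have orbits: "regular_orbits m \<omega> = {\<Psi>_orbit m \<omega> \<zeta> | \<zeta>. is_regular m \<omega> \<zeta>}"
    unfolding regular_orbits_def orbits_def is_regular_def by blast
  have bij: "bij_betw ?\<Phi> (regular_orbits m \<omega>)
      ({V :: skew_laurent set sl2_struct. graded_simple_of_rank m \<theta> V} // sl2_iso_rel)"
    unfolding bij_betw_def
  proof
    show "inj_on ?\<Phi> (regular_orbits m \<omega>)"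
    proof (rule inj_onI)
      fix Y Y' assume "Y \<in> regular_orbits m \<omega>" "Y' \<in> regular_orbits m \<omega>" and eq: "?\<Phi> Y = ?\<Phi> Y'"
      then obtain \<zeta> \<zeta>' where \<zeta>: "is_regular m \<omega> \<zeta>" "Y = \<Psi>_orbit m \<omega> \<zeta>"
          "is_regular m \<omega> \<zeta>'" "Y' = \<Psi>_orbit m \<omega> \<zeta>'"
        by (auto simp: orbits)
      have "?C \<zeta> = ?C \<zeta>'"
        using eq \<Phi> [OF \<zeta>(1)] \<Phi> [OF \<zeta>(3)] unfolding \<zeta>(2,4) by simp
      then have "\<zeta> \<in> \<Psi>_orbit m \<omega> \<zeta>'"
        using class_eq \<zeta> by blast
      then show "Y = Y'"
        using orbit_member(2) [OF m] \<zeta> by (simp add: is_regular_def)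
    qed
    show "?\<Phi> ` regular_orbits m \<omega> =
        {V :: skew_laurent set sl2_struct. graded_simple_of_rank m \<theta> V} // sl2_iso_rel"
    proof (intro equalityI subsetI)
      fix c assume "c \<in> ?\<Phi> ` regular_orbits m \<omega>"
      then obtain \<zeta> where "is_regular m \<omega> \<zeta>" "c = ?C \<zeta>"
        using \<Phi> by (auto simp: orbits)
      then show "c \<in> {V :: skew_laurent set sl2_struct. graded_simple_of_rank m \<theta> V} // sl2_iso_rel"
        using socle by (simp add: quotientI)
    next
      fix c assume "c \<in> {V :: skew_laurent set sl2_struct. graded_simple_of_rank m \<theta> V} // sl2_iso_rel"
      then obtain V :: "skew_laurent set sl2_struct" where V: "graded_simple_of_rank m \<theta> V"
          "c = sl2_iso_rel `` {V}"
        by (auto simp: quotient_def)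
      obtain \<zeta> where \<zeta>: "is_regular m \<omega> \<zeta>" "sl2_iso V (socle_module m \<theta> \<zeta>)"
        using graded_simple_iso_socle [OF m roots V(1)] by blast
      have "sl2_module V"
        using V(1) by (simp add: graded_simple_of_rank_def sl2_simple_def)
      then have "c = ?C \<zeta>"
        using V(2) \<zeta> sl2_iso_rel_Image_eq_iff socle_module by blast
      then have "c = ?\<Phi> (\<Psi>_orbit m \<omega> \<zeta>)"
        using \<Phi> [OF \<zeta>(1)] by simp
      moreover have "\<Psi>_orbit m \<omega> \<zeta> \<in> regular_orbits m \<omega>"
        using \<zeta>(1) unfolding orbits by blast
      ultimately show "c \<in> ?\<Phi> ` regular_orbits m \<omega>"
        by (rule image_eqI)
    qed
  qed
  \<comment> \<open>The embedding puts no restriction on the carrier type, so modules on any other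
    type contribute no further isomorphism classes.\<close>
  have "\<exists>\<zeta>. is_regular m \<omega> \<zeta> \<and> sl2_iso V (socle_module m \<theta> \<zeta>)"
    if "graded_simple_of_rank m \<theta> V" for V :: "'v sl2_struct"
    using graded_simple_iso_socle [OF m roots that] by metis
  then show ?thesis
    using bij \<Phi> by (intro conjI exI [of _ ?\<Phi>]) simp_all
qed

end
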